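(* Let $A$ be a finite set of positive numbers, $M>0$, and let $0<d\le D<\infty$ be constants. For each $n$ and $\alpha\in A$ let $\bar\Pi_{n,\alpha}$ be a probability distribution on $\{\theta\in\mathbb R^{J_{n,\alpha}}:\theta^T1=0\}$ possessing a Lebesgue density that vanishes outside $[-M,M]^{J_{n,\alpha}}$ and on this block is bounded below by $d^{J_{n,\alpha}}$ and above by $D^{J_{n,\alpha}}$, and let $\Pi_{n,\alpha}$ be the distribution of $p_{J_{n,\alpha},\theta}$ for $\theta\sim\bar\Pi_{n,\alpha}$. Put $\varepsilon_{n,\alpha}=n^{-\alpha/(2\alpha+1)}$ and let the model weights be $$\lambda_{n,\alpha}\propto\prod_{\gamma\in A:\gamma<\alpha}(C\varepsilon_{n,\gamma})^{J_{n,\gamma}},\qquad\alpha\in A .$$ If $p_0\in C^\beta[0,1]$ for some $\beta\in A$, $\|\log p_0\|_\infty<\underline C_4M$, and the constant $C$ is sufficiently large, then there exists a constant $B$ such that, as $n\to\infty$, $$P_0^n\,\Pi_n\big(p:\|p-p_0\|_2\ge B\varepsilon_{n,\beta}\,\big|\,X_1,\dots,X_n\big)\to0,\qquad \varepsilon_{n,\beta}=n^{-\beta/(2\beta+1)} .$$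
   Context: $X_1,\dots,X_n$ are i.i.d. from a probability measure $P_0$ on $[0,1]$ with Lebesgue density $p_0$; $P_0^nT$ is the expectation of $T(X_1,\dots,X_n)$ under $P_0^n$; $\|\cdot\|_2$ is the $L_2[0,1]$-norm and $\|\cdot\|_\infty$ the supremum norm (maximum norm for vectors). $C^\beta[0,1]$ is the Hölder space of order $\beta$. Log spline models. For order $q\in\mathbb N$ and resolution $K\in\mathbb N$, the splines of order $q$ are the continuous functions $f:[0,1]\to\mathbb R$ that are $q-2$ times differentiable on $[0,1)$ and restrict to a polynomial of degree $<q$ on each interval $[(k-1)/K,k/K)$, $k=1,\dots,K$ (for $q=1$: piecewise constant functions). They form a vector space of dimension $J=q+K-1$ with B-spline basis $B_{J,1},\dots,B_{J,J}$ (de Boor): $B_{J,j}\ge0$, $\sum_jB_{J,j}\equiv1$, each $B_{J,j}$ is supported on an interval of length $q/K$, and at most $q$ of them are nonzero at any given point. For $\theta\in\mathbb R^J$ put $\theta^TB_J=\sum_j\theta_jB_{J,j}$ and $$p_{J,\theta}(x)=e^{\theta^TB_J(x)-c_J(\theta)},\qquad e^{c_J(\theta)}=\int_0^1e^{\theta^TB_J(x)}dx.$$ $\underline C_4>0$ is a constant such that $\underline C_4\|\theta\|_\infty\le\|\log p_{J,\theta}\|_\infty$ for every $J$ and every $\theta\in\mathbb R^J$ with $\theta^T1=0$, for the spline orders used. For each $\alpha$ the model uses splines of an order $q_\alpha\ge\alpha$ (not depending on $n$) and dimension $J_{n,\alpha}=\lfloor n^{1/(2\alpha+1)}\rfloor$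 ($n$ large enough that $J_{n,\alpha}\ge q_\alpha$ for all $\alpha\in A$). The posterior is $$\Pi_n(S|X_1,\dots,X_n)=\frac{\sum_{\alpha\in A}\lambda_{n,\alpha}\int_S\prod_{i=1}^np(X_i)\,d\Pi_{n,\alpha}(p)}{\sum_{\alpha\in A}\lambda_{n,\alpha}\int\prod_{i=1}^np(X_i)\,d\Pi_{n,\alpha}(p)}.$$ *)

theory Defs
  imports "HOL-Probability.Probability"
begin

section \<open>Norms and Hoelder spaces on the unit interval\<close>

text \<open>Functions on $[0,1]$ are represented by functions of type \<^typ>\<open>real \<Rightarrow> real\<close> of which only
  the values on \<^term>\<open>{0..1::real}\<close> matter.\<close>

definition unit_lebesgue :: "real measure" where
  "unit_lebesgue = restrict_space lborel {0..1}"

definition L2_dist :: "(real \<Rightarrow> real) \<Rightarrow> (real \<Rightarrow> real) \<Rightarrow> real" where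
  "L2_dist f g = sqrt (LINT x|unit_lebesgue. (f x - g x)\<^sup>2)"

text \<open>A supremum in \<^typ>\<open>real\<close>: it is the supremum norm only for functions that are bounded on
  the unit interval.\<close>

definition sup_norm :: "(real \<Rightarrow> real) \<Rightarrow> real" where
  "sup_norm f = (SUP x\<in>{0..1}. \<bar>f x\<bar>)"

definition max_norm :: "nat \<Rightarrow> (nat \<Rightarrow> real) \<Rightarrow> real" where
  "max_norm J \<theta> = Max ((\<lambda>j. \<bar>\<theta> j\<bar>) ` {..<J})"

text \<open>With $k$ the greatest integer strictly smaller than $\beta$, the functions in $C^\beta[0,1]$
  are $k$ times differentiable on $[0,1]$ (one-sidedly at the end points) with $k$th derivative
  Hoelder continuous of exponent $\beta - k \in (0,1]$. For integer $\beta$ the top derivative is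
  Lipschitz, so this contains the $\beta$ times continuously differentiable functions.\<close>

definition holder_space :: "real \<Rightarrow> (real \<Rightarrow> real) set" where
  "holder_space \<beta> = {f. let k = nat (\<lceil>\<beta>\<rceil> - 1) in
     \<exists>Df :: nat \<Rightarrow> real \<Rightarrow> real. Df 0 = f
       \<and> (\<forall>i<k. \<forall>x\<in>{0..1}. (Df i has_real_derivative Df (Suc i) x) (at x within {0..1}))
       \<and> (\<exists>L. \<forall>x\<in>{0..1}. \<forall>y\<in>{0..1}. \<bar>Df k x - Df k y\<bar> \<le> L * \<bar>x - y\<bar> powr (\<beta> - real k))}"


section \<open>B-splines and log spline densities\<close>

text \<open>The Cox--de Boor recursion, indexed by the degree (order minus one). Quotients with a vanishing
  denominator (coincident knots) are $0$, which is the usual convention. B-splines are right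
  continuous, except that at the right end point $1$ they take their left limit: the last
  nondegenerate knot interval is closed, without which they would not sum to one at $1$.\<close>

fun bspline :: "(nat \<Rightarrow> real) \<Rightarrow> nat \<Rightarrow> nat \<Rightarrow> real \<Rightarrow> real" where
  "bspline t 0 i x =
     (if t i \<le> x \<and> x < t (Suc i) \<or> t i < 1 \<and> t (Suc i) = 1 \<and> x = 1 then 1 else 0)"
| "bspline t (Suc m) i x =
     (x - t i) / (t (i + m + 1) - t i) * bspline t m i x
     + (t (i + m + 2) - x) / (t (i + m + 2) - t (i + 1)) * bspline t m (i + 1) x"

text \<open>Knots for order $q$ and resolution $K$: $0$ repeated $q$ times, then
  $1/K,\dots,(K-1)/K$, then $1$ repeated. The truncated subtraction produces the repeated $0$.\<close>

definition knot :: "nat \<Rightarrow> nat \<Rightarrow> nat \<Rightarrow> real" where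
  "knot q K i = real (min K (i - (q - 1))) / real K"

text \<open>The basis function $B_{J,j+1}$ of order $q$, for $j < J$; the resolution is
  $K = J - q + 1$, which is positive if $q \le J$.\<close>

definition B_spline :: "nat \<Rightarrow> nat \<Rightarrow> nat \<Rightarrow> real \<Rightarrow> real" where
  "B_spline q J j = bspline (knot q (J + 1 - q)) (q - 1) j"

definition spline_comb :: "nat \<Rightarrow> nat \<Rightarrow> (nat \<Rightarrow> real) \<Rightarrow> real \<Rightarrow> real" where
  "spline_comb q J \<theta> x = (\<Sum>j<J. \<theta> j * B_spline q J j x)"

definition log_norm_const :: "nat \<Rightarrow> nat \<Rightarrow> (nat \<Rightarrow> real) \<Rightarrow> real" where
  "log_norm_const q J \<theta> = ln (LINT x|unit_lebesgue. exp (spline_comb q J \<theta> x))"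

definition log_spline :: "nat \<Rightarrow> nat \<Rightarrow> (nat \<Rightarrow> real) \<Rightarrow> real \<Rightarrow> real" where
  "log_spline q J \<theta> x = exp (spline_comb q J \<theta> x - log_norm_const q J \<theta>)"


section \<open>Priors\<close>

text \<open>$\mathbb R^J$ is modelled by the functions in \<^term>\<open>extensional {..<J}\<close>, the space of
  \<^term>\<open>PiM {..<J} (\<lambda>_. borel)\<close>.\<close>

definition zero_sum_hyperplane :: "nat \<Rightarrow> (nat \<Rightarrow> real) set" where
  "zero_sum_hyperplane J = {\<theta> \<in> extensional {..<J}. (\<Sum>j<J. \<theta> j) = 0}"

text \<open>Lebesgue measure, that is ($J-1$)-dimensional volume, on the zero-sum hyperplane, as a measure
  on $\mathbb R^J$ concentrated on that hyperplane. The hyperplane is parametrized linearly by its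
  first $J-1$ coordinates; the Gram determinant of this parametrization is $J$, whence the
  factor $\sqrt J$.\<close>

definition hyperplane_lebesgue :: "nat \<Rightarrow> (nat \<Rightarrow> real) measure" where
  "hyperplane_lebesgue J = scale_measure (ennreal (sqrt (real J)))
     (distr (PiM {..<J - 1} (\<lambda>_. lborel)) (PiM {..<J} (\<lambda>_. borel))
       (\<lambda>\<theta>. \<lambda>j\<in>{..<J}. if j = J - 1 then - (\<Sum>i<J - 1. \<theta> i) else \<theta> j))"

definition coefficient_prior :: "real \<Rightarrow> real \<Rightarrow> real \<Rightarrow> nat \<Rightarrow> (nat \<Rightarrow> real) measure \<Rightarrow> bool" where
  "coefficient_prior M d D J \<mu> \<longleftrightarrow> prob_space \<mu> \<and>
     (\<exists>g \<in> borel_measurable (PiM {..<J} (\<lambda>_. borel)).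
        \<mu> = density (hyperplane_lebesgue J) (\<lambda>\<theta>. ennreal (g \<theta>)) \<and>
        (\<forall>\<theta>\<in>zero_sum_hyperplane J.
           if \<forall>j<J. \<theta> j \<in> {-M..M} then d ^ J \<le> g \<theta> \<and> g \<theta> \<le> D ^ J else g \<theta> = 0))"

text \<open>The measurable space of square integrable probability densities on $[0,1]$. Its
  $\sigma$-algebra makes the point evaluations measurable, so that likelihoods can be integrated, and
  contains the $L_2$-balls around its elements.\<close>

definition densities :: "(real \<Rightarrow> real) set" where
  "densities = {p \<in> borel_measurable unit_lebesgue. (\<forall>x\<in>{0..1}. 0 \<le> p x)
     \<and> (\<integral>\<^sup>+x. ennreal (p x) \<partial>unit_lebesgue) = 1 \<and> integrable unit_lebesgue (\<lambda>x. (p x)\<^sup>2)}"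

definition density_space :: "(real \<Rightarrow> real) measure" where
  "density_space = sigma densities
     ({{p \<in> densities. p x \<le> a} | x a. x \<in> {0..1}} \<union>
      {{p \<in> densities. L2_dist p f \<le> r} | f r. f \<in> densities})"

definition log_spline_prior :: "nat \<Rightarrow> nat \<Rightarrow> (nat \<Rightarrow> real) measure \<Rightarrow> (real \<Rightarrow> real) measure" where
  "log_spline_prior q J \<mu> = distr \<mu> density_space (log_spline q J)"

definition model_dim :: "nat \<Rightarrow> real \<Rightarrow> nat" where
  "model_dim n \<alpha> = nat \<lfloor>real n powr (1 / (2 * \<alpha> + 1))\<rfloor>"

definition rate :: "nat \<Rightarrow> real \<Rightarrow> real" where
  "rate n \<alpha> = real n powr (- \<alpha> / (2 * \<alpha> + 1))"

definition raw_weight :: "real set \<Rightarrow> real \<Rightarrow> nat \<Rightarrow> real \<Rightarrow> real" where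
  "raw_weight A C n \<alpha> = (\<Prod>\<gamma>\<in>{\<gamma>\<in>A. \<gamma> < \<alpha>}. (C * rate n \<gamma>) ^ model_dim n \<gamma>)"

definition model_weight :: "real set \<Rightarrow> real \<Rightarrow> nat \<Rightarrow> real \<Rightarrow> real" where
  "model_weight A C n \<alpha> = raw_weight A C n \<alpha> / (\<Sum>\<gamma>\<in>A. raw_weight A C n \<gamma>)"


section \<open>Posterior distribution\<close>

text \<open>The observations $X_1,\dots,X_n$ are represented by \<^term>\<open>X 0\<close>, ..., \<^term>\<open>X (n - 1)\<close>.\<close>

definition posterior ::
    "real set \<Rightarrow> (real \<Rightarrow> real) \<Rightarrow> (real \<Rightarrow> (real \<Rightarrow> real) measure) \<Rightarrow> nat \<Rightarrow>
     (nat \<Rightarrow> real) \<Rightarrow> (real \<Rightarrow> real) set \<Rightarrow> real" where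
  "posterior A w Pr n X S =
     (\<Sum>\<alpha>\<in>A. w \<alpha> * (LINT p:S|Pr \<alpha>. (\<Prod>i<n. p (X i)))) /
     (\<Sum>\<alpha>\<in>A. w \<alpha> * (LINT p|Pr \<alpha>. (\<Prod>i<n. p (X i))))"

end

theory Submission
  imports Defs "HOL-Computational_Algebra.Polynomial" "HOL-Real_Asymp.Real_Asymp"
begin

text \<open>
  Write \<open>d(\<theta>)\<close> for the \<open>L\<^sub>2\<close>-distance of \<open>p\<^sub>\<theta>\<close> and \<open>p\<^sub>0\<close>.
  In each model the root likelihood ratio, averaged over the coefficient cube, has expectation at most
  \<open>\<integral> exp (- c n d(\<theta>)\<^sup>2) d\<theta>\<close>, while its inverse is controlled by averaging over small cubes around a
  coefficient vector (Cauchy-Schwarz). Thresholding this average gives a test which bounds the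
  integrated likelihood of any far set by \<open>exp (- J) + k (R \<epsilon>)\<^sup>J exp (- c n \<rho>\<^sup>2)\<close>,
  with no covering numbers.

  The Gaussian integral is at most of order \<open>(R \<epsilon>)\<^sup>J\<close>. Indeed \<open>d(\<theta>)\<close> dominates the
  differences of the averages of \<open>ln p\<^sub>\<theta> - ln p\<^sub>0\<close> over neighbouring knot intervals, and these
  are, up to a shift, a triangular linear function of \<open>\<theta>\<close>.

  The evidence of the model of index \<open>\<beta>\<close> is at least of order \<open>(c \<epsilon>\<^sub>\<beta>)\<^sup>J\<close>, because a
  spline quasi-interpolant of \<open>ln p\<^sub>0\<close> (Marsden's identity) is \<open>\<epsilon>\<^sub>\<beta>\<close>-close to \<open>ln p\<^sub>0\<close>.
  For \<open>\<alpha> < \<beta>\<close> the weight ratio contributes \<open>(C \<epsilon>\<^sub>\<alpha>)\<^sup>-\<^sup>J\<close>, which beats \<open>(R \<epsilon>\<^sub>\<alpha>)\<^sup>J\<close>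
  for large \<open>C\<close> since \<open>J\<^sub>\<beta> ln n\<close> is of smaller order than \<open>J\<^sub>\<alpha>\<close>; for
  \<open>\<alpha> \<ge> \<beta>\<close> the factor \<open>exp (- c n \<rho>\<^sup>2)\<close> with \<open>\<rho> = B \<epsilon>\<^sub>\<beta>\<close> suffices.
\<close>

section \<open>B-splines and Marsden's identity\<close>

text \<open>The obstacle is the models with \<alpha> < \<beta>. Their dimension is of larger order
  than n \<epsilon>_\<beta>^2, so at distance B \<epsilon>_\<beta> the exponential factor cannot
  outweigh terms that are exponential in J_\<alpha>. What is required is a bound that is small
  because little prior mass lies near p0, with one power of \<epsilon>_\<alpha> per coordinate.
  Hence the Gaussian factor is integrated over the coefficients instead of being bounded by its
  supremum. The power comes out right as follows. The averaged statistic has expectation at most V,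
  of order \<epsilon>^J up to exponential factors, and the threshold is V e^J. Inverting the average
  over a cube of side \<epsilon> costs its volume \<epsilon>^(J-1), and integrating over the prior
  gives a second factor V. The quotient V V / \<epsilon>^(J-1) is again of order \<epsilon>^J. A
  side as large as \<epsilon> is affordable only because the perturbation of the density enters
  quadratically: n \<epsilon>^2 is of order J, whereas a linear error n \<epsilon> would be far too
  large. Square roots are taken because the likelihood ratio itself has expectation one at every
  coefficient vector.\<close>

lemma bspline_supp:
  assumes "mono t" "\<And>i. t i \<le> 1" "bspline t m i x \<noteq> 0"
  shows "t i \<le> x \<and> (x < t (i + m + 1) \<or> x = 1 \<and> t i < 1 \<and> t (i + m + 1) = 1)"
  using assms(3)
proof (induction m arbitrary: i)
  case 0
  then show ?case by (auto split: if_splits)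
next
  case (Suc m)
  have le: "t i \<le> t (i + 1)" "t (i + m + 1) \<le> t (i + m + 2)"
    using assms(1) by (auto intro: monoD)
  consider "bspline t m i x \<noteq> 0" | "bspline t m (i + 1) x \<noteq> 0"
    using Suc.prems by fastforce
  then show ?case
  proof cases
    case 1
    from Suc.IH[OF 1] le assms(2)[of "i + m + 2"] show ?thesis by (auto simp: algebra_simps)
  next
    case 2
    from Suc.IH[OF 2] le show ?thesis by (auto simp: algebra_simps)
  qed
qed

text \<open>Supplies the boundary terms in Marsden's identity: the index shift there reaches splines
  whose knots all coincide.\<close>

lemma bspline_zero_if_coincident:
  assumes "mono t" "\<And>i. t i \<le> 1" "t i = t (i + m + 1)"
  shows "bspline t m i x = 0"
  using bspline_supp[OF assms(1,2), of m i x] assms(3) by force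

lemma bspline_nonneg:
  assumes "mono t" "\<And>i. t i \<le> 1"
  shows "0 \<le> bspline t m i x"
proof (induction m arbitrary: i)
  case 0
  show ?case by simp
next
  case (Suc m)
  have le: "t i \<le> t (i + m + 1)" "t (i + 1) \<le> t (i + m + 2)"
    using assms(1) by (auto intro: monoD)
  have 1: "0 \<le> (x - t i) / (t (i + m + 1) - t i) * bspline t m i x"
  proof (cases "bspline t m i x = 0")
    case False
    with bspline_supp[OF assms False] Suc.IH[of i] le show ?thesis by auto
  qed simp
  have 2: "0 \<le> (t (i + m + 2) - x) / (t (i + m + 2) - t (i + 1)) * bspline t m (i + 1) x"
  proof (cases "bspline t m (i + 1) x = 0")
    case False
    with bspline_supp[OF assms False] Suc.IH[of "i + 1"] le show ?thesis
      by (auto simp: algebra_simps intro!: mult_nonneg_nonneg divide_nonneg_nonneg)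
  qed simp
  show ?case using 1 2 by simp
qed

text \<open>The dual polynomial of Marsden's identity, the product of the t_(i+l) - z, in the
  variable y = \<tau> - z. Centring at \<tau> lets the coefficients of powers of x - \<tau> be read
  off directly.\<close>

definition knot_poly :: "(nat \<Rightarrow> real) \<Rightarrow> nat \<Rightarrow> nat \<Rightarrow> real \<Rightarrow> real poly" where
  "knot_poly t m i \<tau> = (\<Prod>l=1..m. [:t (i + l) - \<tau>, 1:])"

lemma knot_poly_0 [simp]: "knot_poly t 0 i \<tau> = 1"
  by (simp add: knot_poly_def)

lemma knot_poly_Suc: "knot_poly t (Suc m) i \<tau> = [:t (i + m + 1) - \<tau>, 1:] * knot_poly t m i \<tau>"
  by (simp add: knot_poly_def prod.nat_ivl_Suc' algebra_simps)

lemma knot_poly_Suc_left: "knot_poly t (Suc m) i \<tau> = [:t (i + 1) - \<tau>, 1:] * knot_poly t m (i + 1) \<tau>"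
proof -
  have "(\<Prod>l=1..Suc m. [:t (i + l) - \<tau>, 1:]) = [:t (i + 1) - \<tau>, 1:] * (\<Prod>l=Suc 1..Suc m. [:t (i + l) - \<tau>, 1:])"
    by (subst prod.atLeast_Suc_atMost) auto
  also have "(\<Prod>l=Suc 1..Suc m. [:t (i + l) - \<tau>, 1:]) = (\<Prod>l=1..m. [:t (i + 1 + l) - \<tau>, 1:])"
    by (subst prod.shift_bounds_cl_Suc_ivl) (simp add: algebra_simps)
  finally show ?thesis by (simp add: knot_poly_def)
qed

text \<open>The indicators of half-open knot intervals telescope. At x = 1 they would all vanish,
  and the interval that is closed there is found by telescoping the condition \<open>t i < 1\<close>
  instead.\<close>

lemma bspline_0_sum:
  assumes "mono t" "\<And>i. t i \<le> 1" "t 0 = 0" "t J = 1" "x \<in> {0..1}"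
  shows "(\<Sum>i<J. bspline t 0 i x) = 1"
proof -
  have m: "t i \<le> t (Suc i)" for i using assms(1) by (auto intro: monoD)
  show ?thesis
  proof (cases "x = 1")
    case True
    have "(\<Sum>i<J. bspline t 0 i x) = (\<Sum>i<J. of_bool (t i < 1) - of_bool (t (Suc i) < 1))"
    proof (intro sum.cong refl)
      fix i
      show "bspline t 0 i x = of_bool (t i < 1) - of_bool (t (Suc i) < 1)"
        using True m[of i] assms(2)[of i] assms(2)[of "Suc i"] by auto
    qed
    then show ?thesis using assms(3,4) sum_lessThan_telescope'[of "\<lambda>i. of_bool (t i < 1) :: real" J] by simp
  next
    case False
    have "(\<Sum>i<J. bspline t 0 i x) = (\<Sum>i<J. of_bool (t i \<le> x) - of_bool (t (Suc i) \<le> x))"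
    proof (intro sum.cong refl)
      fix i
      show "bspline t 0 i x = of_bool (t i \<le> x) - of_bool (t (Suc i) \<le> x)"
        using False m[of i] by auto
    qed
    then show ?thesis using assms False sum_lessThan_telescope'[of "\<lambda>i. of_bool (t i \<le> x) :: real" J] by simp
  qed
qed

text \<open>Induction on the degree. The recursion weights \<open>v\<close> and \<open>w\<close> are
  those of linear interpolation between t_i and t_(i+m+1), so they average the linear factors
  t_(i+m+1) - \<tau> + y and t_i - \<tau> + y to x - \<tau> + y, which does not depend on i and can
  be pulled out of the sum.\<close>

lemma marsden:
  assumes "mono t" "\<And>i. t i \<le> 1" "\<And>j. j \<le> N \<Longrightarrow> t j = 0" "t J = 1" "x \<in> {0..1}" "m \<le> N"
  shows "(\<Sum>i<J. smult (bspline t m i x) (knot_poly t m i \<tau>)) = [:x - \<tau>, 1:] ^ m"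
  using assms(6)
proof (induction m)
  case 0
  have "(\<Sum>i<J. smult (bspline t 0 i x) 1) = smult (\<Sum>i<J. bspline t 0 i x) 1"
    by (simp only: smult_sum)
  also have "\<dots> = 1" using bspline_0_sum[OF assms(1,2) _ assms(4,5)] assms(3)[of 0] by simp
  finally show ?case by (simp only: knot_poly_0) simp
next
  case (Suc m)
  let ?b = "\<lambda>i. bspline t m i x"
  define v where "v i = (x - t i) / (t (i + m + 1) - t i) * ?b i" for i
  define w where "w i = (t (i + m + 1) - x) / (t (i + m + 1) - t i) * ?b i" for i
  define L where "L i = [:t (i + m + 1) - \<tau>, 1:] * knot_poly t m i \<tau>" for i
  define L' where "L' i = [:t i - \<tau>, 1:] * knot_poly t m i \<tau>" for i
  \<comment> \<open>The shift of the summation index creates terms at 0 and at J. Both vanish, since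
    the first m + 2 knots are all 0 and the knots from J on are all 1.\<close>
  have b0: "?b 0 = 0" using Suc.prems assms(3)[of 0] assms(3)[of "m+1"]
    by (intro bspline_zero_if_coincident assms(1,2)) auto
  have "t J \<le> t (J + m + 1)" using assms(1) by (auto intro: monoD)
  then have bJ: "?b J = 0" using assms(2)[of "J + m + 1"] assms(4)
    by (intro bspline_zero_if_coincident assms(1,2)) auto
  have "(\<Sum>i<J. smult (bspline t (Suc m) i x) (knot_poly t (Suc m) i \<tau>))
     = (\<Sum>i<J. smult (v i) (L i)) + (\<Sum>i<J. smult (w (Suc i)) (L' (Suc i)))"
  proof (subst sum.distrib[symmetric], intro sum.cong refl)
    fix i
    have "bspline t (Suc m) i x = v i + w (Suc i)"
      by (simp add: v_def w_def)
    moreover have "knot_poly t (Suc m) i \<tau> = L i" by (simp only: knot_poly_Suc L_def)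
    moreover have "L' (Suc i) = L i"
      unfolding L_def L'_def using knot_poly_Suc[of t m i \<tau>] knot_poly_Suc_left[of t m i \<tau>]
      by (simp only: Suc_eq_plus1)
    ultimately show "smult (bspline t (Suc m) i x) (knot_poly t (Suc m) i \<tau>) = smult (v i) (L i) + smult (w (Suc i)) (L' (Suc i))"
      by (simp only: smult_add_left)
  qed
  also have "(\<Sum>i<J. smult (w (Suc i)) (L' (Suc i))) = (\<Sum>i<Suc J. smult (w i) (L' i))"
    by (subst sum.lessThan_Suc_shift) (simp add: w_def b0)
  also have "\<dots> = (\<Sum>i<J. smult (w i) (L' i))" by (simp add: w_def bJ)
  also have "(\<Sum>i<J. smult (v i) (L i)) + (\<Sum>i<J. smult (w i) (L' i))
      = (\<Sum>i<J. [:x - \<tau>, 1:] * smult (?b i) (knot_poly t m i \<tau>))"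
  proof (subst sum.distrib[symmetric], intro sum.cong refl)
    fix i
    show "smult (v i) (L i) + smult (w i) (L' i) = [:x - \<tau>, 1:] * smult (?b i) (knot_poly t m i \<tau>)"
    proof (cases "?b i = 0")
      case False
      have ne: "t (i + m + 1) - t i \<noteq> 0"
        using bspline_zero_if_coincident[OF assms(1,2), of i m x] False by auto
      have vw: "v i + w i = ?b i"
        unfolding v_def w_def using ne by (simp add: divide_simps) (simp add: algebra_simps)
      have vt: "v i * (t (i + m + 1) - \<tau>) + w i * (t i - \<tau>) = ?b i * (x - \<tau>)"
        unfolding v_def w_def using ne by (simp add: divide_simps) (simp add: algebra_simps)
      have "smult (v i) (L i) + smult (w i) (L' i)
        = (smult (v i) [:t (i + m + 1) - \<tau>, 1:] + smult (w i) [:t i - \<tau>, 1:]) * knot_poly t m i \<tau>"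
        by (simp only: L_def L'_def distrib_right mult_smult_left)
      also have "smult (v i) [:t (i + m + 1) - \<tau>, 1:] + smult (w i) [:t i - \<tau>, 1:] = smult (?b i) [:x - \<tau>, 1:]"
        using vw vt by simp
      finally show ?thesis by (simp only: mult_smult_left mult_smult_right)
    qed (simp add: v_def w_def)
  qed
  also have "\<dots> = [:x - \<tau>, 1:] ^ Suc m"
    using Suc by (simp only: sum_distrib_left[symmetric] power_Suc)
  finally show ?case .
qed

lemma coeff_linear_times: "coeff ([:a, 1:] * p) i = a * coeff p i + (if i = 0 then 0 else coeff p (i - 1))"
  for a :: real
  by (simp add: coeff_pCons split: nat.splits)

text \<open>Moving \<tau> translates the variable y, so the derivative in \<tau> is minus the
  derivative in y, here taken coefficient by coefficient.\<close>

lemma coeff_knot_poly_deriv: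
  "((\<lambda>\<tau>. coeff (knot_poly t m i \<tau>) r) has_real_derivative - real (r + 1) * coeff (knot_poly t m i \<tau>) (r + 1)) (at \<tau> within S)"
proof (induction m arbitrary: r)
  case 0
  show ?case by (simp add: knot_poly_def)
next
  case (Suc m)
  show ?case
  proof (cases r)
    case 0
    show ?thesis unfolding knot_poly_Suc coeff_linear_times 0
      by (auto intro!: derivative_eq_intros Suc.IH[of 0, simplified] simp: algebra_simps)
  next
    case (Suc r')
    show ?thesis unfolding knot_poly_Suc coeff_linear_times Suc
      by (auto intro!: derivative_eq_intros Suc.IH[of "Suc r'", simplified] Suc.IH[of r', simplified] simp: algebra_simps)
  qed
qed

lemma coeff_knot_poly_eq_0:
  assumes "m < r"
  shows "coeff (knot_poly t m i \<tau>) r = 0"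
proof (rule coeff_eq_0)
  have "degree (knot_poly t m i \<tau>) \<le> (\<Sum>l=1..m. degree [:t (i + l) - \<tau>, 1:])"
    unfolding knot_poly_def using degree_prod_sum_le[of "{1..m}" "\<lambda>l. [:t (i + l) - \<tau>, 1:]"] by (simp add: o_def)
  then show "degree (knot_poly t m i \<tau>) < r" using assms by simp
qed

lemma coeff_knot_poly_bound:
  assumes "\<And>l. 1 \<le> l \<Longrightarrow> l \<le> m \<Longrightarrow> \<bar>t (i + l) - \<tau>\<bar> \<le> U"
  shows "\<bar>coeff (knot_poly t m i \<tau>) r\<bar> \<le> 2 ^ m * U ^ (m - r)"
  using assms
proof (induction m arbitrary: r)
  case 0
  show ?case by (simp add: knot_poly_def coeff_eq_0 split: nat.splits)
next
  case (Suc m)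
  have U: "\<bar>t (i + Suc m) - \<tau>\<bar> \<le> U" "0 \<le> U" using Suc.prems[of "Suc m"] by auto
  have IH: "\<bar>coeff (knot_poly t m i \<tau>) r\<bar> \<le> 2 ^ m * U ^ (m - r)" for r
    using Suc by auto
  have deg: "coeff (knot_poly t m i \<tau>) r = 0" if "m < r" for r
    using that by (rule coeff_knot_poly_eq_0)
  have 1: "\<bar>(t (i + m + 1) - \<tau>) * coeff (knot_poly t m i \<tau>) r\<bar> \<le> 2 ^ m * U ^ (Suc m - r)"
  proof (cases "r \<le> m")
    case True
    have "\<bar>(t (i + m + 1) - \<tau>) * coeff (knot_poly t m i \<tau>) r\<bar> \<le> U * (2 ^ m * U ^ (m - r))"
      unfolding abs_mult using U IH[of r] by (intro mult_mono) auto
    then show ?thesis using True by (simp add: Suc_diff_le algebra_simps)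
  qed (use deg U in auto)
  have 2: "\<bar>if r = 0 then 0 else coeff (knot_poly t m i \<tau>) (r - 1)\<bar> \<le> 2 ^ m * U ^ (Suc m - r)"
    using IH[of "r - 1"] U by (cases r) auto
  have "\<bar>coeff (knot_poly t (Suc m) i \<tau>) r\<bar> \<le> 2 ^ m * U ^ (Suc m - r) + 2 ^ m * U ^ (Suc m - r)"
    unfolding knot_poly_Suc coeff_linear_times using 1 2 by linarith
  then show ?case by simp
qed

section \<open>Spline quasi-interpolation\<close>

lemma mono_knot: "mono (knot q K)"
  unfolding knot_def by (intro monoI divide_right_mono) auto

lemma knot_le_1: "knot q K i \<le> 1"
  unfolding knot_def by (cases "K = 0") (auto simp: divide_simps)

lemma knot_nonneg: "0 \<le> knot q K i"
  unfolding knot_def by simp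

lemma knot_eq_0: "j \<le> q - 1 \<Longrightarrow> knot q K j = 0"
  unfolding knot_def by simp

lemma knot_inner: "1 \<le> q \<Longrightarrow> m \<le> K \<Longrightarrow> knot q K (m + q - 1) = real m / real K"
  unfolding knot_def by simp

lemma knot_diff_le: "knot q K (i + l) - knot q K i \<le> real l / real K"
proof -
  have "real (min K (i + l - (q - 1))) \<le> real (min K (i - (q - 1))) + real l" by linarith
  then have "real (min K (i + l - (q - 1))) / real K \<le> (real (min K (i - (q - 1))) + real l) / real K"
    by (intro divide_right_mono) auto
  then show ?thesis unfolding knot_def by (simp add: add_divide_distrib)
qed

locale spline_basis =
  fixes q J :: nat
  assumes q1: "1 \<le> q" and qJ: "q \<le> J"
begin

definition K where "K = J + 1 - q"
abbreviation t where "t \<equiv> knot q K"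

lemma K1: "1 \<le> K" using qJ by (simp add: K_def)

lemma J_eq: "J = K + q - 1" using qJ q1 by (simp add: K_def)

lemma tJ: "t J = 1" using K1 knot_inner[OF q1, of K K] J_eq by simp

lemma B_spline_eq: "B_spline q J j = bspline t (q - 1) j"
  by (simp add: B_spline_def K_def)

lemma B_spline_nonneg: "0 \<le> B_spline q J j x"
  unfolding B_spline_eq by (intro bspline_nonneg mono_knot knot_le_1)

lemma B_spline_supp:
  assumes "B_spline q J j x \<noteq> 0"
  shows "t j \<le> x" "x \<le> t (j + q)"
  using bspline_supp[OF mono_knot knot_le_1, of q K "q - 1" j x] assms q1 by (auto simp: B_spline_eq)

text \<open>The coefficients for which \<open>\<Sum>j. xi r j \<tau> * B j x\<close> is \<open>(x - \<tau>) ^ r\<close> (Marsden's identity).\<close>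

definition xi where
  "xi r j \<tau> = coeff (knot_poly t (q - 1) j \<tau>) (q - 1 - r) / real ((q - 1) choose r)"

text \<open>Marsden's identity with its centre at the evaluation point: the right-hand side becomes
  y^(q-1), and coefficients are compared.\<close>

lemma B_spline_reproduce:
  assumes "x \<in> {0..1}" "r \<le> q - 1"
  shows "(\<Sum>j<J. B_spline q J j x * xi r j x) = of_bool (r = 0)"
proof -
  have "(\<Sum>j<J. smult (B_spline q J j x) (knot_poly t (q - 1) j x)) = [:0, 1:] ^ (q - 1)"
    using marsden[OF mono_knot knot_le_1 knot_eq_0 tJ assms(1) order.refl, of "q - 1" x]
    by (simp add: B_spline_eq)
  from arg_cong[where f = "\<lambda>p. coeff p (q - 1 - r)", OF this]
  have "(\<Sum>j<J. B_spline q J j x * coeff (knot_poly t (q - 1) j x) (q - 1 - r)) = of_bool (q - 1 = q - 1 - r)"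
    by (simp add: coeff_sum monom_altdef[of 1 "q - 1", symmetric, simplified])
  also have "(q - 1 = q - 1 - r) = (r = 0)" using assms(2) by auto
  finally show ?thesis using assms(2)
    unfolding xi_def by (cases "r = 0") (auto simp flip: sum_divide_distrib)
qed

lemma xi_0: assumes "x \<in> {0..1}" shows "xi 0 j x = 1"
proof -
  have "coeff (knot_poly t m j x) m = 1" for m
    by (induction m) (auto simp: knot_poly_Suc coeff_linear_times coeff_knot_poly_eq_0 simp del: mult_pCons_left)
  then show ?thesis by (simp add: xi_def)
qed

lemma B_spline_sum: "x \<in> {0..1} \<Longrightarrow> (\<Sum>j<J. B_spline q J j x) = 1"
  using B_spline_reproduce[of x 0] by (simp add: xi_0)

lemma spline_comb_abs_le:
  assumes "x \<in> {0..1}" "\<And>j. j < J \<Longrightarrow> \<bar>\<theta> j\<bar> \<le> b"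
  shows "\<bar>spline_comb q J \<theta> x\<bar> \<le> b"
proof -
  have "\<bar>spline_comb q J \<theta> x\<bar> \<le> (\<Sum>j<J. b * B_spline q J j x)"
    unfolding spline_comb_def using assms(2) B_spline_nonneg
    by (intro order_trans[OF sum_abs] sum_mono) (auto simp: abs_mult intro!: mult_right_mono)
  then show ?thesis using B_spline_sum[OF assms(1)] by (simp flip: sum_distrib_left)
qed

text \<open>Mirrors the derivative of (x - \<tau>)^r with respect to \<tau>. For r = 0 the truncated
  index r - 1 is harmless because of the factor r.\<close>

lemma xi_deriv:
  assumes "r \<le> q - 1"
  shows "(xi r j has_real_derivative - real r * xi (r - 1) j \<tau>) (at \<tau> within S)"
proof (cases r)
  case 0
  have "((\<lambda>\<tau>. coeff (knot_poly t (q - 1) j \<tau>) (q - 1)) has_real_derivative 0) (at \<tau> within S)"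
    using coeff_knot_poly_deriv[of t "q - 1" j "q - 1" \<tau> S] by (simp add: coeff_knot_poly_eq_0)
  then show ?thesis unfolding xi_def[abs_def] 0 by simp
next
  case (Suc r')
  have s: "q - 1 - r + 1 = q - 1 - (r - 1)" using Suc assms by auto
  have b: "real ((q - 1) choose (r - 1)) * real (q - 1 - (r - 1)) = real r * real ((q - 1) choose r)"
  proof -
    have "(q - 1 - r') * ((q - 1) choose r') = Suc r' * ((q - 1) choose Suc r')"
      unfolding binomial_absorb_comp binomial_absorption ..
    then have "((q - 1) choose (r - 1)) * (q - 1 - (r - 1)) = r * ((q - 1) choose r)"
      unfolding Suc by (simp only: diff_Suc_1 mult.commute)
    then show ?thesis by (simp only: of_nat_mult[symmetric])
  qed
  have nz: "real ((q - 1) choose (r - 1)) \<noteq> 0" "real ((q - 1) choose r) \<noteq> 0" using Suc assms by auto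
  have "real (q - 1 - (r - 1)) / real ((q - 1) choose r) = real r / real ((q - 1) choose (r - 1))"
    using b nz by (simp only: frac_eq_eq[OF nz(2,1)] mult.commute)
  then have e: "- real (q - 1 - (r - 1)) * c / real ((q - 1) choose r) = - real r * (c / real ((q - 1) choose (r - 1)))" for c
    by (simp only: mult_minus_left times_divide_eq_left[symmetric] minus_divide_left[symmetric] times_divide_eq_right)
  show ?thesis
    unfolding xi_def[abs_def]
    by (rule DERIV_cong[OF DERIV_cdivide[OF coeff_knot_poly_deriv]]) (simp only: s e)
qed

lemma xi_bound:
  assumes "\<And>l. 1 \<le> l \<Longrightarrow> l \<le> q - 1 \<Longrightarrow> \<bar>t (j + l) - \<tau>\<bar> \<le> U" "r \<le> q - 1"
  shows "\<bar>xi r j \<tau>\<bar> \<le> 2 ^ (q - 1) * U ^ r"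
proof -
  have "1 \<le> real ((q - 1) choose r)" using zero_less_binomial[OF assms(2)] by linarith
  then have "\<bar>xi r j \<tau>\<bar> \<le> \<bar>coeff (knot_poly t (q - 1) j \<tau>) (q - 1 - r)\<bar> / 1"
    using assms(2) unfolding xi_def abs_divide by (intro divide_left_mono) auto
  also have "\<dots> \<le> 2 ^ (q - 1) * U ^ r"
    using coeff_knot_poly_bound[of "q - 1" t j \<tau> U "q - 1 - r", OF assms(1)] diff_diff_cancel[OF assms(2)] by (simp only: div_by_1)
  finally show ?thesis .
qed

text \<open>Coefficient number j of the spline that reproduces the Taylor polynomial of degree k
  about \<tau>. The quasi-interpolant uses a different centre, \<tau> = \<open>t j\<close>, for each
  j.\<close>

definition quasi_coeff where
  "quasi_coeff Df k j \<tau> = (\<Sum>r\<le>k. Df r \<tau> / fact r * xi r j \<tau>)"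

text \<open>A coefficient changes little when its centre moves from x to \<open>t j\<close>. As for
  Taylor polynomials, the derivative in the centre telescopes to a single term of top order, and
  \<open>xi\<close> is of order U^r when centre and knots are within U.\<close>

lemma quasi_interpolation_error:
  assumes der: "\<And>i x. i < k \<Longrightarrow> x \<in> {0..1} \<Longrightarrow> (Df i has_real_derivative Df (Suc i) x) (at x within {0..1})"
    and hol: "\<And>x y. x \<in> {0..1} \<Longrightarrow> y \<in> {0..1} \<Longrightarrow> \<bar>Df k x - Df k y\<bar> \<le> L * \<bar>x - y\<bar> powr s"
    and "0 \<le> L" "0 < s" "k < q" and x: "x \<in> {0..1}"
    and nz: "B_spline q J j x \<noteq> 0"
  shows "\<bar>quasi_coeff Df k j (t j) - quasi_coeff Df k j x\<bar> \<le> 2 * (L * 2 ^ (q - 1)) * (real q / real K) powr (real k + s)"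
proof -
  define U where "U = real q / real K"
  have U0: "0 < U" using q1 K1 by (simp add: U_def)
  have tx: "t j \<le> x" "x \<le> t (j + q)" using B_spline_supp[OF nz] by auto
  have U: "\<bar>t (j + l) - \<tau>\<bar> \<le> U" if "\<tau> \<in> {t j..x}" "l \<le> q - 1" for l \<tau>
  proof -
    have "t j \<le> t (j + l)" "t (j + l) \<le> t (j + q)" using mono_knot that(2) by (auto intro: monoD)
    then show ?thesis using knot_diff_le[of q K j q] that tx unfolding U_def by auto
  qed
  have sub: "{t j..x} \<subseteq> {0..1}" using knot_nonneg[of q K j] x by auto
  have dist: "\<bar>\<tau> - x\<bar> \<le> U" if "\<tau> \<in> {t j..x}" for \<tau>
    using knot_diff_le[of q K j q] that tx unfolding U_def by auto
  \<comment> \<open>The top derivative is only Hoelder continuous. Freezing it at x gives the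
    differentiable function \<open>H\<close>; the part left out, at the centre \<open>t j\<close>,
    is bounded directly in \<open>R\<close>, which is why the final constant is doubled.\<close>
  define a where "a = Df k x"
  have da: "\<bar>Df k \<tau> - a\<bar> \<le> L * U powr s" if "\<tau> \<in> {t j..x}" for \<tau>
  proof -
    have "\<bar>Df k \<tau> - a\<bar> \<le> L * \<bar>\<tau> - x\<bar> powr s" unfolding a_def using hol that sub x by blast
    also have "\<dots> \<le> L * U powr s"
      using dist[OF that] assms(3,4) by (intro mult_left_mono powr_mono2) auto
    finally show ?thesis .
  qed
  define H where "H \<tau> = (\<Sum>r<k. Df r \<tau> / fact r * xi r j \<tau>) + a / fact k * xi k j \<tau>" for \<tau>
  define T where "T r \<tau> = Df r \<tau> / fact r * (real r * xi (r - 1) j \<tau>)" for r \<tau>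
  have xib: "\<bar>xi r j \<tau>\<bar> \<le> 2 ^ (q - 1) * U ^ r" if "\<tau> \<in> {t j..x}" "r \<le> q - 1" for r \<tau>
    using xi_bound[of j \<tau> U r] U[OF that(1)] that(2) by blast
  have split: "quasi_coeff Df k j \<tau> = H \<tau> + (Df k \<tau> - a) / fact k * xi k j \<tau>" for \<tau>
    unfolding quasi_coeff_def H_def by (simp flip: lessThan_Suc_atMost add: field_simps)
  have Hder: "(H has_real_derivative (Df k \<tau> - a) / fact k * (real k * xi (k - 1) j \<tau>)) (at \<tau> within {t j..x})"
    if \<tau>: "\<tau> \<in> {t j..x}" for \<tau>
  proof -
    have d1: "((\<lambda>\<tau>. Df r \<tau> / fact r * xi r j \<tau>) has_real_derivative T (Suc r) \<tau> - T r \<tau>) (at \<tau> within {t j..x})"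
      if "r < k" for r
    proof -
      have "(Df r has_real_derivative Df (Suc r) \<tau>) (at \<tau> within {t j..x})"
        using der[OF that, of \<tau>] sub \<tau> DERIV_subset by blast
      moreover have "(xi r j has_real_derivative - real r * xi (r - 1) j \<tau>) (at \<tau> within {t j..x})"
        using that assms(5) by (intro xi_deriv) auto
      moreover have "T (Suc r) \<tau> = Df (Suc r) \<tau> / fact r * xi r j \<tau>"
        unfolding T_def fact_Suc by (simp del: of_nat_Suc)
      ultimately show ?thesis
        using DERIV_cong[OF DERIV_mult[OF DERIV_cdivide[of "Df r" "Df (Suc r) \<tau>" \<tau> "{t j..x}" "fact r"]],
            of "xi r j" "- real r * xi (r - 1) j \<tau>"]
        by (simp add: T_def[of r] mult_ac)
    qed
    have "((\<lambda>\<tau>. \<Sum>r<k. Df r \<tau> / fact r * xi r j \<tau>) has_real_derivative (\<Sum>r<k. T (Suc r) \<tau> - T r \<tau>)) (at \<tau> within {t j..x})"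
      by (rule DERIV_sum, rule d1) simp
    \<comment> \<open>The lower end \<open>T 0\<close> is zero because of the factor
      \<open>real r\<close> in \<open>T\<close>.\<close>
    moreover have "(\<Sum>r<k. T (Suc r) \<tau> - T r \<tau>) = T k \<tau>"
      using sum_lessThan_telescope[of "\<lambda>r. T r \<tau>" k] by (simp add: T_def)
    moreover have "(xi k j has_real_derivative - real k * xi (k - 1) j \<tau>) (at \<tau> within {t j..x})"
      using assms(5) by (intro xi_deriv) auto
    ultimately have "(H has_real_derivative T k \<tau> + a / fact k * (- real k * xi (k - 1) j \<tau>)) (at \<tau> within {t j..x})"
      unfolding H_def[abs_def] by (intro DERIV_add DERIV_cmult) auto
    then show ?thesis by (rule DERIV_cong) (simp add: T_def algebra_simps diff_divide_distrib)
  qed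
  let ?c = "L * U powr s * 2 ^ (q - 1)"
  have c0: "0 \<le> ?c" using assms(3) by simp
  have H: "\<bar>H (t j) - H x\<bar> \<le> ?c * U ^ k"
  proof (cases k)
    case 0
    have "\<bar>H (t j) - H x\<bar> \<le> 0 * \<bar>t j - x\<bar>"
      using field_differentiable_bound[of "{t j..x}" H "\<lambda>\<tau>. (Df k \<tau> - a) / fact k * (real k * xi (k - 1) j \<tau>)" 0 "t j" x] Hder tx 0
      by simp
    then show ?thesis using c0 U0 by (simp add: 0)
  next
    case (Suc k')
    have "\<bar>H (t j) - H x\<bar> \<le> (?c * U ^ k') * \<bar>t j - x\<bar>"
    proof (rule field_differentiable_bound[of "{t j..x}" H "\<lambda>\<tau>. (Df k \<tau> - a) / fact k * (real k * xi (k - 1) j \<tau>)", unfolded real_norm_def, OF _ Hder])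
      fix \<tau> assume \<tau>: "\<tau> \<in> {t j..x}"
      have "real k \<le> real (fact k)" using fact_ge_self by (rule of_nat_mono)
      then have "real k / fact k \<le> 1" by simp
      then have "\<bar>Df k \<tau> - a\<bar> * \<bar>xi k' j \<tau>\<bar> * (real k / fact k) \<le> (L * U powr s) * (2 ^ (q - 1) * U ^ k') * 1"
        using da[OF \<tau>] xib[OF \<tau>, of k'] assms(3,5) Suc U0 by (intro mult_mono) (auto simp: mult_nonneg_nonneg)
      moreover have "\<bar>(Df k \<tau> - a) / fact k * (real k * xi k' j \<tau>)\<bar> = \<bar>Df k \<tau> - a\<bar> * \<bar>xi k' j \<tau>\<bar> * (real k / fact k)"
        by (simp add: abs_mult del: of_nat_Suc fact_Suc)
      moreover have "xi (k - 1) j \<tau> = xi k' j \<tau>" by (simp add: Suc)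
      ultimately show "\<bar>(Df k \<tau> - a) / fact k * (real k * xi (k - 1) j \<tau>)\<bar> \<le> ?c * U ^ k'"
        by (simp only: mult_1_right mult.assoc)
    qed (use tx in auto)
    also have "\<dots> \<le> (?c * U ^ k') * U"
      using dist[of "t j"] tx c0 U0 by (intro mult_left_mono) auto
    finally show ?thesis by (simp add: Suc mult_ac)
  qed
  have R: "\<bar>(Df k (t j) - a) / fact k * xi k j (t j)\<bar> \<le> ?c * U ^ k"
  proof -
    have tj: "t j \<in> {t j..x}" using tx by simp
    have xk: "\<bar>xi k j (t j)\<bar> \<le> 2 ^ (q - 1) * U ^ k" by (rule xib[OF tj]) (use assms(5) in simp)
    have fk: "1 / fact k \<le> (1::real)" using fact_ge_1[of k, where ?'a = real] by simp
    have "\<bar>Df k (t j) - a\<bar> * \<bar>xi k j (t j)\<bar> * (1 / fact k) \<le> (L * U powr s) * (2 ^ (q - 1) * U ^ k) * 1"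
      by (intro mult_mono da[OF tj] xk fk) (simp_all add: assms(3) U0 less_imp_le)
    moreover have "\<bar>(Df k (t j) - a) / fact k * xi k j (t j)\<bar> = \<bar>Df k (t j) - a\<bar> * \<bar>xi k j (t j)\<bar> * (1 / fact k)"
      by (simp add: abs_mult)
    ultimately show ?thesis by (simp only: mult_1_right mult.assoc)
  qed
  have "\<bar>quasi_coeff Df k j (t j) - quasi_coeff Df k j x\<bar> \<le> ?c * U ^ k + ?c * U ^ k"
  proof -
    have "quasi_coeff Df k j x = H x" unfolding split[of x] a_def by simp
    then show ?thesis using H R unfolding split[of "t j"] by linarith
  qed
  also have "\<dots> = 2 * (L * 2 ^ (q - 1)) * U powr (real k + s)"
    using U0 by (simp add: powr_add powr_realpow)
  finally show ?thesis unfolding U_def .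
qed

text \<open>If all centres were x, the spline would equal the function at x by
  \<open>B_spline_reproduce\<close>. Moving the centres costs the same error for every basis
  function that is nonzero at x, and those weights sum to one.\<close>

lemma quasi_interpolation:
  assumes "\<And>i x. i < k \<Longrightarrow> x \<in> {0..1} \<Longrightarrow> (Df i has_real_derivative Df (Suc i) x) (at x within {0..1})"
    and "\<And>x y. x \<in> {0..1} \<Longrightarrow> y \<in> {0..1} \<Longrightarrow> \<bar>Df k x - Df k y\<bar> \<le> L * \<bar>x - y\<bar> powr s"
    and "0 \<le> L" "0 < s" "k < q" and x: "x \<in> {0..1}"
  shows "\<bar>spline_comb q J (\<lambda>j. quasi_coeff Df k j (t j)) x - Df 0 x\<bar> \<le> 2 * (L * 2 ^ (q - 1)) * (real q / real K) powr (real k + s)"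
proof -
  let ?B = "\<lambda>j. B_spline q J j x" and ?E = "2 * (L * 2 ^ (q - 1)) * (real q / real K) powr (real k + s)"
  have "(\<Sum>j<J. quasi_coeff Df k j x * ?B j) = (\<Sum>r\<le>k. Df r x / fact r * (\<Sum>j<J. ?B j * xi r j x))"
    unfolding quasi_coeff_def sum_distrib_left sum_distrib_right by (subst sum.swap) (simp add: algebra_simps)
  also have "\<dots> = (\<Sum>r\<le>k. Df r x / fact r * of_bool (r = 0))"
    using B_spline_reproduce[OF x] assms(5) by (intro sum.cong refl arg_cong2[where f = "(*)"]) auto
  also have "\<dots> = Df 0 x" by (simp add: of_bool_def if_distrib[of "\<lambda>z. _ * z"] sum.delta cong: if_cong)
  finally have eq: "spline_comb q J (\<lambda>j. quasi_coeff Df k j (t j)) x - Df 0 x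
     = (\<Sum>j<J. (quasi_coeff Df k j (t j) - quasi_coeff Df k j x) * ?B j)"
    unfolding spline_comb_def by (simp add: left_diff_distrib sum_subtractf)
  have "\<bar>\<Sum>j<J. (quasi_coeff Df k j (t j) - quasi_coeff Df k j x) * ?B j\<bar> \<le> (\<Sum>j<J. ?E * ?B j)"
  proof (intro order_trans[OF sum_abs] sum_mono)
    fix j
    show "\<bar>(quasi_coeff Df k j (t j) - quasi_coeff Df k j x) * ?B j\<bar> \<le> ?E * ?B j"
      using quasi_interpolation_error[OF assms, of j] B_spline_nonneg[of j x]
      by (cases "?B j = 0") (auto simp: abs_mult intro!: mult_right_mono)
  qed
  also have "\<dots> = ?E" unfolding sum_distrib_left[symmetric] B_spline_sum[OF x] by simp
  finally show ?thesis unfolding eq .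
qed

text \<open>The spline that starts at the left end of cell m, seen on the right half of that cell.
  Only the first term of the recursion survives, and raising the degree to r + 1 multiplies by at
  least (1/(2K)) / ((r+1)/K).\<close>

lemma bspline_left_half:
  assumes "m < K" "x \<in> {real m / real K + 1 / (2 * real K)..<(real m + 1) / real K}"
  shows "(1 / 2) ^ r / fact r \<le> bspline t r (m + q - 1) x"
proof (induction r)
  case 0
  have "t (m + q - 1) = real m / real K" "t (Suc (m + q - 1)) = (real m + 1) / real K"
    using knot_inner[OF q1, of m K] knot_inner[OF q1, of "Suc m" K] assms(1) q1 by (auto simp: add.commute)
  moreover have "real m / real K \<le> x" using assms(2) by (auto intro: order_trans[rotated])
  ultimately show ?case using assms(2) by simp
next
  case (Suc r)
  let ?i = "m + q - 1"
  have ti: "t ?i = real m / real K" "t (Suc ?i) = (real m + 1) / real K"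
    using knot_inner[OF q1, of m K] knot_inner[OF q1, of "Suc m" K] assms(1) q1 by (auto simp: add.commute)
  \<comment> \<open>The second term of the recursion belongs to a spline that starts only at the
    next knot.\<close>
  have z: "bspline t r (?i + 1) x = 0"
    using bspline_supp[OF mono_knot knot_le_1, of q K r "?i + 1" x] ti assms(2) by auto
  have "t (Suc ?i) \<le> t (?i + r + 1)" by (intro monoD[OF mono_knot]) auto
  moreover have "t ?i < t (Suc ?i)" unfolding ti using K1 by (intro divide_strict_right_mono) auto
  ultimately have pos: "0 < t (?i + r + 1) - t ?i" by simp
  have le: "t (?i + r + 1) - t ?i \<le> real (r + 1) / real K" using knot_diff_le[of q K ?i "r + 1"] by simp
  have K: "0 < real K" using K1 by simp
  have "0 < 1 / (2 * real K)" using K by simp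
  then have xl: "0 \<le> x - t ?i" "1 / (2 * real K) \<le> x - t ?i" using assms(2) unfolding ti(1) atLeastLessThan_iff by linarith+
  have "1 / 2 / real (r + 1) = (1 / (2 * real K)) / (real (r + 1) / real K)" using K by simp
  also have "\<dots> \<le> (x - t ?i) / (t (?i + r + 1) - t ?i)"
    using le pos xl by (intro frac_le) auto
  finally have r: "1 / 2 / real (r + 1) \<le> (x - t ?i) / (t (?i + r + 1) - t ?i)" .
  have "(1 / 2) ^ Suc r / fact (Suc r) = (1 / 2 / real (r + 1)) * ((1 / 2) ^ r / fact r)"
    by (simp add: field_simps)
  also have "\<dots> \<le> (x - t ?i) / (t (?i + r + 1) - t ?i) * bspline t r ?i x"
    using r Suc.IH by (intro mult_mono) (auto intro: order_trans[rotated])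
  finally show ?case using z by simp
qed

text \<open>Half of the triangular structure: the last basis function active on cell m has index m +
  q - 1, because the next one starts at the right end of the cell.\<close>

lemma B_spline_cell_zero:
  assumes "m < K" "x \<in> {real m / real K..<(real m + 1) / real K}" "m + q \<le> j"
  shows "B_spline q J j x = 0"
proof (rule ccontr)
  assume "B_spline q J j x \<noteq> 0"
  then have "t j \<le> x" by (rule B_spline_supp)
  moreover have "t (Suc m + q - 1) \<le> t j" using assms(3) by (intro monoD[OF mono_knot]) auto
  ultimately show False using assms(1,2) knot_inner[OF q1, of "Suc m" K] by (auto simp: add.commute)
qed

end

lemma borel_measurable_bspline [measurable]: "bspline t m i \<in> borel_measurable borel"
proof (induction m arbitrary: i)
  case 0
  show ?case by (simp only: bspline.simps[abs_def]) measurable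
next
  case (Suc m)
  have [measurable]: "bspline t m i \<in> borel_measurable borel" for i by (rule Suc.IH)
  show ?case unfolding bspline.simps[abs_def] by measurable
qed

lemma borel_measurable_B_spline [measurable]: "B_spline q J j \<in> borel_measurable borel"
  unfolding B_spline_def by measurable

section \<open>Hoelder classes\<close>

text \<open>Recursion on the derivative replaces the chain of functions in
  \<open>holder_space\<close>, so that closure under products and reciprocals, and hence logarithms,
  follows by induction on k.\<close>

fun holder_class :: "nat \<Rightarrow> real \<Rightarrow> (real \<Rightarrow> real) \<Rightarrow> bool" where
  "holder_class 0 s f = (\<exists>L. \<forall>x\<in>{0..1}. \<forall>y\<in>{0..1}. \<bar>f x - f y\<bar> \<le> L * \<bar>x - y\<bar> powr s)"
| "holder_class (Suc k) s f =
     (\<exists>f'. (\<forall>x\<in>{0..1}. (f has_real_derivative f' x) (at x within {0..1})) \<and> holder_class k s f')"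

lemma holder_class_0I:
  "(\<And>x y. x \<in> {0..1} \<Longrightarrow> y \<in> {0..1} \<Longrightarrow> \<bar>f x - f y\<bar> \<le> L * \<bar>x - y\<bar> powr s) \<Longrightarrow> holder_class 0 s f"
  unfolding holder_class.simps by blast

lemma holder_class_0E:
  assumes "holder_class 0 s f"
  obtains L where "\<And>x y. x \<in> {0..1} \<Longrightarrow> y \<in> {0..1} \<Longrightarrow> \<bar>f x - f y\<bar> \<le> L * \<bar>x - y\<bar> powr s"
  using assms unfolding holder_class.simps by blast

lemma holder_class_SucI:
  "(\<And>x. x \<in> {0..1} \<Longrightarrow> (f has_real_derivative f' x) (at x within {0..1})) \<Longrightarrow> holder_class k s f' \<Longrightarrow> holder_class (Suc k) s f"
  unfolding holder_class.simps by blast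

lemma holder_class_SucE:
  assumes "holder_class (Suc k) s f"
  obtains f' where "\<And>x. x \<in> {0..1} \<Longrightarrow> (f has_real_derivative f' x) (at x within {0..1})" "holder_class k s f'"
  using assms unfolding holder_class.simps by blast

lemma holder_class_chain_iff:
  "holder_class k s f \<longleftrightarrow> (\<exists>Df :: nat \<Rightarrow> real \<Rightarrow> real. Df 0 = f
       \<and> (\<forall>i<k. \<forall>x\<in>{0..1}. (Df i has_real_derivative Df (Suc i) x) (at x within {0..1}))
       \<and> (\<exists>L. \<forall>x\<in>{0..1}. \<forall>y\<in>{0..1}. \<bar>Df k x - Df k y\<bar> \<le> L * \<bar>x - y\<bar> powr s))"
proof (induction k arbitrary: f)
  case 0
  show ?case by (auto intro: exI[of _ "\<lambda>_. f"])
next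
  case (Suc k)
  show ?case (is "_ \<longleftrightarrow> (\<exists>Df. ?P Df)")
  proof
    assume "holder_class (Suc k) s f"
    then obtain f' where f': "\<forall>x\<in>{0..1}. (f has_real_derivative f' x) (at x within {0..1})" "holder_class k s f'"
      by auto
    then obtain Df where Df: "Df 0 = f'"
      "\<forall>i<k. \<forall>x\<in>{0..1}. (Df i has_real_derivative Df (Suc i) x) (at x within {0..1})"
      "\<exists>L. \<forall>x\<in>{0..1}. \<forall>y\<in>{0..1}. \<bar>Df k x - Df k y\<bar> \<le> L * \<bar>x - y\<bar> powr s"
      using Suc.IH by blast
    have "?P (case_nat f Df)" using f' Df by (auto split: nat.splits)
    then show "\<exists>Df. ?P Df" by (rule exI[of ?P])
  next
    assume "\<exists>Df. ?P Df"
    then obtain Df where D0: "Df 0 = f"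
      and D: "\<forall>i<Suc k. \<forall>x\<in>{0..1}. (Df i has_real_derivative Df (Suc i) x) (at x within {0..1})"
      and D2: "\<exists>L. \<forall>x\<in>{0..1}. \<forall>y\<in>{0..1}. \<bar>Df (Suc k) x - Df (Suc k) y\<bar> \<le> L * \<bar>x - y\<bar> powr (s::real)"
      by - (erule exE[of ?P], elim conjE, rule that; assumption)
    note D1 = D[rule_format]
    have "holder_class k s (Df 1)"
      unfolding Suc.IH
    proof (rule exI[of _ "\<lambda>i. Df (Suc i)"], intro conjI)
      show "\<forall>i<k. \<forall>x\<in>{0..1}. (Df (Suc i) has_real_derivative Df (Suc (Suc i)) x) (at x within {0..1})"
        by (intro allI impI ballI D1) auto
      show "\<exists>L. \<forall>x\<in>{0..1}. \<forall>y\<in>{0..1}. \<bar>Df (Suc k) x - Df (Suc k) y\<bar> \<le> L * \<bar>x - y\<bar> powr s"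
        by (rule D2)
    qed simp
    moreover have "(f has_real_derivative Df 1 x) (at x within {0..1})" if "x \<in> {0..1}" for x
      using D1[of 0 x] that unfolding D0 One_nat_def by blast
    ultimately show "holder_class (Suc k) s f" by (intro holder_class_SucI[of f "Df 1"])
  qed
qed

lemma holder_space_iff: "f \<in> holder_space \<beta> \<longleftrightarrow>
    holder_class (nat (\<lceil>\<beta>\<rceil> - 1)) (\<beta> - real (nat (\<lceil>\<beta>\<rceil> - 1))) f"
  unfolding holder_space_def holder_class_chain_iff Let_def by simp

context
  fixes s :: real
  assumes s: "0 < s" "s \<le> 1"
begin

lemma holder_class_continuous: "holder_class k s f \<Longrightarrow> continuous_on {0..1} f"
proof (cases k)
  case 0
  assume "holder_class k s f"
  then obtain L where L: "\<And>x y. x \<in> {0..1} \<Longrightarrow> y \<in> {0..1} \<Longrightarrow> \<bar>f x - f y\<bar> \<le> L * \<bar>x - y\<bar> powr s"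
    unfolding 0 by (elim holder_class_0E) blast
  show "continuous_on {0..1} f"
    unfolding continuous_on_def
  proof
    fix x :: real assume x: "x \<in> {0..1}"
    have "((\<lambda>y. L * \<bar>y - x\<bar> powr s) \<longlongrightarrow> L * \<bar>x - x\<bar> powr s) (at x within {0..1})"
      using s by (intro tendsto_intros) auto
    then have "((\<lambda>y. L * \<bar>y - x\<bar> powr s) \<longlongrightarrow> 0) (at x within {0..1})" using s by simp
    then have "((\<lambda>y. f y - f x) \<longlongrightarrow> 0) (at x within {0..1})"
      by (rule Lim_null_comparison[rotated]) (use L x in \<open>auto simp: eventually_at_filter\<close>)
    then show "(f \<longlongrightarrow> f x) (at x within {0..1})" by (simp add: LIM_zero_iff)
  qed
next
  case (Suc k')
  assume "holder_class k s f"
  then show "continuous_on {0..1} f"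
    using Suc by (auto simp: continuous_on_eq_continuous_within intro: DERIV_continuous)
qed

lemma continuous_unit_bounded:
  assumes "continuous_on {0..1} (f :: real \<Rightarrow> real)"
  obtains b where "0 \<le> b" "\<And>x. x \<in> {0..1} \<Longrightarrow> \<bar>f x\<bar> \<le> b"
proof -
  have "bounded (f ` {0..1})"
    using assms by (intro compact_imp_bounded compact_continuous_image) auto
  then obtain b where "\<And>x. x \<in> {0..1} \<Longrightarrow> \<bar>f x\<bar> \<le> b"
    unfolding bounded_iff real_norm_def by (metis imageI)
  with that[of "max b 0"] show ?thesis by (metis max.cobounded1 max.cobounded2 order_trans)
qed

lemma lipschitz_imp_holder:
  assumes "\<And>x y. x \<in> {0..1} \<Longrightarrow> y \<in> {0..1} \<Longrightarrow> \<bar>f x - f y\<bar> \<le> L * \<bar>x - y\<bar>" "0 \<le> L"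
  shows "holder_class 0 s f"
proof -
  have "\<bar>f x - f y\<bar> \<le> L * \<bar>x - y\<bar> powr s" if xy: "x \<in> {0..1}" "y \<in> {0..1}" for x y :: real
  proof -
    have "\<bar>x - y\<bar> powr 1 \<le> \<bar>x - y\<bar> powr s" using xy s by (intro powr_mono') auto
    then have "\<bar>x - y\<bar> \<le> \<bar>x - y\<bar> powr s" by simp
    then show ?thesis using assms(1)[OF xy] assms(2) by (meson mult_left_mono order_trans)
  qed
  then show ?thesis by (rule holder_class_0I)
qed

text \<open>The product rule multiplies a function by a derivative of lower class, so the classes
  must be nested. At the bottom, f' is continuous, hence bounded, and a Lipschitz function on an
  interval of length one is Hoelder of every exponent up to one.\<close>

lemma holder_class_Suc_imp: "holder_class (Suc k) s f \<Longrightarrow> holder_class k s f"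
proof (induction k arbitrary: f)
  case 0
  then obtain f' where f': "\<And>x. x \<in> {0..1} \<Longrightarrow> (f has_real_derivative f' x) (at x within {0..1})" "holder_class 0 s f'"
    by (elim holder_class_SucE) blast
  obtain b where b: "0 \<le> b" "\<And>x. x \<in> {0..1} \<Longrightarrow> \<bar>f' x\<bar> \<le> b"
    using continuous_unit_bounded[OF holder_class_continuous[OF f'(2)]] by blast
  have "\<bar>f x - f y\<bar> \<le> b * \<bar>x - y\<bar>" if "x \<in> {0..1}" "y \<in> {0..1}" for x y
    using field_differentiable_bound[of "{0..1}" f f' b x y] f'(1) b that by simp
  then show ?case using b lipschitz_imp_holder by blast
next
  case (Suc k)
  from Suc.prems obtain f' where "\<And>x. x \<in> {0..1} \<Longrightarrow> (f has_real_derivative f' x) (at x within {0..1})" "holder_class (Suc k) s f'"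
    by (elim holder_class_SucE[of "Suc k"]) blast
  then show ?case using Suc.IH[of f'] by (intro holder_class_SucI)
qed

lemma holder_class_uminus: "holder_class k s f \<Longrightarrow> holder_class k s (\<lambda>x. - f x)"
proof (induction k arbitrary: f)
  case 0
  then show ?case by (auto simp: abs_minus_commute)
next
  case (Suc k)
  then obtain f' where "\<And>x. x \<in> {0..1} \<Longrightarrow> (f has_real_derivative f' x) (at x within {0..1})" "holder_class k s f'"
    by (elim holder_class_SucE) blast
  then show ?case using Suc.IH[of f']
    by (intro holder_class_SucI[of _ "\<lambda>x. - f' x"] DERIV_minus) auto
qed

lemma holder_class_add: "holder_class k s f \<Longrightarrow> holder_class k s g \<Longrightarrow> holder_class k s (\<lambda>x. f x + g x)"
proof (induction k arbitrary: f g)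
  case 0
  then obtain L L' where "\<And>x y. x \<in> {0..1} \<Longrightarrow> y \<in> {0..1} \<Longrightarrow> \<bar>f x - f y\<bar> \<le> L * \<bar>x - y\<bar> powr s"
    "\<And>x y. x \<in> {0..1} \<Longrightarrow> y \<in> {0..1} \<Longrightarrow> \<bar>g x - g y\<bar> \<le> L' * \<bar>x - y\<bar> powr s"
    by (elim holder_class_0E) blast
  then have "\<bar>f x + g x - (f y + g y)\<bar> \<le> (L + L') * \<bar>x - y\<bar> powr s" if "x \<in> {0..1}" "y \<in> {0..1}" for x y
    unfolding distrib_right using that by (smt (verit))
  then show ?case by (rule holder_class_0I)
next
  case (Suc k)
  then obtain f' g' where "\<And>x. x \<in> {0..1} \<Longrightarrow> (f has_real_derivative f' x) (at x within {0..1})" "holder_class k s f'"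
    "\<And>x. x \<in> {0..1} \<Longrightarrow> (g has_real_derivative g' x) (at x within {0..1})" "holder_class k s g'"
    by (elim holder_class_SucE) blast
  then show ?case using Suc.IH[of f' g']
    by (intro holder_class_SucI[of _ "\<lambda>x. f' x + g' x"] DERIV_add) auto
qed

lemma holder_class_mult: "holder_class k s f \<Longrightarrow> holder_class k s g \<Longrightarrow> holder_class k s (\<lambda>x. f x * g x)"
proof (induction k arbitrary: f g)
  case 0
  then obtain L L' where L: "\<And>x y. x \<in> {0..1} \<Longrightarrow> y \<in> {0..1} \<Longrightarrow> \<bar>f x - f y\<bar> \<le> L * \<bar>x - y\<bar> powr s"
    "\<And>x y. x \<in> {0..1} \<Longrightarrow> y \<in> {0..1} \<Longrightarrow> \<bar>g x - g y\<bar> \<le> L' * \<bar>x - y\<bar> powr s"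
    by (elim holder_class_0E) blast
  obtain b where b: "0 \<le> b" "\<And>x. x \<in> {0..1} \<Longrightarrow> \<bar>f x\<bar> \<le> b"
    using continuous_unit_bounded[OF holder_class_continuous[OF 0(1)]] by blast
  obtain b' where b': "0 \<le> b'" "\<And>x. x \<in> {0..1} \<Longrightarrow> \<bar>g x\<bar> \<le> b'"
    using continuous_unit_bounded[OF holder_class_continuous[OF 0(2)]] by blast
  have "\<bar>f x * g x - f y * g y\<bar> \<le> (b * L' + b' * L) * \<bar>x - y\<bar> powr s" if xy: "x \<in> {0..1}" "y \<in> {0..1}" for x y
  proof -
    have "f x * g x - f y * g y = f x * (g x - g y) + g y * (f x - f y)" by (simp add: algebra_simps)
    then have "\<bar>f x * g x - f y * g y\<bar> \<le> \<bar>f x\<bar> * \<bar>g x - g y\<bar> + \<bar>g y\<bar> * \<bar>f x - f y\<bar>"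
      by (metis abs_mult abs_triangle_ineq)
    also have "\<dots> \<le> b * (L' * \<bar>x - y\<bar> powr s) + b' * (L * \<bar>x - y\<bar> powr s)"
      using L[OF xy] b b' xy by (intro add_mono mult_mono) auto
    finally show ?thesis by (simp add: algebra_simps)
  qed
  then show ?case by (rule holder_class_0I)
next
  case (Suc k)
  then obtain f' g' where d: "\<And>x. x \<in> {0..1} \<Longrightarrow> (f has_real_derivative f' x) (at x within {0..1})" "holder_class k s f'"
    "\<And>x. x \<in> {0..1} \<Longrightarrow> (g has_real_derivative g' x) (at x within {0..1})" "holder_class k s g'"
    by (elim holder_class_SucE) blast
  have "holder_class k s (\<lambda>x. f' x * g x + f x * g' x)"
    by (intro holder_class_add Suc.IH d Suc.prems[THEN holder_class_Suc_imp])
  then show ?case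
  proof (rule holder_class_SucI[rotated])
    fix x :: real assume "x \<in> {0..1}"
    then show "((\<lambda>x. f x * g x) has_real_derivative f' x * g x + f x * g' x) (at x within {0..1})"
      using DERIV_mult[OF d(1)[of x] d(3)[of x]] by (simp only: mult.commute)
  qed
qed

lemma continuous_unit_lower:
  assumes "continuous_on {0..1} f" "\<And>x. x \<in> {0..1} \<Longrightarrow> 0 < (f x :: real)"
  obtains b where "0 < b" "\<And>x. x \<in> {0..1::real} \<Longrightarrow> b \<le> f x"
proof -
  obtain x0 where "x0 \<in> {0..1}" "\<And>x. x \<in> {0..1} \<Longrightarrow> f x0 \<le> f x"
    using continuous_attains_inf[of "{0..1}" f] assms(1) by auto
  then show ?thesis using that assms(2) by blast
qed

lemma holder_class_inverse:
  assumes "holder_class k s f" "\<And>x. x \<in> {0..1} \<Longrightarrow> 0 < f x"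
  shows "holder_class k s (\<lambda>x. inverse (f x))"
  using assms(1)
proof (induction k)
  case 0
  then obtain L where L: "\<And>x y. x \<in> {0..1} \<Longrightarrow> y \<in> {0..1} \<Longrightarrow> \<bar>f x - f y\<bar> \<le> L * \<bar>x - y\<bar> powr s"
    by (elim holder_class_0E) blast
  obtain b where b: "0 < b" "\<And>x. x \<in> {0..1} \<Longrightarrow> b \<le> f x"
    using continuous_unit_lower[OF holder_class_continuous[OF 0] assms(2)] by blast
  have "\<bar>inverse (f x) - inverse (f y)\<bar> \<le> (inverse b * inverse b * L) * \<bar>x - y\<bar> powr s" if xy: "x \<in> {0..1}" "y \<in> {0..1}" for x y
  proof -
    have f: "0 < f x" "0 < f y" using assms(2) xy by auto
    have "inverse (f x) - inverse (f y) = inverse (f x) * inverse (f y) * (f y - f x)"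
      using f by (simp add: field_simps)
    then have "\<bar>inverse (f x) - inverse (f y)\<bar> = inverse (f x) * inverse (f y) * \<bar>f x - f y\<bar>"
      using f by (simp add: abs_mult abs_minus_commute)
    also have "\<dots> \<le> inverse b * inverse b * (L * \<bar>x - y\<bar> powr s)"
      using f b xy L[OF xy] by (intro mult_mono) (auto simp: le_imp_inverse_le)
    finally show ?thesis by (simp add: mult.assoc)
  qed
  then show ?case by (rule holder_class_0I)
next
  case (Suc k)
  then obtain f' where d: "\<And>x. x \<in> {0..1} \<Longrightarrow> (f has_real_derivative f' x) (at x within {0..1})" "holder_class k s f'"
    by (elim holder_class_SucE) blast
  have i: "holder_class k s (\<lambda>x. inverse (f x))" using Suc holder_class_Suc_imp by blast
  have "holder_class k s (\<lambda>x. - (inverse (f x) * f' x * inverse (f x)))"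
    using i d by (intro holder_class_uminus holder_class_mult)
  then show ?case
  proof (rule holder_class_SucI[rotated])
    fix x :: real assume "x \<in> {0..1}"
    then show "((\<lambda>x. inverse (f x)) has_real_derivative - (inverse (f x) * f' x * inverse (f x))) (at x within {0..1})"
      using d(1) assms(2)[of x] by (intro DERIV_inverse') auto
  qed
qed

text \<open>The derivative f'/f is a product of functions already treated, so only k = 0 needs an
  estimate, from the positive minimum of f.\<close>

lemma holder_class_ln:
  assumes "holder_class k s f" "\<And>x. x \<in> {0..1} \<Longrightarrow> 0 < f x"
  shows "holder_class k s (\<lambda>x. ln (f x))"
proof (cases k)
  case 0
  obtain L where L: "\<And>x y. x \<in> {0..1} \<Longrightarrow> y \<in> {0..1} \<Longrightarrow> \<bar>f x - f y\<bar> \<le> L * \<bar>x - y\<bar> powr s"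
    using assms(1) unfolding 0 by (elim holder_class_0E) blast
  obtain b where b: "0 < b" "\<And>x. x \<in> {0..1} \<Longrightarrow> b \<le> f x"
    using continuous_unit_lower[OF holder_class_continuous[OF assms(1)] assms(2)] by blast
  have 1: "ln (f x) - ln (f y) \<le> inverse b * (L * \<bar>x - y\<bar> powr s)" if xy: "x \<in> {0..1}" "y \<in> {0..1}" for x y
  proof -
    have f: "0 < f x" "0 < f y" "b \<le> f y" using assms(2) xy b by auto
    have "ln (f x) - ln (f y) \<le> (f x - f y) / f y"
      using f ln_diff_le by blast
    also have "\<dots> \<le> \<bar>f x - f y\<bar> / f y" using f by (intro divide_right_mono) auto
    also have "\<dots> \<le> \<bar>f x - f y\<bar> / b" using f b by (intro divide_left_mono) auto
    also have "\<dots> \<le> (L * \<bar>x - y\<bar> powr s) / b" using L[OF xy] b by (intro divide_right_mono) auto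
    finally show ?thesis by (simp add: field_simps)
  qed
  have "\<bar>ln (f x) - ln (f y)\<bar> \<le> (inverse b * L) * \<bar>x - y\<bar> powr s" if xy: "x \<in> {0..1}" "y \<in> {0..1}" for x y
    using 1[OF xy] 1[OF xy(2,1)] by (simp add: abs_minus_commute mult.assoc abs_le_iff)
  then show ?thesis unfolding 0 by (rule holder_class_0I)
next
  case (Suc k')
  then obtain f' where d: "\<And>x. x \<in> {0..1} \<Longrightarrow> (f has_real_derivative f' x) (at x within {0..1})" "holder_class k' s f'"
    using assms(1) unfolding Suc by (elim holder_class_SucE) blast
  have "holder_class k' s (\<lambda>x. inverse (f x) * f' x)"
    using assms(1) unfolding Suc by (intro holder_class_inverse holder_class_mult holder_class_Suc_imp[of k' f] d assms(2))
  then show ?thesis unfolding Suc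
  proof (rule holder_class_SucI[rotated])
    fix x :: real assume "x \<in> {0..1}"
    then show "((\<lambda>x. ln (f x)) has_real_derivative inverse (f x) * f' x) (at x within {0..1})"
      using d(1)[of x] assms(2)[of x] by (auto intro!: derivative_eq_intros simp: field_simps)
  qed
qed

end

section \<open>Lebesgue measure on the zero-sum hyperplane\<close>

interpretation lborel_product: product_sigma_finite "\<lambda>_::nat. lborel :: real measure"
  by (rule product_sigma_finite.intro) (rule sigma_finite_lborel)

section \<open>Integrals of triangular products\<close>

lemma nn_integral_lborel_PiM_Suc:
  assumes "f \<in> borel_measurable (PiM {..<Suc N} (\<lambda>_. lborel :: real measure))"
  shows "(\<integral>\<^sup>+u. f u \<partial>PiM {..<Suc N} (\<lambda>_. lborel)) =
    (\<integral>\<^sup>+u. (\<integral>\<^sup>+y. f (u(N := y)) \<partial>lborel) \<partial>PiM {..<N} (\<lambda>_. lborel))"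
  using lborel_product.product_nn_integral_insert[of "{..<N}" N f] assms by (simp add: lessThan_Suc)

context
  fixes w :: "nat \<Rightarrow> (nat \<Rightarrow> real) \<Rightarrow> ennreal"
  assumes w_meas [measurable]: "\<And>i N. i < N \<Longrightarrow> w i \<in> borel_measurable (PiM {..<N} (\<lambda>_. lborel))"
    and w_local: "\<And>i u v. (\<And>j. j \<le> i \<Longrightarrow> u j = v j) \<Longrightarrow> w i u = w i v"
begin

text \<open>Only the last factor sees the last coordinate, so integrating that coordinate out first
  leaves the other factors untouched.\<close>

lemma triangular_step:
  "(\<integral>\<^sup>+u. (\<Prod>i<Suc N. w i u) \<partial>PiM {..<Suc N} (\<lambda>_. lborel)) =
   (\<integral>\<^sup>+u. (\<Prod>i<N. w i u) * (\<integral>\<^sup>+y. w N (u(N := y)) \<partial>lborel) \<partial>PiM {..<N} (\<lambda>_. lborel))"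
proof -
  have "(\<integral>\<^sup>+u. (\<Prod>i<Suc N. w i u) \<partial>PiM {..<Suc N} (\<lambda>_. lborel)) =
    (\<integral>\<^sup>+u. (\<integral>\<^sup>+y. (\<Prod>i<Suc N. w i (u(N := y))) \<partial>lborel) \<partial>PiM {..<N} (\<lambda>_. lborel))"
    by (rule nn_integral_lborel_PiM_Suc) (intro borel_measurable_prod_ennreal, simp add: w_meas)
  also have "\<dots> = (\<integral>\<^sup>+u. (\<Prod>i<N. w i u) * (\<integral>\<^sup>+y. w N (u(N := y)) \<partial>lborel) \<partial>PiM {..<N} (\<lambda>_. lborel))"
  proof (intro nn_integral_cong)
    fix u assume u: "u \<in> space (PiM {..<N} (\<lambda>_. lborel :: real measure))"
    have m: "(\<lambda>y. u(N := y)) \<in> lborel \<rightarrow>\<^sub>M PiM {..<Suc N} (\<lambda>_. lborel :: real measure)"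
      using measurable_component_update[OF u, of N] by (simp add: lessThan_Suc)
    have "(\<Prod>i<Suc N. w i (u(N := y))) = (\<Prod>i<N. w i u) * w N (u(N := y))" for y
    proof -
      have "(\<Prod>i<N. w i (u(N := y))) = (\<Prod>i<N. w i u)"
        by (intro prod.cong refl w_local) auto
      then show ?thesis by simp
    qed
    then show "(\<integral>\<^sup>+y. (\<Prod>i<Suc N. w i (u(N := y))) \<partial>lborel) = (\<Prod>i<N. w i u) * (\<integral>\<^sup>+y. w N (u(N := y)) \<partial>lborel)"
      using measurable_compose[OF m w_meas[of N "Suc N"]] by (simp add: nn_integral_cmult)
  qed
  finally show ?thesis .
qed

lemma triangular_upper:
  assumes "\<And>i u. i < N \<Longrightarrow> (\<integral>\<^sup>+y. w i (u(i := y)) \<partial>lborel) \<le> c i"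
  shows "(\<integral>\<^sup>+u. (\<Prod>i<N. w i u) \<partial>PiM {..<N} (\<lambda>_. lborel)) \<le> (\<Prod>i<N. c i)"
  using assms
proof (induction N)
  case 0
  show ?case by (simp add: PiM_empty)
next
  case (Suc N)
  have "(\<integral>\<^sup>+u. (\<Prod>i<Suc N. w i u) \<partial>PiM {..<Suc N} (\<lambda>_. lborel)) \<le>
     (\<integral>\<^sup>+u. (\<Prod>i<N. w i u) * c N \<partial>PiM {..<N} (\<lambda>_. lborel))"
    unfolding triangular_step by (intro nn_integral_mono mult_left_mono Suc.prems) auto
  also have "\<dots> = (\<integral>\<^sup>+u. (\<Prod>i<N. w i u) \<partial>PiM {..<N} (\<lambda>_. lborel)) * c N"
    by (intro nn_integral_multc borel_measurable_prod_ennreal) (simp add: w_meas)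
  also have "\<dots> \<le> (\<Prod>i<N. c i) * c N" using Suc by (intro mult_right_mono) auto
  finally show ?case by simp
qed

text \<open>Where an earlier factor vanishes the whole product does, so the bound on factor i may
  assume that the earlier ones are nonzero. In \<open>hyperplane_ball_lower\<close> this carries the
  information that the running sum is still small.\<close>

lemma triangular_lower:
  assumes "\<And>i u. i < N \<Longrightarrow> (\<And>j. j < i \<Longrightarrow> w j u \<noteq> 0) \<Longrightarrow> c i \<le> (\<integral>\<^sup>+y. w i (u(i := y)) \<partial>lborel)"
  shows "(\<Prod>i<N. c i) \<le> (\<integral>\<^sup>+u. (\<Prod>i<N. w i u) \<partial>PiM {..<N} (\<lambda>_. lborel))"
  using assms
proof (induction N)
  case 0
  show ?case by (simp add: PiM_empty)
next
  case (Suc N)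
  have "(\<Prod>i<N. c i) * c N \<le> (\<integral>\<^sup>+u. (\<Prod>i<N. w i u) \<partial>PiM {..<N} (\<lambda>_. lborel)) * c N"
    using Suc by (intro mult_right_mono) auto
  also have "\<dots> = (\<integral>\<^sup>+u. (\<Prod>i<N. w i u) * c N \<partial>PiM {..<N} (\<lambda>_. lborel))"
    by (intro nn_integral_multc[symmetric] borel_measurable_prod_ennreal) (simp add: w_meas)
  also have "\<dots> \<le> (\<integral>\<^sup>+u. (\<Prod>i<Suc N. w i u) \<partial>PiM {..<Suc N} (\<lambda>_. lborel))"
    unfolding triangular_step
  proof (intro nn_integral_mono)
    fix u
    show "(\<Prod>i<N. w i u) * c N \<le> (\<Prod>i<N. w i u) * (\<integral>\<^sup>+y. w N (u(N := y)) \<partial>lborel)"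
    proof (cases "\<forall>j<N. w j u \<noteq> 0")
      case True
      then show ?thesis by (intro mult_left_mono Suc.prems) auto
    next
      case False
      then have "(\<Prod>i<N. w i u) = 0" by (intro prod_zero) auto
      then show ?thesis by (simp only: mult_zero_left order.refl)
    qed
  qed
  finally show ?case by simp
qed

end

lemma nn_integral_gaussian:
  assumes "0 < A" "0 < b"
  shows "(\<integral>\<^sup>+y. ennreal (exp (- A * (b * y + r)\<^sup>2)) \<partial>lborel) = ennreal (sqrt (pi / A) / b)"
proof -
  \<comment> \<open>Chosen so that A (b y + r)^2 = (y + r/b)^2 / (2 \<sigma>^2).\<close>
  define \<sigma> where "\<sigma> = 1 / (b * sqrt (2 * A))"
  have s: "0 < \<sigma>" using assms by (simp add: \<sigma>_def)
  have s2: "2 * \<sigma>\<^sup>2 = 1 / (A * b\<^sup>2)" using assms by (simp add: \<sigma>_def power2_eq_square field_simps)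
  have "exp (- A * (b * y + r)\<^sup>2) = sqrt (2 * pi * \<sigma>\<^sup>2) * normal_density (- r / b) \<sigma> y" for y
  proof -
    have "- A * (b * y + r)\<^sup>2 = - (y - - r / b)\<^sup>2 / (2 * \<sigma>\<^sup>2)"
      unfolding s2 using assms by (simp add: power2_eq_square field_simps)
    then show ?thesis using s unfolding normal_density_def by simp
  qed
  then have "(\<integral>\<^sup>+y. ennreal (exp (- A * (b * y + r)\<^sup>2)) \<partial>lborel)
    = (\<integral>\<^sup>+y. ennreal (sqrt (2 * pi * \<sigma>\<^sup>2)) * ennreal (normal_density (- r / b) \<sigma> y) \<partial>lborel)"
    by (simp only: ennreal_mult' ennreal_mult'' normal_density_nonneg)
  also have "\<dots> = ennreal (sqrt (2 * pi * \<sigma>\<^sup>2)) * (\<integral>\<^sup>+y. ennreal (normal_density (- r / b) \<sigma> y) \<partial>lborel)"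
    by (intro nn_integral_cmult) auto
  also have "(\<integral>\<^sup>+y. ennreal (normal_density (- r / b) \<sigma> y) \<partial>lborel) = 1"
  proof -
    interpret prob_space "density lborel (normal_density (- r / b) \<sigma>)" by (rule prob_space_normal_density[OF s])
    show ?thesis using emeasure_space_1 by (simp add: emeasure_density)
  qed
  also have "sqrt (2 * pi * \<sigma>\<^sup>2) = sqrt (pi / A) / b"
  proof -
    have "2 * pi * \<sigma>\<^sup>2 = pi / A / b\<^sup>2" using s2 by (simp add: field_simps)
    then show ?thesis using assms by (simp add: real_sqrt_divide real_sqrt_mult)
  qed
  finally show ?thesis by simp
qed

section \<open>Volume on the zero-sum hyperplane\<close>

definition embed :: "nat \<Rightarrow> (nat \<Rightarrow> real) \<Rightarrow> nat \<Rightarrow> real" where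
  "embed J u = (\<lambda>j\<in>{..<J}. if j = J - 1 then - (\<Sum>i<J - 1. u i) else u j)"

lemma measurable_embed [measurable]:
  "embed J \<in> PiM {..<J - 1} (\<lambda>_. lborel) \<rightarrow>\<^sub>M PiM {..<J} (\<lambda>_. borel)"
  unfolding embed_def[abs_def]
proof (rule measurable_restrict)
  fix j assume "j \<in> {..<J}"
  then show "(\<lambda>u. if j = J - 1 then - (\<Sum>i<J - 1. u i) else u j) \<in> PiM {..<J - 1} (\<lambda>_. lborel) \<rightarrow>\<^sub>M (borel :: real measure)"
    by (cases "j = J - 1") auto
qed

lemma hyperplane_lebesgue_eq:
  "hyperplane_lebesgue J = scale_measure (ennreal (sqrt (real J)))
     (distr (PiM {..<J - 1} (\<lambda>_. lborel)) (PiM {..<J} (\<lambda>_. borel)) (embed J))"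
  unfolding hyperplane_lebesgue_def embed_def[abs_def] ..

lemma sets_hyperplane_lebesgue [simp, measurable_cong]:
  "sets (hyperplane_lebesgue J) = sets (PiM {..<J} (\<lambda>_. borel))"
  by (simp add: hyperplane_lebesgue_eq)

lemma space_hyperplane_lebesgue [simp]: "space (hyperplane_lebesgue J) = space (PiM {..<J} (\<lambda>_. borel))"
  by (rule sets_eq_imp_space_eq) simp

lemma nn_integral_hyperplane:
  assumes [measurable]: "f \<in> borel_measurable (PiM {..<J} (\<lambda>_. borel))"
  shows "(\<integral>\<^sup>+\<theta>. f \<theta> \<partial>hyperplane_lebesgue J) = ennreal (sqrt (real J)) * (\<integral>\<^sup>+u. f (embed J u) \<partial>PiM {..<J - 1} (\<lambda>_. lborel))"
proof -
  have "(\<integral>\<^sup>+\<theta>. f \<theta> \<partial>distr (PiM {..<J - 1} (\<lambda>_. lborel)) (PiM {..<J} (\<lambda>_. borel)) (embed J))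
    = (\<integral>\<^sup>+u. f (embed J u) \<partial>PiM {..<J - 1} (\<lambda>_. lborel))"
    by (rule nn_integral_distr[OF measurable_embed]) simp
  then show ?thesis
    unfolding hyperplane_lebesgue_eq by (subst nn_integral_scale_measure) simp_all
qed

lemma embed_zero_sum:
  assumes "1 \<le> J"
  shows "embed J u \<in> zero_sum_hyperplane J"
proof -
  have "(\<Sum>j<J. embed J u j) = (\<Sum>j<Suc (J - 1). embed J u j)" using assms by simp
  also have "\<dots> = (\<Sum>j<J - 1. u j) - (\<Sum>i<J - 1. u i)"
    unfolding sum.lessThan_Suc using assms by (auto simp: embed_def intro!: sum.cong)
  finally show ?thesis by (auto simp: zero_sum_hyperplane_def embed_def)
qed

lemma AE_hyperplane:
  assumes "1 \<le> J"
  shows "AE \<theta> in hyperplane_lebesgue J. \<theta> \<in> zero_sum_hyperplane J"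
proof -
  define N where "N = {\<theta> \<in> space (PiM {..<J} (\<lambda>_. borel)). (\<Sum>j<J. \<theta> j) \<noteq> (0::real)}"
  have [measurable]: "N \<in> sets (PiM {..<J} (\<lambda>_. borel))" unfolding N_def by measurable
  have "emeasure (hyperplane_lebesgue J) N = (\<integral>\<^sup>+\<theta>. indicator N \<theta> \<partial>hyperplane_lebesgue J)"
    by (intro nn_integral_indicator[symmetric]) simp
  also have "\<dots> = ennreal (sqrt (real J)) * (\<integral>\<^sup>+u. indicator N (embed J u) \<partial>PiM {..<J - 1} (\<lambda>_. lborel))"
    by (intro nn_integral_hyperplane) measurable
  also have "(\<lambda>u. indicator N (embed J u) :: ennreal) = (\<lambda>u. 0)"
    using embed_zero_sum[OF assms] by (auto simp: N_def zero_sum_hyperplane_def indicator_def)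
  finally have N: "emeasure (hyperplane_lebesgue J) N = 0" by simp
  show ?thesis
  proof (rule AE_I[OF _ N])
    show "N \<in> sets (hyperplane_lebesgue J)" by simp
  qed (auto simp: N_def zero_sum_hyperplane_def space_PiM PiE_def)
qed

text \<open>The last coordinate is minus the sum of the others, so the deviations of the free
  coordinates must have a small sum as well. Choosing each deviation with sign opposite to the
  running sum keeps that sum within \<delta> and still leaves an interval of length \<delta> per
  coordinate.\<close>

lemma hyperplane_ball_lower:
  assumes "1 \<le> J" "0 < \<delta>" "\<theta>0 \<in> zero_sum_hyperplane J"
  shows "ennreal (\<delta> ^ (J - 1)) \<le> emeasure (hyperplane_lebesgue J)
     {\<theta> \<in> space (PiM {..<J} (\<lambda>_. borel)). \<forall>j<J. \<bar>\<theta> j - \<theta>0 j\<bar> \<le> \<delta>}" (is "_ \<le> emeasure _ ?B")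
proof -
  define w :: "nat \<Rightarrow> (nat \<Rightarrow> real) \<Rightarrow> ennreal"
    where "w i u = indicator {u. \<bar>u i - \<theta>0 i\<bar> \<le> \<delta> \<and> \<bar>\<Sum>j\<le>i. u j - \<theta>0 j\<bar> \<le> \<delta>} u" for i u
  have wm: "w i \<in> borel_measurable (PiM {..<N} (\<lambda>_. lborel))" if "i < N" for i N
  proof -
    have [measurable]: "(\<lambda>u. u j) \<in> borel_measurable (PiM {..<N} (\<lambda>_. lborel))" if "j \<le> i" for j
      using that \<open>i < N\<close> measurable_component_singleton[of j "{..<N}" "\<lambda>_. lborel :: real measure"] by simp
    have "Measurable.pred (PiM {..<N} (\<lambda>_. lborel)) (\<lambda>u. \<bar>u i - \<theta>0 i\<bar> \<le> \<delta> \<and> \<bar>\<Sum>j\<le>i. u j - \<theta>0 j\<bar> \<le> \<delta>)"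
      by measurable
    then show ?thesis unfolding w_def indicator_def by simp
  qed
  have "(\<Prod>i<J - 1. ennreal \<delta>) \<le> (\<integral>\<^sup>+u. (\<Prod>i<J - 1. w i u) \<partial>PiM {..<J - 1} (\<lambda>_. lborel))"
  proof (rule triangular_lower)
    show "w i \<in> borel_measurable (PiM {..<N} (\<lambda>_. lborel))" if "i < N" for i N using wm that .
    show "w i u = w i v" if "\<And>j. j \<le> i \<Longrightarrow> u j = v j" for i u v
    proof -
      have "(\<Sum>j\<le>i. u j - \<theta>0 j) = (\<Sum>j\<le>i. v j - \<theta>0 j)" using that by (intro sum.cong) auto
      then show ?thesis using that[of i] by (simp add: w_def indicator_def)
    qed
    show "ennreal \<delta> \<le> (\<integral>\<^sup>+y. w i (u(i := y)) \<partial>lborel)"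
      if "i < J - 1" and nz: "\<And>j. j < i \<Longrightarrow> w j u \<noteq> 0" for i u
    proof -
      define S where "S = (\<Sum>j<i. u j - \<theta>0 j)"
      have S: "\<bar>S\<bar> \<le> \<delta>"
      proof (cases i)
        case 0
        then show ?thesis using assms(2) by (simp add: S_def)
      next
        case (Suc i')
        have "w i' u \<noteq> 0" using nz Suc by simp
        then show ?thesis by (auto simp: w_def indicator_def S_def Suc lessThan_Suc_atMost split: if_splits)
      qed
      \<comment> \<open>The half of the allowed interval on the side that moves the running sum
        \<open>S\<close> towards zero.\<close>
      define I where "I = (if S \<le> 0 then {\<theta>0 i..\<theta>0 i + \<delta>} else {\<theta>0 i - \<delta>..\<theta>0 i})"
      have "(\<Sum>j\<le>i. (u(i := y)) j - \<theta>0 j) = S + (y - \<theta>0 i)" for y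
        unfolding S_def lessThan_Suc_atMost[symmetric] sum.lessThan_Suc by simp
      then have "indicator I y \<le> w i (u(i := y))" for y
        using S assms(2) by (auto simp: w_def I_def indicator_def split: if_splits)
      then have "(\<integral>\<^sup>+y. indicator I y \<partial>lborel) \<le> (\<integral>\<^sup>+y. w i (u(i := y)) \<partial>lborel)"
        by (intro nn_integral_mono) auto
      moreover have "(\<integral>\<^sup>+y. indicator I y \<partial>lborel) = ennreal \<delta>"
        using assms(2) by (simp add: I_def)
      ultimately show ?thesis by simp
    qed
  qed
  also have "\<dots> \<le> (\<integral>\<^sup>+u. indicator ?B (embed J u) \<partial>PiM {..<J - 1} (\<lambda>_. lborel))"
  proof (intro nn_integral_mono)
    fix u assume u: "u \<in> space (PiM {..<J - 1} (\<lambda>_. lborel :: real measure))"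
    show "(\<Prod>i<J - 1. w i u) \<le> indicator ?B (embed J u)"
    proof (cases "\<forall>i<J - 1. w i u \<noteq> 0")
      case True
      then have 1: "\<bar>u i - \<theta>0 i\<bar> \<le> \<delta>" "\<bar>\<Sum>j\<le>i. u j - \<theta>0 j\<bar> \<le> \<delta>" if "i < J - 1" for i
        using that by (auto simp: w_def indicator_def split: if_splits)
      have 2: "\<bar>\<Sum>j<J - 1. u j - \<theta>0 j\<bar> \<le> \<delta>"
      proof (cases "J - 1")
        case (Suc k)
        then show ?thesis using 1(2)[of k] by (simp only: lessThan_Suc_atMost)
      qed (use assms(2) in simp)
      have "(\<Sum>j<J. \<theta>0 j) = 0" using assms(3) by (simp add: zero_sum_hyperplane_def)
      then have "(\<Sum>j<Suc (J - 1). \<theta>0 j) = 0" using assms(1) by simp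
      then have "\<theta>0 (J - 1) = - (\<Sum>j<J - 1. \<theta>0 j)" by simp
      then have "\<bar>embed J u j - \<theta>0 j\<bar> \<le> \<delta>" if "j < J" for j
        using that 1(1)[of j] 2 by (cases "j = J - 1") (auto simp: embed_def sum_subtractf abs_minus_commute)
      moreover have "embed J u \<in> space (PiM {..<J} (\<lambda>_. borel))"
        using measurable_space[OF measurable_embed u] .
      moreover have "(\<Prod>i<J - 1. w i u) = 1"
        using True by (intro prod.neutral) (auto simp: w_def indicator_def split: if_splits)
      ultimately show ?thesis by (auto simp: indicator_def)
    next
      case False
      then have "(\<Prod>i<J - 1. w i u) = 0" by (intro prod_zero) auto
      then show ?thesis by (simp only: zero_le)
    qed
  qed
  \<comment> \<open>The Gram factor is at least one and only helps a lower bound.\<close>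
  also have "\<dots> \<le> ennreal (sqrt (real J)) * \<dots>"
    using assms(1) mult_right_mono[of 1 "ennreal (sqrt (real J))"] by simp
  also have "\<dots> = (\<integral>\<^sup>+\<theta>. indicator ?B \<theta> \<partial>hyperplane_lebesgue J)"
    by (intro nn_integral_hyperplane[symmetric]) measurable
  also have "\<dots> = emeasure (hyperplane_lebesgue J) ?B"
    by (intro nn_integral_indicator) (simp, measurable)
  finally show ?thesis using assms(2) by (simp add: ennreal_power)
qed

section \<open>Differences of cell averages\<close>

interpretation unit_lebesgue: prob_space unit_lebesgue
  by (rule prob_spaceI) (simp add: unit_lebesgue_def emeasure_restrict_space space_restrict_space)

lemma space_unit_lebesgue [simp]: "space unit_lebesgue = {0..1}"
  by (simp add: unit_lebesgue_def space_restrict_space)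

lemma measurable_unit_lebesgueI [measurable (raw)]:
  "f \<in> borel \<rightarrow>\<^sub>M N \<Longrightarrow> f \<in> unit_lebesgue \<rightarrow>\<^sub>M N"
  unfolding unit_lebesgue_def by (intro measurable_restrict_space1) simp

lemma integrable_unit_bounded:
  fixes f :: "real \<Rightarrow> real"
  assumes "f \<in> borel_measurable unit_lebesgue" "\<And>x. x \<in> {0..1} \<Longrightarrow> \<bar>f x\<bar> \<le> b"
  shows "integrable unit_lebesgue f"
  using assms by (intro unit_lebesgue.integrable_const_bound[of _ b]) auto

lemma prod_lessThan_add: "(\<Prod>i<m + n. f i) = (\<Prod>i<m. f i) * (\<Prod>i<n. f (m + i))"
  for f :: "nat \<Rightarrow> 'a::comm_monoid_mult"
  by (induction n) (auto simp: mult.assoc)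

context spline_basis
begin

definition cell :: "nat \<Rightarrow> real set" where
  "cell m = {real m / real K..<(real m + 1) / real K}"

definition avg :: "nat \<Rightarrow> (real \<Rightarrow> real) \<Rightarrow> real" where
  "avg m f = real K * (LINT x|unit_lebesgue. indicator (cell m) x * f x)"

text \<open>Differences of neighbouring cell averages do not see additive constants, so for the logarithm of a log spline density the normalising constant drops out.\<close>

definition avg_diff :: "nat \<Rightarrow> (real \<Rightarrow> real) \<Rightarrow> real" where
  "avg_diff l f = avg (l + 1) f - avg l f"

lemma Kpos: "0 < real K" using K1 by simp

lemma cell_borel [measurable]: "cell m \<in> sets borel"
  unfolding cell_def by simp

lemma integral_subinterval_unit:
  assumes "0 \<le> a" "a \<le> b" "b \<le> 1"
  shows "(LINT x|unit_lebesgue. indicator {a..<b} x) = b - (a::real)"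
proof -
  have "(LINT x|unit_lebesgue. indicator {a..<b} x) = measure unit_lebesgue ({a..<b} \<inter> space unit_lebesgue)"
    by simp
  also have "{a..<b} \<inter> space unit_lebesgue = {a..<b}" using assms by auto
  also have "measure unit_lebesgue {a..<b} = measure lborel {a..<b}"
    unfolding unit_lebesgue_def using assms by (intro measure_restrict_space) auto
  finally show ?thesis using assms by simp
qed

lemma cell_in_unit: assumes "m < K" shows "0 \<le> real m / real K" "real m / real K \<le> (real m + 1) / real K" "(real m + 1) / real K \<le> 1"
  using assms by (auto simp: field_simps)

lemma avg_const:
  assumes "m < K"
  shows "avg m (\<lambda>_. c) = c"
proof -
  have "(LINT x|unit_lebesgue. indicator (cell m) x) = 1 / real K"
    using integral_subinterval_unit[OF cell_in_unit[OF assms]] unfolding cell_def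
    by (simp add: add_divide_distrib)
  then show ?thesis unfolding avg_def using Kpos by simp
qed

lemma integrable_cell_mult: "integrable unit_lebesgue f \<Longrightarrow> integrable unit_lebesgue (\<lambda>x. indicator (cell m) x * (f x :: real))"
proof -
  assume f: "integrable unit_lebesgue f"
  have "cell m \<inter> {0..1} \<in> sets unit_lebesgue"
    unfolding unit_lebesgue_def sets_restrict_space by auto
  then have "integrable unit_lebesgue (\<lambda>x. indicator (cell m \<inter> {0..1}) x *\<^sub>R f x)"
    using f by (rule integrable_mult_indicator)
  then show ?thesis
    by (rule Bochner_Integration.integrable_cong[THEN iffD1, rotated 2]) (auto simp: indicator_def)
qed

lemma avg_sum:
  assumes "\<And>j. j \<in> S \<Longrightarrow> integrable unit_lebesgue (f j)"
  shows "avg m (\<lambda>x. \<Sum>j\<in>S. \<theta> j * f j x) = (\<Sum>j\<in>S. \<theta> j * avg m (f j))"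
proof -
  have "avg m (\<lambda>x. \<Sum>j\<in>S. \<theta> j * f j x) = real K * (LINT x|unit_lebesgue. (\<Sum>j\<in>S. \<theta> j * (indicator (cell m) x * f j x)))"
    unfolding avg_def by (simp add: sum_distrib_left mult_ac)
  also have "\<dots> = real K * (\<Sum>j\<in>S. \<theta> j * (LINT x|unit_lebesgue. indicator (cell m) x * f j x))"
    by (subst Bochner_Integration.integral_sum) (auto intro!: integrable_cell_mult assms)
  finally show ?thesis unfolding avg_def by (simp add: sum_distrib_left mult_ac)
qed

lemma avg_fun_diff:
  assumes "integrable unit_lebesgue f" "integrable unit_lebesgue g"
  shows "avg m (\<lambda>x. f x - g x) = avg m f - avg m g"
proof -
  have "(LINT x|unit_lebesgue. indicator (cell m) x * (f x - g x))
    = (LINT x|unit_lebesgue. indicator (cell m) x * f x) - (LINT x|unit_lebesgue. indicator (cell m) x * g x)"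
    by (subst Bochner_Integration.integral_diff[symmetric]) (auto simp: integrable_cell_mult assms right_diff_distrib)
  then show ?thesis unfolding avg_def by (simp add: right_diff_distrib)
qed

text \<open>Cauchy-Schwarz on a cell of length 1/K, obtained by expanding the nonnegative integral
  of (f - avg)^2 over the cell.\<close>

lemma avg_square_le:
  assumes "m < K" "integrable unit_lebesgue f" "integrable unit_lebesgue (\<lambda>x. (f x)\<^sup>2)"
  shows "(avg m f)\<^sup>2 \<le> real K * (LINT x|unit_lebesgue. indicator (cell m) x * (f x)\<^sup>2)"
proof -
  let ?c = "avg m f"
  let ?I = "\<lambda>g. LINT x|unit_lebesgue. indicator (cell m) x * (g x :: real)"
  have 1: "?I (\<lambda>_. 1) = 1 / real K"
    using avg_const[OF assms(1), of 1] Kpos unfolding avg_def by (simp add: field_simps)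
  have 2: "?I f = ?c / real K" unfolding avg_def using Kpos by simp
  have "0 \<le> ?I (\<lambda>x. (f x - ?c)\<^sup>2)" by (intro Bochner_Integration.integral_nonneg) auto
  also have "\<dots> = (LINT x|unit_lebesgue. indicator (cell m) x * (f x)\<^sup>2 - 2 * ?c * (indicator (cell m) x * f x) + ?c\<^sup>2 * (indicator (cell m) x * 1))"
    by (intro Bochner_Integration.integral_cong) (auto simp: power2_eq_square algebra_simps)
  also have "\<dots> = ?I (\<lambda>x. (f x)\<^sup>2) - 2 * ?c * ?I f + ?c\<^sup>2 * ?I (\<lambda>_. 1)"
    using assms integrable_cell_mult[of "\<lambda>_. 1" m]
    by (simp add: integrable_cell_mult del: mult_1_right)
  also have "\<dots> = ?I (\<lambda>x. (f x)\<^sup>2) - ?c\<^sup>2 / real K" unfolding 1 2 using Kpos by (simp add: power2_eq_square field_simps)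
  finally show ?thesis using Kpos by (simp add: field_simps)
qed

lemma sum_indicator_cell_le: "(\<Sum>m<n. indicator (cell m) x) \<le> (1::real)"
proof -
  have "(\<Sum>m<n. indicator (cell m) x) = (\<Sum>m<n. of_bool (real m / real K \<le> x) - (of_bool (real (Suc m) / real K \<le> x) :: real))"
  proof (intro sum.cong refl)
    fix m
    have "real m / real K < real (Suc m) / real K" using Kpos by (intro divide_strict_right_mono) auto
    then show "indicator (cell m) x = of_bool (real m / real K \<le> x) - (of_bool (real (Suc m) / real K \<le> x) :: real)"
      unfolding cell_def indicator_def by (auto simp: add.commute)
  qed
  also have "\<dots> = of_bool (real 0 / real K \<le> x) - of_bool (real n / real K \<le> x)"
    by (rule sum_lessThan_telescope')
  finally show ?thesis by simp
qed

lemma sum_avg_square_le: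
  assumes "integrable unit_lebesgue f" "integrable unit_lebesgue (\<lambda>x. (f x)\<^sup>2)"
  shows "(\<Sum>m<K. (avg m f)\<^sup>2) \<le> real K * (LINT x|unit_lebesgue. (f x)\<^sup>2)"
proof -
  have "(\<Sum>m<K. (avg m f)\<^sup>2) \<le> (\<Sum>m<K. real K * (LINT x|unit_lebesgue. indicator (cell m) x * (f x)\<^sup>2))"
    using assms by (intro sum_mono avg_square_le) auto
  also have "\<dots> = real K * (LINT x|unit_lebesgue. (\<Sum>m<K. indicator (cell m) x * (f x)\<^sup>2))"
    using assms by (subst Bochner_Integration.integral_sum) (auto simp: sum_distrib_left integrable_cell_mult)
  also have "\<dots> \<le> real K * (LINT x|unit_lebesgue. (f x)\<^sup>2)"
  proof (intro mult_left_mono integral_mono)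
    fix x
    have "(\<Sum>m<K. indicator (cell m) x * (f x)\<^sup>2) = (\<Sum>m<K. indicator (cell m) x) * (f x)\<^sup>2"
      by (simp add: sum_distrib_right)
    also have "\<dots> \<le> 1 * (f x)\<^sup>2" by (intro mult_right_mono sum_indicator_cell_le) auto
    finally show "(\<Sum>m<K. indicator (cell m) x * (f x)\<^sup>2) \<le> (f x)\<^sup>2" by simp
    show "integrable unit_lebesgue (\<lambda>x. \<Sum>m<K. indicator (cell m) x * (f x)\<^sup>2)"
      by (intro Bochner_Integration.integrable_sum integrable_cell_mult assms)
  qed (use assms in auto)
  finally show ?thesis .
qed

text \<open>The 4 arises from (a - b)^2 \<le> 2 a^2 + 2 b^2 and from each cell occurring in at most
  two differences.\<close>

lemma sum_avg_diff_square_le: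
  assumes "integrable unit_lebesgue f" "integrable unit_lebesgue (\<lambda>x. (f x)\<^sup>2)"
  shows "(\<Sum>l<K - 2. (avg_diff l f)\<^sup>2) \<le> 4 * real K * (LINT x|unit_lebesgue. (f x)\<^sup>2)"
proof -
  have "(\<Sum>l<K - 2. (avg_diff l f)\<^sup>2) \<le> (\<Sum>l<K - 2. 2 * (avg (Suc l) f)\<^sup>2 + 2 * (avg l f)\<^sup>2)"
  proof (intro sum_mono)
    fix l
    have "0 \<le> (avg (Suc l) f + avg l f)\<^sup>2" by simp
    then show "(avg_diff l f)\<^sup>2 \<le> 2 * (avg (Suc l) f)\<^sup>2 + 2 * (avg l f)\<^sup>2"
      unfolding avg_diff_def by (simp add: power2_eq_square algebra_simps)
  qed
  also have "\<dots> = 2 * (\<Sum>l<K - 2. (avg (Suc l) f)\<^sup>2) + 2 * (\<Sum>l<K - 2. (avg l f)\<^sup>2)"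
    by (simp add: sum.distrib sum_distrib_left)
  also have "(\<Sum>l<K - 2. (avg (Suc l) f)\<^sup>2) = (\<Sum>m\<in>Suc ` {..<K - 2}. (avg m f)\<^sup>2)"
    by (simp add: sum.reindex)
  also have "2 * \<dots> + 2 * (\<Sum>l<K - 2. (avg l f)\<^sup>2) \<le> 2 * (\<Sum>m<K. (avg m f)\<^sup>2) + 2 * (\<Sum>m<K. (avg m f)\<^sup>2)"
    by (intro add_mono mult_left_mono sum_mono2) auto
  finally show ?thesis using sum_avg_square_le[OF assms] by linarith
qed

lemma B_spline_le_1: "j < J \<Longrightarrow> x \<in> {0..1} \<Longrightarrow> \<bar>B_spline q J j x\<bar> \<le> 1"
  using member_le_sum[of j "{..<J}" "\<lambda>j. B_spline q J j x"] B_spline_nonneg B_spline_sum by auto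

lemma integrable_B_spline: "j < J \<Longrightarrow> integrable unit_lebesgue (B_spline q J j)"
  by (rule integrable_unit_bounded[where b = 1]) (auto intro: B_spline_le_1[unfolded atLeastAtMost_iff])

lemma avg_diff_spline: "avg_diff l (spline_comb q J \<theta>) = (\<Sum>j<J. \<theta> j * avg_diff l (B_spline q J j))"
  unfolding avg_diff_def spline_comb_def
  by (subst (1 2) avg_sum) (auto simp: integrable_B_spline right_diff_distrib sum_subtractf)

lemma avg_B_spline_zero:
  assumes "m < K" "m + q \<le> j"
  shows "avg m (B_spline q J j) = 0"
proof -
  have "(LINT x|unit_lebesgue. indicator (cell m) x * B_spline q J j x) = (LINT x|unit_lebesgue. 0)"
    using B_spline_cell_zero[OF assms(1) _ assms(2)]
    by (intro Bochner_Integration.integral_cong) (auto simp: cell_def indicator_def)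
  then show ?thesis by (simp add: avg_def)
qed

text \<open>Integrates \<open>bspline_left_half\<close> for degree q - 1; the half cell contributes
  the additional factor 1/2.\<close>

lemma avg_B_spline_lower:
  assumes "m < K"
  shows "(1 / 2) ^ q / fact (q - 1) \<le> avg m (B_spline q J (m + q - 1))"
proof -
  let ?I = "{real m / real K + 1 / (2 * real K)..<(real m + 1) / real K}" and ?v = "(1 / 2) ^ (q - 1) / fact (q - 1) :: real"
  have j: "m + q - 1 < J" using assms J_eq q1 by simp
  have e: "(real m + 1) / real K - (real m / real K + 1 / (2 * real K)) = 1 / (2 * real K)"
    using Kpos by (simp add: field_simps)
  have p: "0 < 1 / (2 * real K)" using Kpos by simp
  have "(LINT x|unit_lebesgue. indicator ?I x * ?v) \<le> (LINT x|unit_lebesgue. indicator (cell m) x * B_spline q J (m + q - 1) x)"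
  proof (intro integral_mono integrable_cell_mult integrable_B_spline j)
    show "integrable unit_lebesgue (\<lambda>x. indicator ?I x * ?v)"
      by (rule integrable_unit_bounded[where b = ?v]) (auto simp: indicator_def)
    fix x
    show "indicator ?I x * ?v \<le> indicator (cell m) x * B_spline q J (m + q - 1) x"
    proof (cases "x \<in> ?I")
      case True
      then have "x \<in> cell m" using p unfolding cell_def atLeastLessThan_iff by linarith
      then show ?thesis using bspline_left_half[OF assms True, of "q - 1"] True by (simp add: B_spline_eq)
    qed (simp add: B_spline_nonneg)
  qed
  also have "(LINT x|unit_lebesgue. indicator ?I x * ?v) = 1 / (2 * real K) * ?v"
    using integral_subinterval_unit[of "real m / real K + 1 / (2 * real K)" "(real m + 1) / real K"] e p cell_in_unit[OF assms]
    by simp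
  finally have "real K * (1 / (2 * real K) * ?v) \<le> avg m (B_spline q J (m + q - 1))"
    unfolding avg_def using Kpos by (intro mult_left_mono) auto
  moreover have "real K * (1 / (2 * real K) * ?v) = (1 / 2) * ?v" using Kpos by simp
  moreover have "(1 / 2) * ?v = (1 / 2) ^ Suc (q - 1) / fact (q - 1)" by simp
  ultimately show ?thesis using q1 by simp
qed

lemma avg_diff_B_spline_zero: "l < K - 2 \<Longrightarrow> q + l < j \<Longrightarrow> avg_diff l (B_spline q J j) = 0"
  unfolding avg_diff_def by (simp add: avg_B_spline_zero)

text \<open>The spline with index q + l starts exactly at cell l + 1. Its average over cell l is
  zero, so nothing is subtracted from the diagonal entry of the triangular system.\<close>

lemma avg_diff_B_spline_lower: "l < K - 2 \<Longrightarrow> (1 / 2) ^ q / fact (q - 1) \<le> avg_diff l (B_spline q J (q + l))"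
  unfolding avg_diff_def using avg_B_spline_lower[of "l + 1"] q1 by (simp add: avg_B_spline_zero add.commute)

text \<open>As \<open>avg_diff l\<close> involves only the coefficients with index at most \<open>q + l\<close>, the last one with a coefficient bounded below, the Gaussian factors can be integrated out one coordinate at a time.\<close>

lemma gaussian_volume:
  assumes "2 \<le> K" "0 < A" "0 \<le> R"
  shows "(\<integral>\<^sup>+\<theta>. indicator {\<theta>. \<forall>j<J. \<bar>\<theta> j\<bar> \<le> R} \<theta> *
        ennreal (exp (- A * (\<Sum>l<K - 2. (avg_diff l (spline_comb q J \<theta>) - e l)\<^sup>2))) \<partial>hyperplane_lebesgue J)
     \<le> ennreal (sqrt (real J) * ((2 * R) ^ q * (sqrt (pi / A) / ((1 / 2) ^ q / fact (q - 1))) ^ (K - 2)))"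
proof -
  define c where "c l j = avg_diff l (B_spline q J j)" for l j
  define b :: real where "b = (1 / 2) ^ q / fact (q - 1)"
  have b: "0 < b" by (simp add: b_def)
  define w :: "nat \<Rightarrow> (nat \<Rightarrow> real) \<Rightarrow> ennreal" where
    "w i u = (if i < q then indicator {-R..R} (u i)
       else ennreal (exp (- A * ((\<Sum>j\<le>i. u j * c (i - q) j) - e (i - q))\<^sup>2)))" for i u
  \<comment> \<open>Count of the free coordinates: the first q are merely confined to the cube, and
    coordinate q + l is controlled by difference l. One more difference, l = K - 2, would have
    coordinate J - 1 on its diagonal, which the hyperplane already determines.\<close>
  have J1: "J - 1 = q + (K - 2)" using J_eq assms(1) q1 by simp
  have J1': "1 \<le> J" using q1 qJ by simp
  have [measurable]: "(\<lambda>\<theta>. \<theta> j) \<in> borel_measurable (PiM {..<J} (\<lambda>_. borel :: real measure))" if "j < J" for j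
    using that by simp
  have "Measurable.pred (PiM {..<J} (\<lambda>_. borel :: real measure)) (\<lambda>\<theta>. \<forall>j<J. \<bar>\<theta> j\<bar> \<le> R)"
    by measurable
  then have m1': "indicator {\<theta>. \<forall>j<J. \<bar>\<theta> j\<bar> \<le> R} \<in> borel_measurable (PiM {..<J} (\<lambda>_. borel :: real measure))"
    unfolding indicator_def by simp
  have m2: "(\<lambda>\<theta>. avg_diff l (spline_comb q J \<theta>)) \<in> borel_measurable (PiM {..<J} (\<lambda>_. borel :: real measure))" for l
    unfolding avg_diff_spline by measurable
  note [measurable] = m1' m2
  have "(\<integral>\<^sup>+\<theta>. indicator {\<theta>. \<forall>j<J. \<bar>\<theta> j\<bar> \<le> R} \<theta> *
        ennreal (exp (- A * (\<Sum>l<K - 2. (avg_diff l (spline_comb q J \<theta>) - e l)\<^sup>2))) \<partial>hyperplane_lebesgue J)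
     = ennreal (sqrt (real J)) * (\<integral>\<^sup>+u. indicator {\<theta>. \<forall>j<J. \<bar>\<theta> j\<bar> \<le> R} (embed J u) *
        ennreal (exp (- A * (\<Sum>l<K - 2. (avg_diff l (spline_comb q J (embed J u)) - e l)\<^sup>2))) \<partial>PiM {..<J - 1} (\<lambda>_. lborel))"
    by (rule nn_integral_hyperplane) measurable
  also have "\<dots> \<le> ennreal (sqrt (real J)) * (\<integral>\<^sup>+u. (\<Prod>i<J - 1. w i u) \<partial>PiM {..<J - 1} (\<lambda>_. lborel))"
  proof (intro mult_left_mono nn_integral_mono)
    fix u
    show "indicator {\<theta>. \<forall>j<J. \<bar>\<theta> j\<bar> \<le> R} (embed J u) *
        ennreal (exp (- A * (\<Sum>l<K - 2. (avg_diff l (spline_comb q J (embed J u)) - e l)\<^sup>2))) \<le> (\<Prod>i<J - 1. w i u)"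
    proof (cases "\<forall>j<J. \<bar>embed J u j\<bar> \<le> R")
      case True
      have E: "embed J u j = u j" if "j < J - 1" for j using that by (auto simp: embed_def)
      have w1: "w i u = 1" if "i < q" for i
      proof -
        have "i < J" "i < J - 1" using that J1 by auto
        then have "\<bar>u i\<bar> \<le> R" using True E by metis
        then show ?thesis using that by (auto simp: w_def indicator_def)
      qed
      have w2: "w (q + l) u = ennreal (exp (- A * (avg_diff l (spline_comb q J (embed J u)) - e l)\<^sup>2))" if l: "l < K - 2" for l
      proof -
        have "avg_diff l (spline_comb q J (embed J u)) = (\<Sum>j\<le>q + l. embed J u j * c l j)"
          unfolding avg_diff_spline c_def using l J1 avg_diff_B_spline_zero[OF l]
          by (intro sum.mono_neutral_right) auto
        also have "\<dots> = (\<Sum>j\<le>q + l. u j * c l j)" using l J1 by (intro sum.cong) (auto simp: E)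
        finally show ?thesis by (simp add: w_def)
      qed
      have "(\<Prod>i<J - 1. w i u) = (\<Prod>i<q. w i u) * (\<Prod>l<K - 2. w (q + l) u)"
        unfolding J1 by (rule prod_lessThan_add)
      also have "\<dots> = (\<Prod>l<K - 2. ennreal (exp (- A * (avg_diff l (spline_comb q J (embed J u)) - e l)\<^sup>2)))"
        using w1 w2 by simp
      also have "\<dots> = ennreal (exp (- A * (\<Sum>l<K - 2. (avg_diff l (spline_comb q J (embed J u)) - e l)\<^sup>2)))"
        by (subst prod_ennreal) (auto simp: exp_sum sum_distrib_left)
      finally show ?thesis using True by simp
    qed (auto simp: indicator_def)
  qed simp
  also have "(\<integral>\<^sup>+u. (\<Prod>i<J - 1. w i u) \<partial>PiM {..<J - 1} (\<lambda>_. lborel))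
     \<le> (\<Prod>i<J - 1. if i < q then ennreal (2 * R) else ennreal (sqrt (pi / A) / b))"
  proof (rule triangular_upper)
    show "w i \<in> borel_measurable (PiM {..<N} (\<lambda>_. lborel))" if "i < N" for i N
    proof -
      have [measurable]: "(\<lambda>u. u j) \<in> borel_measurable (PiM {..<N} (\<lambda>_. lborel :: real measure))" if "j \<le> i" for j
        using that \<open>i < N\<close> measurable_component_singleton[of j "{..<N}" "\<lambda>_. lborel :: real measure"] by simp
      show ?thesis unfolding w_def[abs_def] by (cases "i < q") (simp_all, measurable)
    qed
    show "w i u = w i v" if "\<And>j. j \<le> i \<Longrightarrow> u j = v j" for i u v
    proof -
      have "(\<Sum>j\<le>i. u j * c (i - q) j) = (\<Sum>j\<le>i. v j * c (i - q) j)" using that by (intro sum.cong) auto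
      then show ?thesis using that[of i] by (simp add: w_def)
    qed
    show "(\<integral>\<^sup>+y. w i (u(i := y)) \<partial>lborel) \<le> (if i < q then ennreal (2 * R) else ennreal (sqrt (pi / A) / b))"
      if i: "i < J - 1" for i u
    proof (cases "i < q")
      case True
      have "(\<integral>\<^sup>+y. w i (u(i := y)) \<partial>lborel) = (\<integral>\<^sup>+y. indicator {-R..R} y \<partial>lborel)"
        using True by (simp add: w_def)
      then show ?thesis using True assms(3) by simp
    next
      case False
      define l where "l = i - q"
      have l: "l < K - 2" "i = q + l" using i J1 False by (auto simp: l_def)
      have cb: "b \<le> c l i" using avg_diff_B_spline_lower[OF l(1)] by (simp add: b_def c_def l(2))
      define r where "r = (\<Sum>j<i. u j * c l j) - e l"
      have "(\<Sum>j\<le>i. (u(i := y)) j * c l j) - e l = c l i * y + r" for y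
        unfolding r_def lessThan_Suc_atMost[symmetric] sum.lessThan_Suc by simp
      then have "(\<integral>\<^sup>+y. w i (u(i := y)) \<partial>lborel) = (\<integral>\<^sup>+y. ennreal (exp (- A * (c l i * y + r)\<^sup>2)) \<partial>lborel)"
        using False by (simp add: w_def flip: l_def)
      also have "\<dots> = ennreal (sqrt (pi / A) / c l i)"
        using assms(2) cb b by (intro nn_integral_gaussian) auto
      also have "\<dots> \<le> ennreal (sqrt (pi / A) / b)"
        using cb b assms(2) by (intro ennreal_leI divide_left_mono) auto
      finally show ?thesis using False by simp
    qed
  qed
  also have "(\<Prod>i<J - 1. if i < q then ennreal (2 * R) else ennreal (sqrt (pi / A) / b)) = ennreal ((2 * R) ^ q * (sqrt (pi / A) / b) ^ (K - 2))"
  proof -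
    have "(\<Prod>i<q + k. if i < q then x else y) = x ^ q * y ^ k" for x y :: ennreal and k
      by (simp add: prod_lessThan_add)
    moreover have "ennreal x ^ q * ennreal y ^ k = ennreal (x ^ q * y ^ k)" if "0 \<le> x" "0 \<le> y" for x y k
      using that by (simp add: ennreal_power ennreal_mult)
    moreover have "0 \<le> 2 * R" "0 \<le> sqrt (pi / A) / b" using assms b by auto
    ultimately show ?thesis unfolding J1 by metis
  qed
  finally show ?thesis
    using assms b by (simp add: b_def ennreal_mult mult_left_mono)
qed

end

section \<open>Square-root likelihood ratios\<close>

text \<open>A test written as an inequality. Where W \<ge> u, Markov's bound 1 \<le> W / u applies;
  elsewhere u / W \<ge> 1 may be multiplied to y.\<close>

lemma min_one_le:
  fixes y W :: ennreal
  assumes "0 < u"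
  shows "min 1 y \<le> W / ennreal u + y * (ennreal u * inverse W)"
proof (cases "ennreal u \<le> W")
  case True
  have "1 = ennreal u / ennreal u" using assms by (simp add: ennreal_divide_self)
  also have "\<dots> \<le> W / ennreal u" using True by (rule divide_right_mono_ennreal)
  finally have "1 \<le> W / ennreal u" .
  then have "min 1 y \<le> W / ennreal u" by (rule min.coboundedI1)
  then show ?thesis by (rule order_trans) simp
next
  case False
  then have W: "W < ennreal u" by simp
  have "1 \<le> ennreal u * inverse W"
  proof (cases "W = 0")
    case True
    then show ?thesis using assms by (simp add: ennreal_mult_top)
  next
    case False
    have "W < top" using W by (rule less_trans) simp
    then have "1 = W * inverse W" using False by (simp add: ennreal_divide_self flip: divide_ennreal_def)
    also have "\<dots> \<le> ennreal u * inverse W" using W by (intro mult_right_mono) auto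
    finally show ?thesis .
  qed
  then have "y * 1 \<le> y * (ennreal u * inverse W)" by (rule mult_left_mono) simp
  then have "min 1 y \<le> y * (ennreal u * inverse W)" by (simp add: min.coboundedI2)
  then show ?thesis by (rule order_trans) simp
qed

text \<open>Cauchy-Schwarz in the form that the squared measure of b is at most the product of the
  integrals of f and 1/f. It turns the reciprocal of an average, whose expectation is intractable,
  into an average of reciprocals.\<close>

lemma inverse_nn_integral_le:
  fixes f :: "'a \<Rightarrow> real"
  assumes [measurable]: "f \<in> borel_measurable M" "b \<in> sets M"
    and pos: "\<And>x. x \<in> b \<Longrightarrow> 0 < f x"
    and v: "0 < emeasure M b" "emeasure M b < \<infinity>"
  shows "inverse (\<integral>\<^sup>+x\<in>b. ennreal (f x) \<partial>M)
     \<le> (\<integral>\<^sup>+x\<in>b. ennreal (1 / f x) \<partial>M) / (emeasure M b)\<^sup>2"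
proof -
  define F where "F = (\<integral>\<^sup>+x\<in>b. ennreal (f x) \<partial>M)"
  define G where "G = (\<integral>\<^sup>+x\<in>b. ennreal (1 / f x) \<partial>M)"
  define v where "v = measure M b"
  have vv: "emeasure M b = ennreal v" using v by (simp add: v_def emeasure_eq_ennreal_measure top.not_eq_extremum)
  have v0: "0 < v" using v vv by (simp add: ennreal_eq_0_iff not_le flip: ennreal_eq_0_iff)
  have F0: "F \<noteq> 0"
  proof
    assume "F = 0"
    then have "AE x in M. ennreal (f x) * indicator b x = 0"
      unfolding F_def by (subst (asm) nn_integral_0_iff_AE) auto
    then have "AE x in M. x \<notin> b"
    proof (rule eventually_mono)
      fix x assume "ennreal (f x) * indicator b x = 0"
      then show "x \<notin> b" using pos[of x] by (auto simp: ennreal_eq_0_iff)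
    qed
    then have "emeasure M {x \<in> space M. x \<in> b} = 0" by (rule emeasure_eq_0_AE)
    moreover have "{x \<in> space M. x \<in> b} = b" using sets.sets_into_space[OF assms(2)] by auto
    ultimately have "emeasure M b = 0" by simp
    then show False using v(1) by simp
  qed
  show ?thesis
  proof (cases "F = \<infinity> \<or> G = \<infinity>")
    case True
    then show ?thesis
      unfolding F_def[symmetric] G_def[symmetric] vv using v0
      by (auto simp: ennreal_power ennreal_top_divide)
  next
    case False
    obtain f' where f': "F = ennreal f'" "0 < f'"
      using False F0 by (cases F) (auto simp: order_less_le)
    obtain g where g: "G = ennreal g" "0 \<le> g" using False by (cases G) auto
    \<comment> \<open>With c the mean of f over b, integrating 2 \<le> f/c + c/f gives 2 v \<le> v +
      c g, which is the claim rearranged.\<close>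
    define c where "c = f' / v"
    have c: "0 < c" using f' v0 by (simp add: c_def)
    have "2 * ennreal v = (\<integral>\<^sup>+x. ennreal 2 * indicator b x \<partial>M)" by (simp add: nn_integral_cmult vv)
    also have "\<dots> \<le> (\<integral>\<^sup>+x. ennreal (1 / c) * (ennreal (f x) * indicator b x) + ennreal c * (ennreal (1 / f x) * indicator b x) \<partial>M)"
    proof (intro nn_integral_mono)
      fix x
      show "ennreal 2 * indicator b x \<le> ennreal (1 / c) * (ennreal (f x) * indicator b x) + ennreal c * (ennreal (1 / f x) * indicator b x)"
      proof (cases "x \<in> b")
        case True
        note p = pos[OF True]
        have "0 \<le> (f x - c)\<^sup>2 / (c * f x)" using c p by simp
        also have "\<dots> = 1 / c * f x + c * (1 / f x) - 2" using c p by (simp add: power2_eq_square field_simps)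
        finally have "ennreal 2 \<le> ennreal (1 / c * f x + c * (1 / f x))" by (intro ennreal_leI) simp
        also have "\<dots> = ennreal (1 / c) * ennreal (f x) + ennreal c * ennreal (1 / f x)"
        proof -
          have "0 \<le> 1 / c" "0 \<le> f x" "0 \<le> c" "0 \<le> 1 / f x" using c p by auto
          then show ?thesis by (metis ennreal_mult ennreal_plus mult_nonneg_nonneg)
        qed
        finally show ?thesis using True by simp
      qed simp
    qed
    also have "\<dots> = ennreal (1 / c) * F + ennreal c * G"
    proof -
      have [measurable]: "(\<lambda>x. ennreal (f x) * indicator b x) \<in> borel_measurable M"
        "(\<lambda>x. ennreal (1 / f x) * indicator b x) \<in> borel_measurable M" by measurable
      show ?thesis unfolding F_def G_def
        by (subst nn_integral_add, measurable, subst (1 2) nn_integral_cmult, measurable)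
    qed
    also have "\<dots> = ennreal (v + c * g)"
    proof -
      have "0 \<le> 1 / c" "0 \<le> f'" "0 \<le> c" using c f' by auto
      then have "ennreal (1 / c) * ennreal f' + ennreal c * ennreal g = ennreal (1 / c * f' + c * g)"
        using g(2) by (metis ennreal_mult ennreal_plus mult_nonneg_nonneg)
      moreover have "1 / c * f' = v" using f' v0 by (simp add: c_def)
      ultimately show ?thesis unfolding f' g by (simp only:)
    qed
    finally have le: "2 * ennreal v \<le> ennreal (v + c * g)" .
    have "2 * ennreal v = ennreal (2 * v)" using v0 by (subst ennreal_mult) auto
    then have "ennreal (2 * v) \<le> ennreal (v + c * g)" using le by (simp only:)
    moreover have "0 \<le> v + c * g" using v0 c g(2) by simp
    ultimately have "2 * v \<le> v + c * g" by (simp only: ennreal_le_iff)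
    then have "v\<^sup>2 \<le> f' * g" unfolding c_def using v0 by (simp add: field_simps power2_eq_square)
    then have "1 / f' \<le> g / v\<^sup>2" using f' v0 by (simp add: field_simps)
    then show ?thesis
      unfolding F_def[symmetric] G_def[symmetric] vv f' g using f' g v0
      by (simp add: inverse_ennreal ennreal_power divide_ennreal inverse_eq_divide)
  qed
qed

locale sampling =
  fixes P0 :: "real measure" and p0 :: "real \<Rightarrow> real" and n :: nat and \<Lambda> :: real
  assumes P0_prob: "prob_space P0"
    and P0_eq: "P0 = density unit_lebesgue (\<lambda>x. ennreal (p0 x))"
    and p0_meas [measurable]: "p0 \<in> borel_measurable unit_lebesgue"
    and Lam1: "1 \<le> \<Lambda>"
    and p0_bounds: "\<And>x. x \<in> {0..1} \<Longrightarrow> 1 / \<Lambda> \<le> p0 x \<and> p0 x \<le> \<Lambda>"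
begin

abbreviation sample where "sample \<equiv> PiM {..<n} (\<lambda>_. P0)"

text \<open>The two-sided bound makes the Hellinger, chi-square and squared L2 distances, and the
  squared L2 distance of the logarithms, comparable up to powers of \<Lambda>.\<close>

definition good :: "(real \<Rightarrow> real) \<Rightarrow> bool" where
  "good f \<longleftrightarrow> f \<in> borel_measurable unit_lebesgue \<and> (\<forall>x\<in>{0..1}. 1 / \<Lambda> \<le> f x \<and> f x \<le> \<Lambda>) \<and> (LINT x|unit_lebesgue. f x) = 1"

definition sqd :: "(real \<Rightarrow> real) \<Rightarrow> real" where
  "sqd f = (LINT x|unit_lebesgue. (f x - p0 x)\<^sup>2)"

lemma sets_P0 [measurable_cong]: "sets P0 = sets unit_lebesgue"
  by (simp add: P0_eq)

lemma space_P0: "space P0 = {0..1}"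
  by (simp add: P0_eq)

lemma p0_pos: "x \<in> {0..1} \<Longrightarrow> 0 < p0 x"
  using p0_bounds[of x] Lam1 divide_pos_pos[of 1 \<Lambda>] by linarith

lemma good_p0: "good p0"
proof -
  interpret prob_space P0 by (rule P0_prob)
  have "(\<integral>\<^sup>+x. ennreal (p0 x) \<partial>unit_lebesgue) = 1"
  proof -
    have "(\<integral>\<^sup>+x. 1 \<partial>P0) = (\<integral>\<^sup>+x. ennreal (p0 x) * 1 \<partial>unit_lebesgue)"
      unfolding P0_eq by (rule nn_integral_density) auto
    then show ?thesis using emeasure_space_1 by simp
  qed
  then have "(LINT x|unit_lebesgue. p0 x) = 1"
    using p0_pos by (intro integral_eq_nn_integral[THEN trans] AE_I2) (auto intro: less_imp_le)
  then show ?thesis unfolding good_def using p0_bounds by auto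
qed

lemma good_pos:
  assumes "good f" "x \<in> {0..1}"
  shows "0 < f x"
proof -
  have "1 / \<Lambda> \<le> f x" using assms unfolding good_def by blast
  then show ?thesis using Lam1 divide_pos_pos[of 1 \<Lambda>] by linarith
qed

lemma good_integrable:
  assumes "good f"
  shows "integrable unit_lebesgue f"
proof (rule integrable_unit_bounded)
  show "f \<in> borel_measurable unit_lebesgue" using assms by (simp add: good_def)
  show "\<bar>f x\<bar> \<le> \<Lambda>" if "x \<in> {0..1}" for x
    using good_pos[OF assms that] assms that unfolding good_def by simp
qed

lemma good_diff_bound:
  assumes "good f" "good g" "x \<in> {0..1}"
  shows "\<bar>f x - g x\<bar> \<le> \<Lambda>"
proof -
  have "f x \<le> \<Lambda>" "g x \<le> \<Lambda>" using assms unfolding good_def by blast+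
  then show ?thesis using good_pos[OF assms(1,3)] good_pos[OF assms(2,3)] by linarith
qed

lemma good_sq_integrable:
  assumes "good f" "good g"
  shows "integrable unit_lebesgue (\<lambda>x. (f x - g x)\<^sup>2)"
proof (rule integrable_unit_bounded)
  show "(\<lambda>x. (f x - g x)\<^sup>2) \<in> borel_measurable unit_lebesgue"
    using assms by (auto simp: good_def)
  fix x :: real assume "x \<in> {0..1}"
  from good_diff_bound[OF assms this] have "\<bar>f x - g x\<bar>\<^sup>2 \<le> \<Lambda>\<^sup>2"
    by (intro power_mono) auto
  then show "\<bar>(f x - g x)\<^sup>2\<bar> \<le> \<Lambda>\<^sup>2" by simp
qed

text \<open>Independence reduces to one observation, and 1 + e \<le> exp e. The majorant
  \<open>h\<close> is chosen in each application so that its integral can be computed.\<close>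

lemma nn_integral_sample_prod:
  assumes [measurable]: "g \<in> borel_measurable unit_lebesgue" and g0: "\<And>x. x \<in> {0..1} \<Longrightarrow> 0 \<le> g x"
    and h: "integrable unit_lebesgue h" "\<And>x. x \<in> {0..1} \<Longrightarrow> p0 x * g x \<le> h x"
    and e: "(LINT x|unit_lebesgue. h x) \<le> 1 + e"
  shows "(\<integral>\<^sup>+X. (\<Prod>i<n. ennreal (g (X i))) \<partial>sample) \<le> ennreal (exp (real n * e))"
proof -
  interpret P0: prob_space P0 by (rule P0_prob)
  interpret product_sigma_finite "\<lambda>_::nat. P0"
    by (rule product_sigma_finite.intro) (rule P0.sigma_finite_measure_axioms)
  have prod_eq: "(\<integral>\<^sup>+X. (\<Prod>i<n. ennreal (g (X i))) \<partial>sample) = (\<Prod>i<n. \<integral>\<^sup>+x. ennreal (g x) \<partial>P0)"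
    by (rule product_nn_integral_prod) auto
  have "(\<integral>\<^sup>+x. ennreal (g x) \<partial>P0) = (\<integral>\<^sup>+x. ennreal (p0 x) * ennreal (g x) \<partial>unit_lebesgue)"
    unfolding P0_eq by (rule nn_integral_density) auto
  also have "\<dots> \<le> (\<integral>\<^sup>+x. ennreal (h x) \<partial>unit_lebesgue)"
    using h(2) p0_pos g0 by (intro nn_integral_mono) (auto simp: ennreal_mult[symmetric] less_imp_le intro!: ennreal_leI)
  also have "\<dots> = ennreal (LINT x|unit_lebesgue. h x)"
  proof (intro nn_integral_eq_integral AE_I2 h(1))
    fix x assume "x \<in> space unit_lebesgue"
    then have "x \<in> {0..1}" by simp
    then show "0 \<le> h x" using mult_nonneg_nonneg[OF less_imp_le[OF p0_pos] g0, of x x] h(2)[of x] by linarith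
  qed
  also have "\<dots> \<le> ennreal (exp e)"
    using e exp_ge_add_one_self[of e] by (intro ennreal_leI) linarith
  finally have "(\<integral>\<^sup>+x. ennreal (g x) \<partial>P0) \<le> ennreal (exp e)" .
  then have "(\<Prod>i<n. \<integral>\<^sup>+x. ennreal (g x) \<partial>P0) \<le> (\<Prod>i<n. ennreal (exp e))"
    by (simp add: power_mono)
  also have "\<dots> = ennreal (exp (real n * e))" by (simp add: ennreal_power exp_of_nat_mult)
  finally show ?thesis
    unfolding prod_eq by simp
qed

text \<open>The left side is sqrt (a b), the mean of a and b minus half of (sqrt b - sqrt a)^2. As
  (sqrt a + sqrt b)^2 \<le> 4 \<Lambda>, that square is at least (b - a)^2 / (4 \<Lambda>).\<close>

lemma sqrt_affinity:
  assumes "0 < a" "0 < b" "a \<le> \<Lambda>" "b \<le> \<Lambda>"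
  shows "a * sqrt (b / a) \<le> (a + b) / 2 - (b - a)\<^sup>2 / (8 * \<Lambda>)"
proof -
  define s t where "s = sqrt a" and "t = sqrt b"
  have st: "0 < s" "0 < t" "a = s\<^sup>2" "b = t\<^sup>2" using assms by (auto simp: s_def t_def)
  have "(s + t)\<^sup>2 \<le> 4 * \<Lambda>"
  proof -
    have "(s + t)\<^sup>2 + (s - t)\<^sup>2 = 2 * a + 2 * b" by (simp add: st power2_eq_square algebra_simps)
    then show ?thesis using assms zero_le_power2[of "s - t"] by linarith
  qed
  then have "(s + t)\<^sup>2 * (t - s)\<^sup>2 \<le> 4 * \<Lambda> * (t - s)\<^sup>2" by (intro mult_right_mono) auto
  moreover have "(s + t)\<^sup>2 * (t - s)\<^sup>2 = (b - a)\<^sup>2" by (simp add: st power2_eq_square algebra_simps)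
  ultimately have "(b - a)\<^sup>2 / (8 * \<Lambda>) \<le> (t - s)\<^sup>2 / 2" using Lam1 by (simp add: field_simps)
  moreover have "a * sqrt (b / a) = s * t"
    using st by (simp add: real_sqrt_divide power2_eq_square)
  moreover have "(a + b) / 2 - (t - s)\<^sup>2 / 2 = s * t" by (simp add: st power2_eq_square field_simps)
  ultimately show ?thesis by linarith
qed

lemma sqrt_lr_expectation:
  assumes "good f"
  shows "(\<integral>\<^sup>+X. (\<Prod>i<n. ennreal (sqrt (f (X i) / p0 (X i)))) \<partial>sample) \<le> ennreal (exp (- (real n * sqd f / (8 * \<Lambda>))))"
proof -
  have [measurable]: "f \<in> borel_measurable unit_lebesgue" using assms by (simp add: good_def)
  note i = good_integrable[OF assms] good_integrable[OF good_p0] good_sq_integrable[OF assms good_p0]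
  have "(\<integral>\<^sup>+X. (\<Prod>i<n. ennreal (sqrt (f (X i) / p0 (X i)))) \<partial>sample) \<le> ennreal (exp (real n * (- (sqd f / (8 * \<Lambda>)))))"
  proof (rule nn_integral_sample_prod)
    show "p0 x * sqrt (f x / p0 x) \<le> (p0 x + f x) / 2 - (f x - p0 x)\<^sup>2 / (8 * \<Lambda>)" if "x \<in> {0..1}" for x
      using that p0_pos good_pos[OF assms] p0_bounds assms by (intro sqrt_affinity) (auto simp: good_def)
    show "(LINT x|unit_lebesgue. (p0 x + f x) / 2 - (f x - p0 x)\<^sup>2 / (8 * \<Lambda>)) \<le> 1 + - (sqd f / (8 * \<Lambda>))"
      using i assms good_p0 by (simp add: good_def sqd_def)
  qed (use i p0_pos good_pos[OF assms] in \<open>auto intro!: divide_nonneg_nonneg less_imp_le\<close>)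
  then show ?thesis by simp
qed

text \<open>To be read with a = p0, with c the density under study and b a neighbour of it. Writing
  c = b + (c - b) and splitting off 1 from the root leaves the affinity of a and b, a product of two
  small quantities, and c - b. The last integrates to zero, so the error is quadratic in
  \<eta>.\<close>

lemma sqrt_swap_pointwise:
  assumes "0 < a" "a \<le> \<Lambda>" "1 / \<Lambda> \<le> b" "b \<le> \<Lambda>" "\<bar>c - b\<bar> \<le> \<eta>"
  shows "c * sqrt (a / b) \<le> (a + b) / 2 + (c - b) - (c - a)\<^sup>2 / (32 * \<Lambda>) + 5 * \<Lambda> ^ 3 * \<eta>\<^sup>2"
proof -
  have L: "0 < \<Lambda>" using Lam1 by simp
  have b: "0 < b" using assms(3) L by (auto intro: less_le_trans[of 0 "1 / \<Lambda>"])
  have eta: "0 \<le> \<eta>" using assms(5) by simp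
  define s t where "s = sqrt a" and "t = sqrt b"
  have st: "0 < s" "0 < t" "a = s\<^sup>2" "b = t\<^sup>2" using assms b by (auto simp: s_def t_def)
  have r: "sqrt (a / b) = s / t" by (simp add: real_sqrt_divide s_def t_def)
  have 1: "b * sqrt (a / b) \<le> (b + a) / 2 - (a - b)\<^sup>2 / (8 * \<Lambda>)"
    using assms b by (intro sqrt_affinity) auto
  have 2: "\<bar>sqrt (a / b) - 1\<bar> \<le> \<Lambda> * \<bar>a - b\<bar>"
  proof -
    have e: "sqrt (a / b) - 1 = (a - b) / (t * (s + t))"
      unfolding r using st by (simp add: power2_eq_square divide_simps) (simp add: algebra_simps)
    have "t * (s + t) = b + s * t" by (simp add: st power2_eq_square algebra_simps)
    then have "1 / \<Lambda> \<le> t * (s + t)" using assms(3) mult_pos_pos[OF st(1,2)] by linarith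
    then have "\<bar>a - b\<bar> / (t * (s + t)) \<le> \<bar>a - b\<bar> / (1 / \<Lambda>)"
      using L st by (intro divide_left_mono) auto
    then show ?thesis unfolding e abs_divide using st by (simp add: mult.commute)
  qed
  have "(c - b) * (sqrt (a / b) - 1) \<le> \<bar>c - b\<bar> * \<bar>sqrt (a / b) - 1\<bar>"
    by (metis abs_ge_self abs_mult)
  also have "\<dots> \<le> \<eta> * (\<Lambda> * \<bar>a - b\<bar>)" using 2 assms(5) eta by (intro mult_mono) auto
  also have "\<dots> \<le> (a - b)\<^sup>2 / (16 * \<Lambda>) + 4 * \<Lambda> ^ 3 * \<eta>\<^sup>2"
  proof -
    define u where "u = \<bar>a - b\<bar>"
    \<comment> \<open>The weight is chosen so that the cross term costs (a - b)^2 / (16 \<Lambda>),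
      half of what the affinity gains. The other half pays in \<open>5\<close> for replacing (a -
      b)^2 by (c - a)^2.\<close>
    have "0 \<le> (u - 8 * \<Lambda>\<^sup>2 * \<eta>)\<^sup>2" by simp
    then have "16 * \<Lambda> * (\<eta> * (\<Lambda> * u)) \<le> u\<^sup>2 + 64 * \<Lambda> ^ 4 * \<eta>\<^sup>2"
      by (simp add: power2_eq_square eval_nat_numeral algebra_simps)
    then have "16 * \<Lambda> * (\<eta> * (\<Lambda> * u)) / (16 * \<Lambda>) \<le> (u\<^sup>2 + 64 * \<Lambda> ^ 4 * \<eta>\<^sup>2) / (16 * \<Lambda>)"
      using L by (intro divide_right_mono) auto
    also have "\<dots> = u\<^sup>2 / (16 * \<Lambda>) + 4 * \<Lambda> ^ 3 * \<eta>\<^sup>2"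
      using L by (simp add: add_divide_distrib power3_eq_cube power4_eq_xxxx)
    finally show ?thesis using L by (simp add: u_def)
  qed
  finally have 3: "(c - b) * (sqrt (a / b) - 1) \<le> (a - b)\<^sup>2 / (16 * \<Lambda>) + 4 * \<Lambda> ^ 3 * \<eta>\<^sup>2" .
  have 4: "(c - a)\<^sup>2 \<le> 2 * \<eta>\<^sup>2 + 2 * (a - b)\<^sup>2"
  proof -
    have "(c - b)\<^sup>2 \<le> \<eta>\<^sup>2" using assms(5) eta by (metis abs_le_square_iff abs_of_nonneg)
    moreover have "(c - a)\<^sup>2 \<le> 2 * (c - b)\<^sup>2 + 2 * (a - b)\<^sup>2"
      using zero_le_power2[of "(c - b) + (a - b)"] by (simp add: power2_eq_square algebra_simps)
    ultimately show ?thesis by linarith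
  qed
  then have 5: "(c - a)\<^sup>2 / (32 * \<Lambda>) \<le> \<eta>\<^sup>2 / (16 * \<Lambda>) + (a - b)\<^sup>2 / (16 * \<Lambda>)"
    using L by (simp add: field_simps)
  have 6: "\<eta>\<^sup>2 / (16 * \<Lambda>) \<le> \<Lambda> ^ 3 * \<eta>\<^sup>2"
  proof -
    have "1 / (16 * \<Lambda>) \<le> 1" using Lam1 by (simp add: field_simps)
    also have "1 \<le> \<Lambda> ^ 3" using Lam1 by simp
    finally have "\<eta>\<^sup>2 * (1 / (16 * \<Lambda>)) \<le> \<eta>\<^sup>2 * \<Lambda> ^ 3" by (intro mult_left_mono) auto
    then show ?thesis by (simp add: mult.commute)
  qed
  have 7: "(a - b)\<^sup>2 / (8 * \<Lambda>) = (a - b)\<^sup>2 / (16 * \<Lambda>) + (a - b)\<^sup>2 / (16 * \<Lambda>)" using L by (simp add: field_simps)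
  have 8: "c * sqrt (a / b) = b * sqrt (a / b) + (c - b) * (sqrt (a / b) - 1) + (c - b)"
    by (simp add: algebra_simps)
  have 9: "4 * \<Lambda> ^ 3 * \<eta>\<^sup>2 + \<Lambda> ^ 3 * \<eta>\<^sup>2 = 5 * \<Lambda> ^ 3 * \<eta>\<^sup>2"
    by (simp add: algebra_simps)
  have "x \<le> (a + b) / 2 + w - q + l5"
    if "x = y + z + w" "y \<le> (b + a) / 2 - p8" "z \<le> p16 + l4" "q \<le> e + p16" "e \<le> l" "p8 = p16 + p16" "l4 + l = l5"
    for x y z w p8 p16 q e l l4 l5 :: real
    using that by argo
  from this[OF 8 1 3 5 6 7 9] show ?thesis .
qed

text \<open>Error of the second kind: under the density f, the inverse root likelihood ratio of a
  neighbour g is still exponentially small.\<close>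

lemma sqrt_swap_expectation:
  assumes f: "good f" and g: "good g" and close: "\<And>x. x \<in> {0..1} \<Longrightarrow> \<bar>f x - g x\<bar> \<le> \<eta>"
  shows "(\<integral>\<^sup>+X. (\<Prod>i<n. ennreal (f (X i) / p0 (X i) * sqrt (p0 (X i) / g (X i)))) \<partial>sample)
     \<le> ennreal (exp (real n * (5 * \<Lambda> ^ 3 * \<eta>\<^sup>2 - sqd f / (32 * \<Lambda>))))"
proof (rule nn_integral_sample_prod)
  have [measurable]: "f \<in> borel_measurable unit_lebesgue" "g \<in> borel_measurable unit_lebesgue"
    using f g by (simp_all add: good_def)
  note i = good_integrable[OF f] good_integrable[OF g] good_integrable[OF good_p0] good_sq_integrable[OF f good_p0]
  let ?h = "\<lambda>x. (p0 x + g x) / 2 + (f x - g x) - (f x - p0 x)\<^sup>2 / (32 * \<Lambda>) + 5 * \<Lambda> ^ 3 * \<eta>\<^sup>2"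
  show "(\<lambda>x. f x / p0 x * sqrt (p0 x / g x)) \<in> borel_measurable unit_lebesgue" by measurable
  show "0 \<le> f x / p0 x * sqrt (p0 x / g x)" if "x \<in> {0..1}" for x
    using that p0_pos good_pos[OF f] good_pos[OF g] by (simp add: less_imp_le)
  show "integrable unit_lebesgue ?h" using i by auto
  show "p0 x * (f x / p0 x * sqrt (p0 x / g x)) \<le> ?h x" if "x \<in> {0..1}" for x
    using sqrt_swap_pointwise[of "p0 x" "g x" "f x" \<eta>] that p0_pos[of x] p0_bounds g close[OF that]
    by (simp add: good_def)
  show "(LINT x|unit_lebesgue. ?h x) \<le> 1 + (5 * \<Lambda> ^ 3 * \<eta>\<^sup>2 - sqd f / (32 * \<Lambda>))"
    using i f g good_p0 unit_lebesgue.prob_space by (simp add: good_def sqd_def)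
qed

text \<open>The expectation of p0/f is one plus the chi-square distance, by p0^2/f = 2 p0 - f + (f -
  p0)^2/f.\<close>

lemma inverse_lr_expectation:
  assumes f: "good f"
  shows "(\<integral>\<^sup>+X. (\<Prod>i<n. ennreal (p0 (X i) / f (X i))) \<partial>sample) \<le> ennreal (exp (real n * (\<Lambda> * sqd f)))"
proof (rule nn_integral_sample_prod)
  have [measurable]: "f \<in> borel_measurable unit_lebesgue" using f by (simp add: good_def)
  note i = good_integrable[OF f] good_integrable[OF good_p0] good_sq_integrable[OF f good_p0]
  let ?h = "\<lambda>x. 2 * p0 x - f x + \<Lambda> * (f x - p0 x)\<^sup>2"
  show "(\<lambda>x. p0 x / f x) \<in> borel_measurable unit_lebesgue" by measurable
  show "0 \<le> p0 x / f x" if "x \<in> {0..1}" for x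
    using that p0_pos good_pos[OF f] by (simp add: less_imp_le)
  show "integrable unit_lebesgue ?h" using i by auto
  show "p0 x * (p0 x / f x) \<le> ?h x" if "x \<in> {0..1}" for x
  proof -
    have fx: "0 < f x" "1 / \<Lambda> \<le> f x" using good_pos[OF f that] f that by (auto simp: good_def)
    have "p0 x * (p0 x / f x) = 2 * p0 x - f x + (1 / f x) * (f x - p0 x)\<^sup>2"
      using fx by (simp add: field_simps power2_eq_square)
    moreover have r: "1 / f x \<le> \<Lambda>" using fx Lam1 by (simp add: field_simps)
    moreover from r have "(1 / f x) * (f x - p0 x)\<^sup>2 \<le> \<Lambda> * (f x - p0 x)\<^sup>2"
      by (rule mult_right_mono) simp
    ultimately show ?thesis by linarith
  qed
  show "(LINT x|unit_lebesgue. ?h x) \<le> 1 + \<Lambda> * sqd f"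
    using i f good_p0 by (simp add: good_def sqd_def)
qed

end

section \<open>Bayesian tests and evidence bounds\<close>

lemma inverse_ennreal_antimono:
  assumes "(a::ennreal) \<le> b"
  shows "inverse b \<le> inverse a"
proof (cases "a = 0 \<or> b = top")
  case False
  then have "a < top" "b < top" "0 < a" using assms by (auto simp: less_top[symmetric] top_unique zero_less_iff_neq_zero)
  then obtain r s where rs: "a = ennreal r" "0 < r" "b = ennreal s" "r \<le> s" "0 < s"
    using assms by (cases a; cases b) (auto simp: ennreal_le_iff)
  then show ?thesis by (simp add: inverse_ennreal ennreal_leI le_imp_inverse_le)
qed auto

locale sampling_model = sampling +
  fixes T :: "'a measure" and p :: "'a \<Rightarrow> real \<Rightarrow> real"
  assumes p_meas: "(\<lambda>(\<theta>, x). p \<theta> x) \<in> borel_measurable (T \<Otimes>\<^sub>M unit_lebesgue)"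
begin

definition lr :: "'a \<Rightarrow> (nat \<Rightarrow> real) \<Rightarrow> real" where
  "lr \<theta> X = (\<Prod>i<n. p \<theta> (X i) / p0 (X i))"

definition root_lr :: "'a \<Rightarrow> (nat \<Rightarrow> real) \<Rightarrow> real" where
  "root_lr \<theta> X = (\<Prod>i<n. sqrt (p \<theta> (X i) / p0 (X i)))"

lemma sample_component: "X \<in> space sample \<Longrightarrow> i < n \<Longrightarrow> X i \<in> {0..1}"
  using space_P0 by (auto simp: space_PiM PiE_def Pi_def)

lemma measurable_p_component [measurable]:
  assumes "i < n"
  shows "(\<lambda>z. p (fst z) (snd z i)) \<in> borel_measurable (T \<Otimes>\<^sub>M sample)"
proof -
  have [measurable]: "(\<lambda>X. X i) \<in> sample \<rightarrow>\<^sub>M unit_lebesgue"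
    using measurable_component_singleton[of i "{..<n}" "\<lambda>_. P0"] assms sets_P0
    by (metis (no_types, lifting) lessThan_iff measurable_cong_sets)
  have "(\<lambda>z. (fst z, snd z i)) \<in> T \<Otimes>\<^sub>M sample \<rightarrow>\<^sub>M T \<Otimes>\<^sub>M unit_lebesgue" by measurable
  from measurable_compose[OF this p_meas] show ?thesis by simp
qed

lemma lr_meas [measurable]: "(\<lambda>z. lr (fst z) (snd z)) \<in> borel_measurable (T \<Otimes>\<^sub>M sample)"
  unfolding lr_def by (intro borel_measurable_prod) (auto intro!: borel_measurable_divide measurable_compose[OF measurable_snd])

lemma root_lr_meas [measurable]: "(\<lambda>z. root_lr (fst z) (snd z)) \<in> borel_measurable (T \<Otimes>\<^sub>M sample)"
  unfolding root_lr_def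
  by (intro borel_measurable_prod)
    (auto intro!: borel_measurable_divide borel_measurable_sqrt measurable_compose[OF measurable_snd])

lemma root_lr_pos: "good (p \<theta>) \<Longrightarrow> X \<in> space sample \<Longrightarrow> 0 < root_lr \<theta> X"
  unfolding root_lr_def using good_pos p0_pos sample_component by (intro prod_pos) auto

lemma lr_pos: "good (p \<theta>) \<Longrightarrow> X \<in> space sample \<Longrightarrow> 0 < lr \<theta> X"
  unfolding lr_def using good_pos p0_pos sample_component by (intro prod_pos) auto

lemma prod_ennreal_sample:
  assumes "\<And>x. x \<in> {0..1} \<Longrightarrow> 0 \<le> g x"
  shows "(\<integral>\<^sup>+X. ennreal (\<Prod>i<n. g (X i)) \<partial>sample) = (\<integral>\<^sup>+X. (\<Prod>i<n. ennreal (g (X i))) \<partial>sample)"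
  using assms sample_component by (intro nn_integral_cong prod_ennreal[symmetric]) auto

lemma root_lr_expectation:
  assumes "good (p \<theta>)"
  shows "(\<integral>\<^sup>+X. ennreal (root_lr \<theta> X) \<partial>sample) \<le> ennreal (exp (- (real n * sqd (p \<theta>) / (8 * \<Lambda>))))"
  unfolding root_lr_def
  by (subst prod_ennreal_sample[where g = "\<lambda>x. sqrt (p \<theta> x / p0 x)"])
    (use good_pos[OF assms] p0_pos sqrt_lr_expectation[OF assms] in \<open>auto intro!: divide_nonneg_nonneg less_imp_le\<close>)

lemma lr_root_lr_expectation:
  assumes f: "good (p \<theta>)" and g: "good (p \<theta>')" and close: "\<And>x. x \<in> {0..1} \<Longrightarrow> \<bar>p \<theta> x - p \<theta>' x\<bar> \<le> \<eta>"
  shows "(\<integral>\<^sup>+X. ennreal (lr \<theta> X) * ennreal (1 / root_lr \<theta>' X) \<partial>sample)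
    \<le> ennreal (exp (real n * (5 * \<Lambda> ^ 3 * \<eta>\<^sup>2 - sqd (p \<theta>) / (32 * \<Lambda>))))"
proof -
  have "(\<integral>\<^sup>+X. ennreal (lr \<theta> X) * ennreal (1 / root_lr \<theta>' X) \<partial>sample)
    = (\<integral>\<^sup>+X. ennreal (\<Prod>i<n. p \<theta> (X i) / p0 (X i) * sqrt (p0 (X i) / p \<theta>' (X i))) \<partial>sample)"
  proof (intro nn_integral_cong)
    fix X assume X: "X \<in> space sample"
    have "lr \<theta> X * (1 / root_lr \<theta>' X) = (\<Prod>i<n. p \<theta> (X i) / p0 (X i) * sqrt (p0 (X i) / p \<theta>' (X i)))"
      unfolding lr_def root_lr_def prod.distrib prod_dividef[symmetric]
      by (simp add: real_sqrt_divide prod_dividef)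
    then show "ennreal (lr \<theta> X) * ennreal (1 / root_lr \<theta>' X) = ennreal (\<Prod>i<n. p \<theta> (X i) / p0 (X i) * sqrt (p0 (X i) / p \<theta>' (X i)))"
      using lr_pos[OF f X] root_lr_pos[OF g X] by (simp add: ennreal_mult[symmetric] less_imp_le)
  qed
  also have "\<dots> = (\<integral>\<^sup>+X. (\<Prod>i<n. ennreal (p \<theta> (X i) / p0 (X i) * sqrt (p0 (X i) / p \<theta>' (X i)))) \<partial>sample)"
    using good_pos[OF f] good_pos[OF g] p0_pos
    by (intro prod_ennreal_sample[where g = "\<lambda>x. p \<theta> x / p0 x * sqrt (p0 x / p \<theta>' x)"])
      (auto intro!: mult_nonneg_nonneg divide_nonneg_nonneg less_imp_le)
  also have "\<dots> \<le> ennreal (exp (real n * (5 * \<Lambda> ^ 3 * \<eta>\<^sup>2 - sqd (p \<theta>) / (32 * \<Lambda>))))"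
    by (rule sqrt_swap_expectation[OF f g close])
  finally show ?thesis .
qed

lemma sample_sigma_finite: "sigma_finite_measure sample"
proof -
  interpret P0: prob_space P0 by (rule P0_prob)
  interpret product_sigma_finite "\<lambda>_::nat. P0"
    by (rule product_sigma_finite.intro) (rule P0.sigma_finite_measure_axioms)
  show ?thesis by (rule sigma_finite) simp
qed

lemma measurable_param:
  assumes "sets \<mu> = sets T"
  shows "(\<lambda>z. lr (fst z) (snd z)) \<in> borel_measurable (\<mu> \<Otimes>\<^sub>M sample)"
    "(\<lambda>z. root_lr (fst z) (snd z)) \<in> borel_measurable (\<mu> \<Otimes>\<^sub>M sample)"
proof -
  have "sets (\<mu> \<Otimes>\<^sub>M sample) = sets (T \<Otimes>\<^sub>M sample)" using assms by (intro sets_pair_measure_cong) auto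
  then show "(\<lambda>z. lr (fst z) (snd z)) \<in> borel_measurable (\<mu> \<Otimes>\<^sub>M sample)"
    "(\<lambda>z. root_lr (fst z) (snd z)) \<in> borel_measurable (\<mu> \<Otimes>\<^sub>M sample)"
    using lr_meas root_lr_meas by (metis (no_types, lifting) measurable_cong_sets)+
qed

text \<open>The test statistic is the average of the root likelihood ratio over \<open>\<nu>\<close>; compared with the threshold \<open>u\<close> it plays the role of the tests that are usually built from a covering of \<open>S\<close>.\<close>

lemma bayes_test:
  fixes \<mu> \<nu> :: "'a measure" and k F :: ennreal
  assumes sets: "sets \<mu> = sets T" "sets \<nu> = sets T"
    and sf: "sigma_finite_measure \<mu>" "sigma_finite_measure \<nu>"
    and S: "S \<in> sets T"
    and good_nu: "AE \<theta> in \<nu>. good (p \<theta>)"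
    and uv: "0 < u" "0 < v"
    and ball: "AE \<theta> in \<mu>. \<theta> \<in> S \<longrightarrow> good (p \<theta>) \<and> (\<exists>b\<in>sets T. ennreal v \<le> emeasure \<nu> b \<and> emeasure \<nu> b < \<infinity> \<and>
        (\<forall>\<theta>'\<in>b. good (p \<theta>') \<and> (\<forall>x\<in>{0..1}. \<bar>p \<theta> x - p \<theta>' x\<bar> \<le> \<eta>)))"
    and F: "(\<integral>\<^sup>+\<theta>. ennreal (exp (- (real n * sqd (p \<theta>) / (8 * \<Lambda>)))) \<partial>\<nu>) \<le> F"
  shows "(\<integral>\<^sup>+X. min 1 (k * (\<integral>\<^sup>+\<theta>\<in>S. ennreal (lr \<theta> X) \<partial>\<mu>)) \<partial>sample) \<le> F / ennreal u +
     k * ennreal (u / v) * (\<integral>\<^sup>+\<theta>\<in>S. ennreal (exp (real n * (5 * \<Lambda> ^ 3 * \<eta>\<^sup>2 - sqd (p \<theta>) / (32 * \<Lambda>)))) \<partial>\<mu>)"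
proof -
  interpret mu: sigma_finite_measure \<mu> by (rule sf)
  interpret nu: sigma_finite_measure \<nu> by (rule sf)
  interpret smp: sigma_finite_measure sample by (rule sample_sigma_finite)
  interpret ps: pair_sigma_finite \<nu> sample ..
  interpret pm: pair_sigma_finite \<mu> sample ..
  note [measurable_cong] = sets
  note [measurable] = S measurable_param[OF sets(1)] measurable_param[OF sets(2)]
  define W where "W X = (\<integral>\<^sup>+\<theta>'. ennreal (root_lr \<theta>' X) \<partial>\<nu>)" for X
  have swap: "(\<lambda>z. root_lr (snd z) (fst z)) \<in> borel_measurable (sample \<Otimes>\<^sub>M \<nu>)"
    "(\<lambda>z. lr (snd z) (fst z)) \<in> borel_measurable (sample \<Otimes>\<^sub>M \<mu>)"
    using measurable_compose[OF measurable_pair_swap' measurable_param(2)[OF sets(2)]]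
      measurable_compose[OF measurable_pair_swap' measurable_param(1)[OF sets(1)]]
    by (simp_all add: split_beta')
  note [measurable] = swap
  have Wm [measurable]: "W \<in> borel_measurable sample"
    unfolding W_def by measurable
  have Am [measurable]: "(\<lambda>X. \<integral>\<^sup>+\<theta>\<in>S. ennreal (lr \<theta> X) \<partial>\<mu>) \<in> borel_measurable sample"
    by measurable
  have "(\<integral>\<^sup>+X. min 1 (k * (\<integral>\<^sup>+\<theta>\<in>S. ennreal (lr \<theta> X) \<partial>\<mu>)) \<partial>sample)
     \<le> (\<integral>\<^sup>+X. W X / ennreal u + k * (\<integral>\<^sup>+\<theta>\<in>S. ennreal (lr \<theta> X) \<partial>\<mu>) * (ennreal u * inverse (W X)) \<partial>sample)"
    by (intro nn_integral_mono min_one_le uv)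
  also have "\<dots> = (\<integral>\<^sup>+X. W X / ennreal u \<partial>sample) + (\<integral>\<^sup>+X. k * (\<integral>\<^sup>+\<theta>\<in>S. ennreal (lr \<theta> X) \<partial>\<mu>) * (ennreal u * inverse (W X)) \<partial>sample)"
    by (rule nn_integral_add) measurable
  also have "(\<integral>\<^sup>+X. W X / ennreal u \<partial>sample) \<le> F / ennreal u"
  proof -
    have "(\<integral>\<^sup>+X. W X \<partial>sample) = (\<integral>\<^sup>+\<theta>. (\<integral>\<^sup>+X. ennreal (root_lr \<theta> X) \<partial>sample) \<partial>\<nu>)"
      unfolding W_def by (rule ps.Fubini') (simp add: split_beta')
    also have "\<dots> \<le> (\<integral>\<^sup>+\<theta>. ennreal (exp (- (real n * sqd (p \<theta>) / (8 * \<Lambda>)))) \<partial>\<nu>)"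
      using good_nu by (intro nn_integral_mono_AE) (auto elim!: eventually_mono intro: root_lr_expectation)
    finally have "(\<integral>\<^sup>+X. W X \<partial>sample) \<le> F" using F by (rule order_trans)
    then show ?thesis by (subst nn_integral_divide) (auto intro: divide_right_mono_ennreal)
  qed
  also have "(\<integral>\<^sup>+X. k * (\<integral>\<^sup>+\<theta>\<in>S. ennreal (lr \<theta> X) \<partial>\<mu>) * (ennreal u * inverse (W X)) \<partial>sample)
    = (\<integral>\<^sup>+X. (\<integral>\<^sup>+\<theta>. k * ennreal u * (indicator S \<theta> * (ennreal (lr \<theta> X) * inverse (W X))) \<partial>\<mu>) \<partial>sample)"
  proof (intro nn_integral_cong)
    fix X assume X: "X \<in> space sample"
    have [measurable]: "(\<lambda>\<theta>. lr \<theta> X) \<in> borel_measurable \<mu>"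
      using measurable_compose[OF measurable_Pair2'[OF X] measurable_param(1)[OF sets(1)]] by simp
    have "(\<integral>\<^sup>+\<theta>. k * ennreal u * (indicator S \<theta> * (ennreal (lr \<theta> X) * inverse (W X))) \<partial>\<mu>)
      = (\<integral>\<^sup>+\<theta>. (k * ennreal u * inverse (W X)) * (ennreal (lr \<theta> X) * indicator S \<theta>) \<partial>\<mu>)"
      by (intro nn_integral_cong) (simp add: mult_ac)
    also have "\<dots> = (k * ennreal u * inverse (W X)) * (\<integral>\<^sup>+\<theta>\<in>S. ennreal (lr \<theta> X) \<partial>\<mu>)"
      by (rule nn_integral_cmult) measurable
    finally show "k * (\<integral>\<^sup>+\<theta>\<in>S. ennreal (lr \<theta> X) \<partial>\<mu>) * (ennreal u * inverse (W X)) =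
      (\<integral>\<^sup>+\<theta>. k * ennreal u * (indicator S \<theta> * (ennreal (lr \<theta> X) * inverse (W X))) \<partial>\<mu>)"
      by (simp add: mult_ac)
  qed
  also have "\<dots> = (\<integral>\<^sup>+\<theta>. (\<integral>\<^sup>+X. k * ennreal u * (indicator S \<theta> * (ennreal (lr \<theta> X) * inverse (W X))) \<partial>sample) \<partial>\<mu>)"
    by (rule pm.Fubini') (simp add: split_beta')
  also have "\<dots> \<le> (\<integral>\<^sup>+\<theta>. k * ennreal (u / v) * (ennreal (exp (real n * (5 * \<Lambda> ^ 3 * \<eta>\<^sup>2 - sqd (p \<theta>) / (32 * \<Lambda>)))) * indicator S \<theta>) \<partial>\<mu>)"
    using ball
  proof (intro nn_integral_mono_AE, elim eventually_mono)
    fix \<theta>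
    let ?e = "ennreal (exp (real n * (5 * \<Lambda> ^ 3 * \<eta>\<^sup>2 - sqd (p \<theta>) / (32 * \<Lambda>))))"
    assume *: "\<theta> \<in> S \<longrightarrow> good (p \<theta>) \<and> (\<exists>b\<in>sets T. ennreal v \<le> emeasure \<nu> b \<and> emeasure \<nu> b < \<infinity> \<and>
        (\<forall>\<theta>'\<in>b. good (p \<theta>') \<and> (\<forall>x\<in>{0..1}. \<bar>p \<theta> x - p \<theta>' x\<bar> \<le> \<eta>)))"
    show "(\<integral>\<^sup>+X. k * ennreal u * (indicator S \<theta> * (ennreal (lr \<theta> X) * inverse (W X))) \<partial>sample)
       \<le> k * ennreal (u / v) * (?e * indicator S \<theta>)"
    proof (cases "\<theta> \<in> S")
      case True
      with * obtain b where b [measurable]: "b \<in> sets T" and vb: "ennreal v \<le> emeasure \<nu> b" "emeasure \<nu> b < \<infinity>"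
        and gb: "\<And>\<theta>'. \<theta>' \<in> b \<Longrightarrow> good (p \<theta>')" and cb: "\<And>\<theta>' x. \<theta>' \<in> b \<Longrightarrow> x \<in> {0..1} \<Longrightarrow> \<bar>p \<theta> x - p \<theta>' x\<bar> \<le> \<eta>"
        and g: "good (p \<theta>)" by blast
      have \<theta>T: "\<theta> \<in> space \<mu>" using True S sets.sets_into_space[OF S] sets_eq_imp_space_eq[OF sets(1)] by auto
      have lrm [measurable]: "(\<lambda>X. lr \<theta> X) \<in> borel_measurable sample"
        using measurable_compose[OF measurable_Pair1'[OF \<theta>T] measurable_param(1)[OF sets(1)]] by simp
      have vb0: "0 < emeasure \<nu> b" using vb(1) uv by (auto intro: less_le_trans[of 0 "ennreal v"])
      \<comment> \<open>The average \<open>W\<close> is decreased to the contribution of the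
        neighbourhood b of \<theta>, then inverted by Cauchy-Schwarz; on b every \<theta>' is close
        enough for \<open>lr_root_lr_expectation\<close>.\<close>
      have "(\<integral>\<^sup>+X. ennreal (lr \<theta> X) * inverse (W X) \<partial>sample)
         \<le> (\<integral>\<^sup>+X. (\<integral>\<^sup>+\<theta>'\<in>b. ennreal (lr \<theta> X) * ennreal (1 / root_lr \<theta>' X) \<partial>\<nu>) / (emeasure \<nu> b)\<^sup>2 \<partial>sample)"
      proof (intro nn_integral_mono)
        fix X assume X: "X \<in> space sample"
        have rm [measurable]: "(\<lambda>\<theta>'. root_lr \<theta>' X) \<in> borel_measurable \<nu>"
          using measurable_compose[OF measurable_Pair2'[OF X] measurable_param(2)[OF sets(2)]] by simp
        have "inverse (W X) \<le> inverse (\<integral>\<^sup>+\<theta>'\<in>b. ennreal (root_lr \<theta>' X) \<partial>\<nu>)"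
          unfolding W_def by (intro inverse_ennreal_antimono nn_integral_mono) (auto simp: indicator_def)
        also have "\<dots> \<le> (\<integral>\<^sup>+\<theta>'\<in>b. ennreal (1 / root_lr \<theta>' X) \<partial>\<nu>) / (emeasure \<nu> b)\<^sup>2"
          using b vb vb0 gb X sets by (intro inverse_nn_integral_le) (auto intro: root_lr_pos)
        finally have "ennreal (lr \<theta> X) * inverse (W X) \<le> ennreal (lr \<theta> X) * ((\<integral>\<^sup>+\<theta>'\<in>b. ennreal (1 / root_lr \<theta>' X) \<partial>\<nu>) / (emeasure \<nu> b)\<^sup>2)"
          by (rule mult_left_mono) simp
        also have "\<dots> = (\<integral>\<^sup>+\<theta>'\<in>b. ennreal (lr \<theta> X) * ennreal (1 / root_lr \<theta>' X) \<partial>\<nu>) / (emeasure \<nu> b)\<^sup>2"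
          using b sets by (simp add: ennreal_times_divide mult.assoc nn_integral_cmult)
        finally show "ennreal (lr \<theta> X) * inverse (W X) \<le> (\<integral>\<^sup>+\<theta>'\<in>b. ennreal (lr \<theta> X) * ennreal (1 / root_lr \<theta>' X) \<partial>\<nu>) / (emeasure \<nu> b)\<^sup>2" .
      qed
      also have "\<dots> = (\<integral>\<^sup>+X. (\<integral>\<^sup>+\<theta>'\<in>b. ennreal (lr \<theta> X) * ennreal (1 / root_lr \<theta>' X) \<partial>\<nu>) \<partial>sample) / (emeasure \<nu> b)\<^sup>2"
        using b sets by (intro nn_integral_divide) measurable
      also have "(\<integral>\<^sup>+X. (\<integral>\<^sup>+\<theta>'\<in>b. ennreal (lr \<theta> X) * ennreal (1 / root_lr \<theta>' X) \<partial>\<nu>) \<partial>sample)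
        = (\<integral>\<^sup>+\<theta>'. (\<integral>\<^sup>+X. ennreal (lr \<theta> X) * ennreal (1 / root_lr \<theta>' X) * indicator b \<theta>' \<partial>sample) \<partial>\<nu>)"
        using b sets by (intro ps.Fubini') (simp add: split_beta')
      also have "\<dots> \<le> (\<integral>\<^sup>+\<theta>'. ?e * indicator b \<theta>' \<partial>\<nu>)"
        using lr_root_lr_expectation[OF g gb cb] by (intro nn_integral_mono) (auto simp: indicator_def)
      also have "\<dots> = ?e * emeasure \<nu> b" using b sets by (intro nn_integral_cmult_indicator) simp
      \<comment> \<open>Cauchy-Schwarz divided by the squared measure of b and the integral over b
        returns one factor, so the volume is paid for only once.\<close>
      also have "?e * emeasure \<nu> b / (emeasure \<nu> b)\<^sup>2 = ?e / emeasure \<nu> b"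
      proof -
        have "emeasure \<nu> b = ennreal (measure \<nu> b)" using vb by (intro emeasure_eq_ennreal_measure) auto
        moreover from this vb0 have "0 < measure \<nu> b" by simp
        ultimately show ?thesis
          by (simp add: ennreal_power divide_ennreal ennreal_mult[symmetric] power2_eq_square)
      qed
      also have "?e / emeasure \<nu> b \<le> ?e / ennreal v" unfolding divide_ennreal_def
        by (intro mult_left_mono inverse_ennreal_antimono vb(1)) simp
      finally have "(\<integral>\<^sup>+X. ennreal (lr \<theta> X) * inverse (W X) \<partial>sample) \<le> ?e / ennreal v"
        by (auto intro: divide_right_mono_ennreal)
      then have "k * ennreal u * (\<integral>\<^sup>+X. ennreal (lr \<theta> X) * inverse (W X) \<partial>sample) \<le> k * ennreal u * (?e / ennreal v)"
        by (rule mult_left_mono) simp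
      also have "\<dots> = k * ennreal (u / v) * ?e"
        using uv by (simp add: divide_ennreal ennreal_mult[symmetric] mult.assoc)
      finally show ?thesis using True by (simp add: nn_integral_cmult)
    qed simp
  qed
  also have "\<dots> = k * ennreal (u / v) * (\<integral>\<^sup>+\<theta>\<in>S. ennreal (exp (real n * (5 * \<Lambda> ^ 3 * \<eta>\<^sup>2 - sqd (p \<theta>) / (32 * \<Lambda>)))) \<partial>\<mu>)"
  proof (rule nn_integral_cmult)
    have "(\<lambda>(\<theta>, x). (p \<theta> x - p0 x)\<^sup>2) \<in> borel_measurable (T \<Otimes>\<^sub>M unit_lebesgue)"
      using p_meas by (auto simp: split_beta')
    then have "(\<lambda>\<theta>. sqd (p \<theta>)) \<in> borel_measurable T"
      unfolding sqd_def by (rule unit_lebesgue.borel_measurable_lebesgue_integral)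
    then have [measurable]: "(\<lambda>\<theta>. sqd (p \<theta>)) \<in> borel_measurable \<mu>"
      using sets by (metis measurable_cong_sets)
    show "(\<lambda>\<theta>. ennreal (exp (real n * (5 * \<Lambda> ^ 3 * \<eta>\<^sup>2 - sqd (p \<theta>) / (32 * \<Lambda>)))) * indicator S \<theta>) \<in> borel_measurable \<mu>"
      by measurable
  qed
  finally show ?thesis by (auto intro: add_mono)
qed

text \<open>Bounding the mean of the reciprocal evidence makes Markov's inequality available for the
  event of small evidence. The reciprocal is handled by restricting to b and applying
  Cauchy-Schwarz, which leaves only the expectations of 1/lr.\<close>

lemma evidence_bound:
  fixes \<mu> :: "'a measure"
  assumes sets: "sets \<mu> = sets T" and sf: "sigma_finite_measure \<mu>"
    and b: "b \<in> sets T" "0 < emeasure \<mu> b" "emeasure \<mu> b < \<infinity>"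
    and gb: "\<And>\<theta>. \<theta> \<in> b \<Longrightarrow> good (p \<theta>) \<and> sqd (p \<theta>) \<le> e"
  shows "(\<integral>\<^sup>+X. inverse (\<integral>\<^sup>+\<theta>. ennreal (lr \<theta> X) \<partial>\<mu>) \<partial>sample) \<le> ennreal (exp (real n * (\<Lambda> * e))) / emeasure \<mu> b"
proof -
  interpret mu: sigma_finite_measure \<mu> by (rule sf)
  interpret smp: sigma_finite_measure sample by (rule sample_sigma_finite)
  interpret pm: pair_sigma_finite \<mu> sample ..
  note [measurable_cong] = sets
  note [measurable] = b(1) measurable_param[OF sets]
  have swap [measurable]: "(\<lambda>z. lr (snd z) (fst z)) \<in> borel_measurable (sample \<Otimes>\<^sub>M \<mu>)"
    using measurable_compose[OF measurable_pair_swap' measurable_param(1)[OF sets]]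
    by (simp_all add: split_beta')
  have "(\<integral>\<^sup>+X. inverse (\<integral>\<^sup>+\<theta>. ennreal (lr \<theta> X) \<partial>\<mu>) \<partial>sample)
     \<le> (\<integral>\<^sup>+X. (\<integral>\<^sup>+\<theta>\<in>b. ennreal (1 / lr \<theta> X) \<partial>\<mu>) / (emeasure \<mu> b)\<^sup>2 \<partial>sample)"
  proof (intro nn_integral_mono)
    fix X assume X: "X \<in> space sample"
    have [measurable]: "(\<lambda>\<theta>. lr \<theta> X) \<in> borel_measurable \<mu>"
      using measurable_compose[OF measurable_Pair2'[OF X] measurable_param(1)[OF sets]] by simp
    have "inverse (\<integral>\<^sup>+\<theta>. ennreal (lr \<theta> X) \<partial>\<mu>) \<le> inverse (\<integral>\<^sup>+\<theta>\<in>b. ennreal (lr \<theta> X) \<partial>\<mu>)"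
      by (intro inverse_ennreal_antimono nn_integral_mono) (auto simp: indicator_def)
    also have "\<dots> \<le> (\<integral>\<^sup>+\<theta>\<in>b. ennreal (1 / lr \<theta> X) \<partial>\<mu>) / (emeasure \<mu> b)\<^sup>2"
      using b gb X sets by (intro inverse_nn_integral_le) (auto intro: lr_pos)
    finally show "inverse (\<integral>\<^sup>+\<theta>. ennreal (lr \<theta> X) \<partial>\<mu>) \<le> (\<integral>\<^sup>+\<theta>\<in>b. ennreal (1 / lr \<theta> X) \<partial>\<mu>) / (emeasure \<mu> b)\<^sup>2" .
  qed
  also have "\<dots> = (\<integral>\<^sup>+X. (\<integral>\<^sup>+\<theta>\<in>b. ennreal (1 / lr \<theta> X) \<partial>\<mu>) \<partial>sample) / (emeasure \<mu> b)\<^sup>2"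
    using b sets by (intro nn_integral_divide) measurable
  also have "(\<integral>\<^sup>+X. (\<integral>\<^sup>+\<theta>\<in>b. ennreal (1 / lr \<theta> X) \<partial>\<mu>) \<partial>sample)
    = (\<integral>\<^sup>+\<theta>. (\<integral>\<^sup>+X. ennreal (1 / lr \<theta> X) * indicator b \<theta> \<partial>sample) \<partial>\<mu>)"
    using b sets by (intro pm.Fubini') (simp add: split_beta')
  also have "\<dots> \<le> (\<integral>\<^sup>+\<theta>. ennreal (exp (real n * (\<Lambda> * e))) * indicator b \<theta> \<partial>\<mu>)"
  proof (intro nn_integral_mono)
    fix \<theta>
    show "(\<integral>\<^sup>+X. ennreal (1 / lr \<theta> X) * indicator b \<theta> \<partial>sample) \<le> ennreal (exp (real n * (\<Lambda> * e))) * indicator b \<theta>"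
    proof (cases "\<theta> \<in> b")
      case True
      then have g: "good (p \<theta>)" and e: "sqd (p \<theta>) \<le> e" using gb by auto
      have "1 / lr \<theta> X = (\<Prod>i<n. p0 (X i) / p \<theta> (X i))" for X
        unfolding lr_def by (simp add: prod_dividef)
      then have "(\<integral>\<^sup>+X. ennreal (1 / lr \<theta> X) \<partial>sample) = (\<integral>\<^sup>+X. (\<Prod>i<n. ennreal (p0 (X i) / p \<theta> (X i))) \<partial>sample)"
        using good_pos[OF g] p0_pos
        by (simp only:) (intro prod_ennreal_sample[where g = "\<lambda>x. p0 x / p \<theta> x"], auto intro!: divide_nonneg_nonneg less_imp_le)
      also have "\<dots> \<le> ennreal (exp (real n * (\<Lambda> * sqd (p \<theta>))))" by (rule inverse_lr_expectation[OF g])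
      also have "\<dots> \<le> ennreal (exp (real n * (\<Lambda> * e)))"
        using e Lam1 by (intro ennreal_leI) (auto intro!: mult_left_mono)
      finally show ?thesis using True by simp
    qed simp
  qed
  also have "\<dots> = ennreal (exp (real n * (\<Lambda> * e))) * emeasure \<mu> b" using b sets by (intro nn_integral_cmult_indicator) simp
  also have "\<dots> / (emeasure \<mu> b)\<^sup>2 = ennreal (exp (real n * (\<Lambda> * e))) / emeasure \<mu> b"
  proof -
    have "emeasure \<mu> b = ennreal (measure \<mu> b)" using b by (intro emeasure_eq_ennreal_measure) auto
    moreover from this b(2) have "0 < measure \<mu> b" by simp
    ultimately show ?thesis
      by (simp add: ennreal_power divide_ennreal ennreal_mult[symmetric] power2_eq_square)
  qed
  finally show ?thesis by (auto intro: divide_right_mono_ennreal)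
qed

end

section \<open>Log spline densities and their priors\<close>

definition cube :: "nat \<Rightarrow> real \<Rightarrow> (nat \<Rightarrow> real) set" where
  "cube J R = {\<theta>. \<forall>j<J. \<bar>\<theta> j\<bar> \<le> R}"

lemma spline_comb_meas:
  "(\<lambda>z. spline_comb q J (fst z) (snd z)) \<in> borel_measurable (PiM {..<J} (\<lambda>_. borel) \<Otimes>\<^sub>M unit_lebesgue)"
  unfolding spline_comb_def
proof (intro borel_measurable_sum borel_measurable_times)
  fix j assume "j \<in> {..<J}"
  then show "(\<lambda>z. fst z j) \<in> borel_measurable (PiM {..<J} (\<lambda>_. borel :: real measure) \<Otimes>\<^sub>M unit_lebesgue)"
    by (intro measurable_compose[OF measurable_fst]) auto
  show "(\<lambda>z. B_spline q J j (snd z)) \<in> borel_measurable (PiM {..<J} (\<lambda>_. borel :: real measure) \<Otimes>\<^sub>M unit_lebesgue)"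
    by (intro measurable_compose[OF measurable_snd] measurable_unit_lebesgueI) auto
qed

lemma spline_comb_borel [measurable]: "spline_comb q J \<theta> \<in> borel_measurable borel"
  unfolding spline_comb_def[abs_def] by measurable

lemma spline_comb_meas_coeff: "(\<lambda>\<theta>. spline_comb q J \<theta> x) \<in> borel_measurable (PiM {..<J} (\<lambda>_. borel))"
  unfolding spline_comb_def by measurable

lemma log_norm_const_meas: "log_norm_const q J \<in> borel_measurable (PiM {..<J} (\<lambda>_. borel))"
proof -
  have "(\<lambda>(\<theta>, x). exp (spline_comb q J \<theta> x)) \<in> borel_measurable (PiM {..<J} (\<lambda>_. borel) \<Otimes>\<^sub>M unit_lebesgue)"
    using measurable_compose[OF spline_comb_meas borel_measurable_exp] by (simp add: split_beta')
  then have "(\<lambda>\<theta>. LINT x|unit_lebesgue. exp (spline_comb q J \<theta> x)) \<in> borel_measurable (PiM {..<J} (\<lambda>_. borel))"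
    by (rule unit_lebesgue.borel_measurable_lebesgue_integral)
  then show ?thesis unfolding log_norm_const_def[abs_def] by measurable
qed

lemma log_spline_meas:
  "(\<lambda>(\<theta>, x). log_spline q J \<theta> x) \<in> borel_measurable (PiM {..<J} (\<lambda>_. borel) \<Otimes>\<^sub>M unit_lebesgue)"
proof -
  have "(\<lambda>z. spline_comb q J (fst z) (snd z) - log_norm_const q J (fst z)) \<in> borel_measurable (PiM {..<J} (\<lambda>_. borel) \<Otimes>\<^sub>M unit_lebesgue)"
    by (rule borel_measurable_diff[OF spline_comb_meas measurable_compose[OF measurable_fst log_norm_const_meas]])
  from measurable_compose[OF this borel_measurable_exp] show ?thesis
    unfolding log_spline_def split_beta' .
qed

lemma log_spline_borel [measurable]: "log_spline q J \<theta> \<in> borel_measurable borel"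
  unfolding log_spline_def[abs_def] by measurable

lemma log_spline_meas_coeff: "(\<lambda>\<theta>. log_spline q J \<theta> x) \<in> borel_measurable (PiM {..<J} (\<lambda>_. borel))"
  using measurable_compose[OF borel_measurable_diff[OF spline_comb_meas_coeff log_norm_const_meas] borel_measurable_exp]
  unfolding log_spline_def .

lemma log_spline_pos: "0 < log_spline q J \<theta> x"
  by (simp add: log_spline_def)

lemma prob_unit_lebesgue: "measure unit_lebesgue {0..1} = 1"
  using unit_lebesgue.prob_space by simp

context spline_basis
begin

lemma spline_bound: "\<theta> \<in> cube J R \<Longrightarrow> x \<in> {0..1} \<Longrightarrow> \<bar>spline_comb q J \<theta> x\<bar> \<le> R"
  by (rule spline_comb_abs_le) (auto simp: cube_def)

lemma in_some_cube: "\<theta> \<in> cube J (\<Sum>j<J. \<bar>\<theta> j\<bar>)"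
  unfolding cube_def by (auto intro: member_le_sum[of _ "{..<J}" "\<lambda>j. \<bar>\<theta> j\<bar>"])

lemma integrable_exp_spline: "integrable unit_lebesgue (\<lambda>x. exp (spline_comb q J \<theta> x))"
proof (rule integrable_unit_bounded)
  show "(\<lambda>x. exp (spline_comb q J \<theta> x)) \<in> borel_measurable unit_lebesgue"
    by (intro measurable_unit_lebesgueI) measurable
  show "\<bar>exp (spline_comb q J \<theta> x)\<bar> \<le> exp (\<Sum>j<J. \<bar>\<theta> j\<bar>)" if "x \<in> {0..1}" for x
    using spline_bound[OF in_some_cube[of \<theta>] that] by (simp add: abs_le_iff)
qed

lemma exp_spline_integral_bounds:
  assumes "\<And>x. x \<in> {0..1} \<Longrightarrow> a \<le> spline_comb q J \<theta> x" "\<And>x. x \<in> {0..1} \<Longrightarrow> spline_comb q J \<theta> x \<le> b"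
  shows "exp a \<le> (LINT x|unit_lebesgue. exp (spline_comb q J \<theta> x))"
    "(LINT x|unit_lebesgue. exp (spline_comb q J \<theta> x)) \<le> exp b"
proof -
  have "(LINT x|unit_lebesgue. exp a) \<le> (LINT x|unit_lebesgue. exp (spline_comb q J \<theta> x))"
    using assms(1) by (intro integral_mono integrable_exp_spline) auto
  then show "exp a \<le> (LINT x|unit_lebesgue. exp (spline_comb q J \<theta> x))" by (simp add: prob_unit_lebesgue)
  have "(LINT x|unit_lebesgue. exp (spline_comb q J \<theta> x)) \<le> (LINT x|unit_lebesgue. exp b)"
    using assms(2) by (intro integral_mono integrable_exp_spline) auto
  then show "(LINT x|unit_lebesgue. exp (spline_comb q J \<theta> x)) \<le> exp b" by (simp add: prob_unit_lebesgue)
qed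

lemma exp_spline_integral_pos: "0 < (LINT x|unit_lebesgue. exp (spline_comb q J \<theta> x))"
proof -
  let ?R = "\<Sum>j<J. \<bar>\<theta> j\<bar>"
  have "- ?R \<le> spline_comb q J \<theta> x" "spline_comb q J \<theta> x \<le> ?R" if "x \<in> {0..1}" for x
    using spline_bound[OF in_some_cube[of \<theta>] that] by (simp_all add: abs_le_iff)
  from exp_spline_integral_bounds(1)[OF this] show ?thesis
    by (rule less_le_trans[OF exp_gt_zero])
qed

lemma log_norm_const_bound:
  assumes "\<theta> \<in> cube J R"
  shows "\<bar>log_norm_const q J \<theta>\<bar> \<le> R"
proof -
  have "- R \<le> spline_comb q J \<theta> x" "spline_comb q J \<theta> x \<le> R" if "x \<in> {0..1}" for x
    using spline_bound[OF assms that] by auto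
  note b = exp_spline_integral_bounds[OF this]
  have "ln (exp (- R)) \<le> log_norm_const q J \<theta>" "log_norm_const q J \<theta> \<le> ln (exp R)"
    unfolding log_norm_const_def using b exp_spline_integral_pos[of \<theta>]
    by (auto simp only: ln_le_cancel_iff exp_gt_zero)
  then show ?thesis by simp
qed

lemma log_spline_integral: "(LINT x|unit_lebesgue. log_spline q J \<theta> x) = 1"
proof -
  have "exp (log_norm_const q J \<theta>) = (LINT x|unit_lebesgue. exp (spline_comb q J \<theta> x))"
    unfolding log_norm_const_def using exp_spline_integral_pos by simp
  then show ?thesis
    unfolding log_spline_def exp_diff using exp_spline_integral_pos[of \<theta>] by simp
qed

lemma log_spline_bounds:
  assumes "\<theta> \<in> cube J R" "x \<in> {0..1}"
  shows "exp (- (2 * R)) \<le> log_spline q J \<theta> x" "log_spline q J \<theta> x \<le> exp (2 * R)"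
  using spline_bound[OF assms] log_norm_const_bound[OF assms(1)] by (auto simp: log_spline_def)

lemma log_spline_densities: "log_spline q J \<theta> \<in> densities"
proof -
  let ?R = "\<Sum>j<J. \<bar>\<theta> j\<bar>"
  have m [measurable]: "log_spline q J \<theta> \<in> borel_measurable unit_lebesgue"
    by (intro measurable_unit_lebesgueI) measurable
  have i: "integrable unit_lebesgue (log_spline q J \<theta>)"
    using log_spline_bounds(2)[OF in_some_cube, of _ \<theta>] log_spline_pos[of q J \<theta>]
    by (intro integrable_unit_bounded[where b = "exp (2 * ?R)"]) (auto simp: abs_of_pos)
  have "integrable unit_lebesgue (\<lambda>x. (log_spline q J \<theta> x)\<^sup>2)"
  proof (rule integrable_unit_bounded)
    show "\<bar>(log_spline q J \<theta> x)\<^sup>2\<bar> \<le> (exp (2 * ?R))\<^sup>2" if "x \<in> {0..1}" for x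
      using log_spline_bounds(2)[OF in_some_cube that] log_spline_pos[of q J \<theta> x] by (simp add: power_mono)
  qed measurable
  moreover have "(\<integral>\<^sup>+x. ennreal (log_spline q J \<theta> x) \<partial>unit_lebesgue) = 1"
    using i log_spline_integral log_spline_pos[of q J \<theta>]
    by (subst nn_integral_eq_integral) (auto intro: less_imp_le)
  ultimately show ?thesis unfolding densities_def using m log_spline_pos[of q J \<theta>] by (auto intro: less_imp_le)
qed

lemma spline_comb_diff: "spline_comb q J \<theta> x - spline_comb q J \<theta>' x = spline_comb q J (\<lambda>j. \<theta> j - \<theta>' j) x"
  unfolding spline_comb_def by (simp add: left_diff_distrib sum_subtractf)

text \<open>A perturbation by at most e changes the integral of the exponential by a factor of at
  most exp e. The function g is general because it is later both a second spline and ln p0 shifted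
  by a constant.\<close>

lemma log_norm_const_perturb:
  assumes "\<And>x. x \<in> {0..1} \<Longrightarrow> \<bar>spline_comb q J \<theta> x - g x\<bar> \<le> e" "g \<in> borel_measurable unit_lebesgue"
  shows "\<bar>log_norm_const q J \<theta> - ln (LINT x|unit_lebesgue. exp (g x))\<bar> \<le> e"
proof -
  let ?I = "LINT x|unit_lebesgue. exp (spline_comb q J \<theta> x)" and ?G = "LINT x|unit_lebesgue. exp (g x)"
  let ?R = "\<Sum>j<J. \<bar>\<theta> j\<bar>"
  have gi: "integrable unit_lebesgue (\<lambda>x. exp (g x))"
  proof (rule integrable_unit_bounded)
    show "\<bar>exp (g x)\<bar> \<le> exp (?R + e)" if "x \<in> {0..1}" for x
      using spline_bound[OF in_some_cube that, of \<theta>] assms(1)[OF that] by simp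
  qed (use assms(2) in measurable)
  have 1: "?I \<le> exp e * ?G"
  proof -
    have "?I \<le> (LINT x|unit_lebesgue. exp e * exp (g x))"
    proof (intro integral_mono integrable_exp_spline)
      fix x assume "x \<in> space unit_lebesgue"
      then have "spline_comb q J \<theta> x \<le> e + g x" using assms(1)[of x] by auto
      then show "exp (spline_comb q J \<theta> x) \<le> exp e * exp (g x)" by (simp flip: exp_add)
    qed (use gi in simp)
    then show ?thesis by simp
  qed
  have 2: "?G \<le> exp e * ?I"
  proof -
    have "?G \<le> (LINT x|unit_lebesgue. exp e * exp (spline_comb q J \<theta> x))"
    proof (intro integral_mono gi)
      fix x assume "x \<in> space unit_lebesgue"
      then have "g x \<le> e + spline_comb q J \<theta> x" using assms(1)[of x] by auto
      then show "exp (g x) \<le> exp e * exp (spline_comb q J \<theta> x)" by (simp flip: exp_add)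
    qed (use integrable_exp_spline in simp)
    then show ?thesis by simp
  qed
  note I = exp_spline_integral_pos[of \<theta>]
  have G: "0 < ?G" using 1 I by (smt (verit) exp_gt_zero zero_less_mult_iff)
  have "ln ?I \<le> ln (exp e * ?G)" "ln ?G \<le> ln (exp e * ?I)" using 1 2 I G mult_pos_pos[OF exp_gt_zero I] mult_pos_pos[OF exp_gt_zero G] by (auto simp only: ln_le_cancel_iff)
  then show ?thesis unfolding log_norm_const_def using I G by (simp add: ln_mult)
qed

lemma ln_log_spline: "ln (log_spline q J \<theta> x) = spline_comb q J \<theta> x - log_norm_const q J \<theta>"
  by (simp add: log_spline_def)

lemma ln_log_spline_perturb:
  assumes "\<And>j. j < J \<Longrightarrow> \<bar>\<theta> j - \<theta>' j\<bar> \<le> \<delta>" "x \<in> {0..1}"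
  shows "\<bar>ln (log_spline q J \<theta> x) - ln (log_spline q J \<theta>' x)\<bar> \<le> 2 * \<delta>"
proof -
  have s: "\<bar>spline_comb q J \<theta> x - spline_comb q J \<theta>' x\<bar> \<le> \<delta>" if "x \<in> {0..1}" for x
    unfolding spline_comb_diff by (rule spline_comb_abs_le[OF that]) (rule assms(1))
  have "\<bar>log_norm_const q J \<theta> - log_norm_const q J \<theta>'\<bar> \<le> \<delta>"
    using log_norm_const_perturb[OF s measurable_unit_lebesgueI[OF spline_comb_borel]]
    unfolding log_norm_const_def[of q J \<theta>'] .
  then show ?thesis using s[OF assms(2)] unfolding ln_log_spline by linarith
qed

lemma log_spline_density_space: "log_spline q J \<in> PiM {..<J} (\<lambda>_. borel) \<rightarrow>\<^sub>M density_space"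
  unfolding density_space_def
proof (rule measurable_measure_of)
  show "{{p \<in> densities. p x \<le> a} | x a. x \<in> {0..1}} \<union> {{p \<in> densities. L2_dist p f \<le> r} | f r. f \<in> densities} \<subseteq> Pow densities"
    by auto
  show "log_spline q J \<in> space (PiM {..<J} (\<lambda>_. borel)) \<rightarrow> densities" using log_spline_densities by auto
  fix A assume "A \<in> {{p \<in> densities. p x \<le> a} | x a. x \<in> {0..1}} \<union> {{p \<in> densities. L2_dist p f \<le> r} | f r. f \<in> densities}"
  then consider x a where "A = {p \<in> densities. p x \<le> a}" | f r where "f \<in> densities" "A = {p \<in> densities. L2_dist p f \<le> r}"
    by blast
  then show "log_spline q J -` A \<inter> space (PiM {..<J} (\<lambda>_. borel)) \<in> sets (PiM {..<J} (\<lambda>_. borel))"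
  proof cases
    case 1
    have "log_spline q J -` A \<inter> space (PiM {..<J} (\<lambda>_. borel)) = {\<theta> \<in> space (PiM {..<J} (\<lambda>_. borel)). log_spline q J \<theta> x \<le> a}"
      using 1 log_spline_densities by auto
    moreover note [measurable] = log_spline_meas_coeff[of q J x]
    ultimately show ?thesis by simp
  next
    case 2
    have [measurable]: "f \<in> borel_measurable unit_lebesgue" using 2 by (simp add: densities_def)
    have "(\<lambda>(\<theta>, x). (log_spline q J \<theta> x - f x)\<^sup>2) \<in> borel_measurable (PiM {..<J} (\<lambda>_. borel) \<Otimes>\<^sub>M unit_lebesgue)"
      using log_spline_meas by (auto simp: split_beta')
    then have "(\<lambda>\<theta>. LINT x|unit_lebesgue. (log_spline q J \<theta> x - f x)\<^sup>2) \<in> borel_measurable (PiM {..<J} (\<lambda>_. borel))"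
      by (rule unit_lebesgue.borel_measurable_lebesgue_integral)
    then have [measurable]: "(\<lambda>\<theta>. L2_dist (log_spline q J \<theta>) f) \<in> borel_measurable (PiM {..<J} (\<lambda>_. borel))"
      unfolding L2_dist_def by measurable
    have "log_spline q J -` A \<inter> space (PiM {..<J} (\<lambda>_. borel)) = {\<theta> \<in> space (PiM {..<J} (\<lambda>_. borel)). L2_dist (log_spline q J \<theta>) f \<le> r}"
      using 2 log_spline_densities by auto
    then show ?thesis by simp
  qed
qed

end

lemma space_density_space: "space density_space = densities"
  unfolding density_space_def by (intro space_measure_of) auto

lemma sets_density_space: "sets density_space = sigma_sets densities
     ({{p \<in> densities. p x \<le> a} | x a. x \<in> {0..1}} \<union> {{p \<in> densities. L2_dist p f \<le> r} | f r. f \<in> densities})"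
  unfolding density_space_def by (intro sets_measure_of) auto

lemma evaluation_meas: "x \<in> {0..1} \<Longrightarrow> (\<lambda>p. p x) \<in> borel_measurable density_space"
  unfolding borel_measurable_iff_le space_density_space sets_density_space
  by (intro allI sigma_sets.Basic) blast

lemma L2_far_sets:
  assumes "f \<in> densities"
  shows "{p \<in> space density_space. L2_dist p f \<ge> r} \<in> sets density_space"
proof -
  have "(\<lambda>p. L2_dist p f) \<in> borel_measurable density_space"
    unfolding borel_measurable_iff_le space_density_space sets_density_space
    using assms by (intro allI sigma_sets.Basic) blast
  then show ?thesis by measurable
qed

section \<open>Mass bounds for the coefficient prior\<close>

locale spline_prior = spline_basis +
  fixes M d D :: real and \<mu> :: "(nat \<Rightarrow> real) measure"
  assumes M_pos: "0 < M" and d_pos: "0 < d" and dD: "d \<le> D"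
    and prior: "coefficient_prior M d D J \<mu>"
begin

lemma prior_prob: "prob_space \<mu>"
  using prior by (simp add: coefficient_prior_def)

lemma prior_density_ex:
  "\<exists>g. g \<in> borel_measurable (PiM {..<J} (\<lambda>_. borel)) \<and>
     \<mu> = density (hyperplane_lebesgue J) (\<lambda>\<theta>. ennreal (g \<theta>)) \<and>
     (\<forall>\<theta>\<in>zero_sum_hyperplane J. if \<theta> \<in> cube J M then d ^ J \<le> g \<theta> \<and> g \<theta> \<le> D ^ J else g \<theta> = 0)"
proof -
  have "(\<forall>j<J. \<theta> j \<in> {-M..M}) \<longleftrightarrow> \<theta> \<in> cube J M" for \<theta>
    by (auto simp: cube_def abs_le_iff)
  then show ?thesis using prior unfolding coefficient_prior_def by (simp only:) blast
qed

lemma sets_mu: "sets \<mu> = sets (PiM {..<J} (\<lambda>_. borel))"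
  using prior_density_ex by force

lemma J1: "1 \<le> J" using q1 qJ by simp

lemma cube_meas [measurable]: "Measurable.pred (PiM {..<J} (\<lambda>_. borel :: real measure)) (\<lambda>\<theta>. \<theta> \<in> cube J R)"
  unfolding cube_def by measurable

lemma AE_prior: "AE \<theta> in \<mu>. \<theta> \<in> zero_sum_hyperplane J \<and> \<theta> \<in> cube J M"
proof -
  obtain dens where dens_meas [measurable]: "dens \<in> borel_measurable (PiM {..<J} (\<lambda>_. borel))"
    and mu_eq: "\<mu> = density (hyperplane_lebesgue J) (\<lambda>\<theta>. ennreal (dens \<theta>))"
    and dens: "\<forall>\<theta>\<in>zero_sum_hyperplane J. if \<theta> \<in> cube J M then d ^ J \<le> dens \<theta> \<and> dens \<theta> \<le> D ^ J else dens \<theta> = 0"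
    using prior_density_ex by blast
  show ?thesis unfolding mu_eq
  proof (subst AE_density)
  show "AE \<theta> in hyperplane_lebesgue J. 0 < ennreal (dens \<theta>) \<longrightarrow> \<theta> \<in> zero_sum_hyperplane J \<and> \<theta> \<in> cube J M"
    using AE_hyperplane[OF J1]
  proof eventually_elim
    case (elim \<theta>)
    then show ?case using bspec[OF dens, of \<theta>] by (cases "\<theta> \<in> cube J M") auto
  qed
  qed measurable
qed

lemma prior_integral_le:
  assumes [measurable]: "f \<in> borel_measurable (PiM {..<J} (\<lambda>_. borel))"
  shows "(\<integral>\<^sup>+\<theta>. f \<theta> \<partial>\<mu>) \<le> ennreal (D ^ J) * (\<integral>\<^sup>+\<theta>. indicator (cube J M) \<theta> * f \<theta> \<partial>hyperplane_lebesgue J)"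
proof -
  obtain dens where dens_meas [measurable]: "dens \<in> borel_measurable (PiM {..<J} (\<lambda>_. borel))"
    and mu_eq: "\<mu> = density (hyperplane_lebesgue J) (\<lambda>\<theta>. ennreal (dens \<theta>))"
    and dens: "\<forall>\<theta>\<in>zero_sum_hyperplane J. if \<theta> \<in> cube J M then d ^ J \<le> dens \<theta> \<and> dens \<theta> \<le> D ^ J else dens \<theta> = 0"
    using prior_density_ex by blast
  have "(\<integral>\<^sup>+\<theta>. f \<theta> \<partial>\<mu>) = (\<integral>\<^sup>+\<theta>. ennreal (dens \<theta>) * f \<theta> \<partial>hyperplane_lebesgue J)"
    unfolding mu_eq by (rule nn_integral_density) measurable
  also have "\<dots> \<le> (\<integral>\<^sup>+\<theta>. ennreal (D ^ J) * (indicator (cube J M) \<theta> * f \<theta>) \<partial>hyperplane_lebesgue J)"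
    using AE_hyperplane[OF J1]
  proof (intro nn_integral_mono_AE, eventually_elim)
    fix \<theta> assume z: "\<theta> \<in> zero_sum_hyperplane J"
    show "ennreal (dens \<theta>) * f \<theta> \<le> ennreal (D ^ J) * (indicator (cube J M) \<theta> * f \<theta>)"
      using bspec[OF dens z] by (cases "\<theta> \<in> cube J M") (auto intro!: mult_right_mono ennreal_leI)
  qed
  also have "\<dots> = ennreal (D ^ J) * (\<integral>\<^sup>+\<theta>. indicator (cube J M) \<theta> * f \<theta> \<partial>hyperplane_lebesgue J)"
    by (rule nn_integral_cmult) measurable
  finally show ?thesis .
qed

definition coeff_ball :: "(nat \<Rightarrow> real) \<Rightarrow> real \<Rightarrow> (nat \<Rightarrow> real) set" where
  "coeff_ball \<theta>0 \<delta> = {\<theta> \<in> space (PiM {..<J} (\<lambda>_. borel)). \<forall>j<J. \<bar>\<theta> j - \<theta>0 j\<bar> \<le> \<delta>}"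

lemma coeff_ball_sets [measurable]: "coeff_ball \<theta>0 \<delta> \<in> sets (PiM {..<J} (\<lambda>_. borel))"
  unfolding coeff_ball_def by measurable

lemma coeff_ball_cube:
  assumes "\<theta>0 \<in> cube J R" "R + \<delta> \<le> R'"
  shows "coeff_ball \<theta>0 \<delta> \<subseteq> cube J R'"
proof
  fix \<theta> assume "\<theta> \<in> coeff_ball \<theta>0 \<delta>"
  then have "\<bar>\<theta> j - \<theta>0 j\<bar> \<le> \<delta>" "\<bar>\<theta>0 j\<bar> \<le> R" if "j < J" for j
    using assms(1) that by (auto simp: coeff_ball_def cube_def)
  then show "\<theta> \<in> cube J R'" using assms(2) unfolding cube_def by fastforce
qed

text \<open>The margin \<delta> in the condition on the centre keeps the ball inside the block where
  the density is at least d^J.\<close>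

lemma prior_ball_lower:
  assumes "0 < \<delta>" "\<theta>0 \<in> zero_sum_hyperplane J" "\<theta>0 \<in> cube J (M - \<delta>)"
  shows "ennreal (d ^ J * \<delta> ^ (J - 1)) \<le> emeasure \<mu> (coeff_ball \<theta>0 \<delta>)"
proof -
  obtain dens where dens_meas [measurable]: "dens \<in> borel_measurable (PiM {..<J} (\<lambda>_. borel))"
    and mu_eq: "\<mu> = density (hyperplane_lebesgue J) (\<lambda>\<theta>. ennreal (dens \<theta>))"
    and dens: "\<forall>\<theta>\<in>zero_sum_hyperplane J. if \<theta> \<in> cube J M then d ^ J \<le> dens \<theta> \<and> dens \<theta> \<le> D ^ J else dens \<theta> = 0"
    using prior_density_ex by blast
  let ?b = "coeff_ball \<theta>0 \<delta>"
  have sub: "?b \<subseteq> cube J M" using assms by (intro coeff_ball_cube) auto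
  have "ennreal (d ^ J * \<delta> ^ (J - 1)) = ennreal (d ^ J) * ennreal (\<delta> ^ (J - 1))"
    using d_pos assms(1) by (simp add: ennreal_mult)
  also have "\<dots> \<le> ennreal (d ^ J) * emeasure (hyperplane_lebesgue J) ?b"
    using hyperplane_ball_lower[OF J1 assms(1,2)] unfolding coeff_ball_def by (intro mult_left_mono) auto
  also have "\<dots> = (\<integral>\<^sup>+\<theta>. ennreal (d ^ J) * indicator ?b \<theta> \<partial>hyperplane_lebesgue J)"
    by (intro nn_integral_cmult_indicator[symmetric]) simp
  also have "\<dots> \<le> (\<integral>\<^sup>+\<theta>. ennreal (dens \<theta>) * indicator ?b \<theta> \<partial>hyperplane_lebesgue J)"
    using AE_hyperplane[OF J1]
  proof (intro nn_integral_mono_AE, eventually_elim)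
    fix \<theta> assume z: "\<theta> \<in> zero_sum_hyperplane J"
    show "ennreal (d ^ J) * indicator ?b \<theta> \<le> ennreal (dens \<theta>) * indicator ?b \<theta>"
      using bspec[OF dens z] sub by (cases "\<theta> \<in> ?b") (auto intro!: ennreal_leI)
  qed
  also have "\<dots> = emeasure \<mu> ?b"
    unfolding mu_eq by (subst emeasure_density) auto
  finally show ?thesis .
qed

end

section \<open>Nonasymptotic bounds for a single model\<close>

lemma ln_diff_bound:
  assumes "0 < L" "1 / L \<le> a" "1 / L \<le> (b::real)"
  shows "\<bar>ln a - ln b\<bar> \<le> L * \<bar>a - b\<bar>"
proof -
  have 1: "ln x - ln y \<le> L * \<bar>x - y\<bar>" if "1 / L \<le> x" "1 / L \<le> (y::real)" for x y
  proof -
    have y: "0 < y" "0 < x" using that assms(1) divide_pos_pos[of 1 L] by linarith+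
    have "ln x - ln y \<le> (x - y) / y" using y ln_diff_le by blast
    also have "\<dots> \<le> \<bar>x - y\<bar> / y" using y by (intro divide_right_mono) auto
    also have "\<dots> \<le> \<bar>x - y\<bar> / (1 / L)" using y that assms(1) by (intro divide_left_mono) auto
    finally show ?thesis by (simp add: mult.commute)
  qed
  show ?thesis using 1[OF assms(2,3)] 1[OF assms(3,2)] by (simp add: abs_le_iff abs_minus_commute)
qed

lemma diff_ln_bound:
  assumes "0 < a" "0 < b" "a \<le> L" "b \<le> (L::real)"
  shows "\<bar>a - b\<bar> \<le> L * \<bar>ln a - ln b\<bar>"
proof -
  have 1: "x - y \<le> L * \<bar>ln x - ln y\<bar>" if "0 < x" "0 < y" "x \<le> (L::real)" for x y
  proof -
    have "ln y - ln x \<le> (y - x) / x" using that ln_diff_le by blast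
    then have "x * (ln y - ln x) \<le> y - x" using that by (simp add: field_simps)
    then have "x - y \<le> x * (ln x - ln y)" by (simp add: algebra_simps)
    also have "\<dots> \<le> x * \<bar>ln x - ln y\<bar>" using that by (intro mult_left_mono) auto
    also have "\<dots> \<le> L * \<bar>ln x - ln y\<bar>" using that by (intro mult_right_mono) auto
    finally show ?thesis .
  qed
  show ?thesis using 1[OF assms(1,2,3)] 1[OF assms(2,1,4)] by (simp add: abs_le_iff abs_minus_commute)
qed

text \<open>The bound is required for the cube of size M + 1, not M, so that neighbours of a
  coefficient vector in the support of the prior still give densities between 1/\<Lambda> and
  \<Lambda>.\<close>

locale log_spline_experiment = spline_prior q J M d D \<mu> + sampling P0 p0 n \<Lambda>
  for q J M d D \<mu> P0 p0 n \<Lambda> +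
  assumes Lam: "exp (2 * (M + 1)) \<le> \<Lambda>"

sublocale log_spline_experiment \<subseteq> sampling_model P0 p0 n \<Lambda> "PiM {..<J} (\<lambda>_. borel)" "log_spline q J"
  by unfold_locales (rule log_spline_meas)

context log_spline_experiment
begin

lemma L0: "0 < \<Lambda>" using Lam1 by simp

lemma good_cube:
  assumes "\<theta> \<in> cube J (M + 1)"
  shows "good (log_spline q J \<theta>)"
proof -
  have "1 / \<Lambda> \<le> 1 / exp (2 * (M + 1))" using Lam by (intro divide_left_mono) (auto simp: L0)
  also have "\<dots> = exp (- (2 * (M + 1)))" by (simp only: exp_minus inverse_eq_divide)
  finally have L: "1 / \<Lambda> \<le> exp (- (2 * (M + 1)))" .
  have "log_spline q J \<theta> \<in> borel_measurable unit_lebesgue" by (intro measurable_unit_lebesgueI) measurable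
  moreover have "1 / \<Lambda> \<le> log_spline q J \<theta> x \<and> log_spline q J \<theta> x \<le> \<Lambda>" if "x \<in> {0..1}" for x
    using log_spline_bounds[OF assms that] L Lam by linarith
  ultimately show ?thesis unfolding good_def log_spline_integral by blast
qed

lemma cube_M_subset: "cube J M \<subseteq> cube J (M + 1)"
  unfolding cube_def by fastforce

lemma ln_p0_bound: "x \<in> {0..1} \<Longrightarrow> \<bar>ln (p0 x)\<bar> \<le> ln \<Lambda>"
  using p0_bounds[of x] p0_pos[of x] L0 ln_le_cancel_iff[of "p0 x" \<Lambda>] ln_le_cancel_iff[of "1 / \<Lambda>" "p0 x"]
  by (auto simp: abs_le_iff ln_div)

text \<open>The logarithm is \<Lambda>-Lipschitz on the common range, so the L2 distance of the
  logarithms is at most \<Lambda> times that of the densities; cell averages then reduce it to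
  finitely many linear functionals of \<theta>.\<close>

lemma sqd_lower:
  assumes \<theta>: "\<theta> \<in> cube J (M + 1)"
  shows "(\<Sum>l<K - 2. (avg_diff l (spline_comb q J \<theta>) - avg_diff l (\<lambda>x. ln (p0 x)))\<^sup>2) \<le> 4 * real K * \<Lambda>\<^sup>2 * sqd (log_spline q J \<theta>)"
proof -
  let ?s = "spline_comb q J \<theta>" and ?c = "log_norm_const q J \<theta>" and ?p = "log_spline q J \<theta>"
  let ?f = "\<lambda>x. ?s x - ln (p0 x) - ?c"
  note g = good_cube[OF \<theta>]
  have [measurable]: "?s \<in> borel_measurable unit_lebesgue" by (intro measurable_unit_lebesgueI) measurable
  have si: "integrable unit_lebesgue ?s"
    using spline_bound[OF \<theta>] by (intro integrable_unit_bounded[where b = "M + 1"]) auto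
  have li: "integrable unit_lebesgue (\<lambda>x. ln (p0 x))"
    using ln_p0_bound by (intro integrable_unit_bounded[where b = "ln \<Lambda>"]) auto
  have fb: "\<bar>?f x\<bar> \<le> \<Lambda> * \<bar>?p x - p0 x\<bar>" if "x \<in> {0..1}" for x
  proof -
    have "?f x = ln (?p x) - ln (p0 x)" by (simp add: ln_log_spline)
    then show ?thesis using ln_diff_bound[OF L0, of "?p x" "p0 x"] g p0_bounds[OF that] that by (simp add: good_def)
  qed
  have fsq: "(?f x)\<^sup>2 \<le> \<Lambda>\<^sup>2 * (?p x - p0 x)\<^sup>2" if "x \<in> {0..1}" for x
    using power_mono[OF fb[OF that], of 2] by (simp add: power_mult_distrib)
  have fi2: "integrable unit_lebesgue (\<lambda>x. (?f x)\<^sup>2)"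
  proof (rule Bochner_Integration.integrable_bound)
    show "integrable unit_lebesgue (\<lambda>x. \<Lambda>\<^sup>2 * (?p x - p0 x)\<^sup>2)"
      using good_sq_integrable[OF g good_p0] by simp
    show "AE x in unit_lebesgue. norm ((?f x)\<^sup>2) \<le> norm (\<Lambda>\<^sup>2 * (?p x - p0 x)\<^sup>2)"
      using fsq by (intro AE_I2) auto
  qed measurable
  have "avg_diff l ?f = avg_diff l ?s - avg_diff l (\<lambda>x. ln (p0 x))" if "l < K - 2" for l
    using that si li unfolding avg_diff_def by (simp add: avg_fun_diff avg_const)
  then have "(\<Sum>l<K - 2. (avg_diff l ?s - avg_diff l (\<lambda>x. ln (p0 x)))\<^sup>2) = (\<Sum>l<K - 2. (avg_diff l ?f)\<^sup>2)"
    by (intro sum.cong) auto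
  also have "\<dots> \<le> 4 * real K * (LINT x|unit_lebesgue. (?f x)\<^sup>2)"
    using si li fi2 by (intro sum_avg_diff_square_le) auto
  also have "\<dots> \<le> 4 * real K * (LINT x|unit_lebesgue. \<Lambda>\<^sup>2 * (?p x - p0 x)\<^sup>2)"
    using fsq fi2 good_sq_integrable[OF g good_p0] by (intro mult_left_mono integral_mono) auto
  finally show ?thesis by (simp add: sqd_def mult.assoc)
qed

definition vol :: "real \<Rightarrow> real" where
  "vol A = sqrt (real J) * ((2 * (M + 1)) ^ q * (sqrt (pi / A) / ((1 / 2) ^ q / fact (q - 1))) ^ (K - 2))"

lemma sqd_meas [measurable]: "(\<lambda>\<theta>. sqd (log_spline q J \<theta>)) \<in> borel_measurable (PiM {..<J} (\<lambda>_. borel))"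
proof -
  have "(\<lambda>(\<theta>, x). (log_spline q J \<theta> x - p0 x)\<^sup>2) \<in> borel_measurable (PiM {..<J} (\<lambda>_. borel) \<Otimes>\<^sub>M unit_lebesgue)"
    using p_meas by (auto simp: split_beta')
  then show ?thesis
    unfolding sqd_def by (rule unit_lebesgue.borel_measurable_lebesgue_integral)
qed

lemma sqd_nonneg: "0 \<le> sqd f"
  unfolding sqd_def by (intro Bochner_Integration.integral_nonneg) auto

lemma exp_sqd_integral:
  assumes "2 \<le> K" "0 < A"
  shows "(\<integral>\<^sup>+\<theta>. indicator (cube J (M + 1)) \<theta> * ennreal (exp (- A * sqd (log_spline q J \<theta>))) \<partial>hyperplane_lebesgue J)
    \<le> ennreal (vol (A / (4 * real K * \<Lambda>\<^sup>2)))"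
proof -
  let ?A = "A / (4 * real K * \<Lambda>\<^sup>2)"
  have pos: "0 < 4 * real K * \<Lambda>\<^sup>2" using Kpos L0 by simp
  then have A: "0 < ?A" using assms(2) by simp
  have "(\<integral>\<^sup>+\<theta>. indicator (cube J (M + 1)) \<theta> * ennreal (exp (- A * sqd (log_spline q J \<theta>))) \<partial>hyperplane_lebesgue J)
    \<le> (\<integral>\<^sup>+\<theta>. indicator {\<theta>. \<forall>j<J. \<bar>\<theta> j\<bar> \<le> M + 1} \<theta> *
        ennreal (exp (- ?A * (\<Sum>l<K - 2. (avg_diff l (spline_comb q J \<theta>) - avg_diff l (\<lambda>x. ln (p0 x)))\<^sup>2))) \<partial>hyperplane_lebesgue J)"
  proof (intro nn_integral_mono)
    fix \<theta>
    let ?S = "\<Sum>l<K - 2. (avg_diff l (spline_comb q J \<theta>) - avg_diff l (\<lambda>x. ln (p0 x)))\<^sup>2"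
    show "indicator (cube J (M + 1)) \<theta> * ennreal (exp (- A * sqd (log_spline q J \<theta>)))
      \<le> indicator {\<theta>. \<forall>j<J. \<bar>\<theta> j\<bar> \<le> M + 1} \<theta> * ennreal (exp (- ?A * ?S))"
    proof (cases "\<theta> \<in> cube J (M + 1)")
      case True
      have "?A * ?S \<le> ?A * (4 * real K * \<Lambda>\<^sup>2 * sqd (log_spline q J \<theta>))"
        using sqd_lower[OF True] A by (intro mult_left_mono) auto
      also have "\<dots> = A * sqd (log_spline q J \<theta>)"
      proof -
        have "A / c * (c * y) = A * y" if "0 < c" for c y :: real using that by simp
        from this[OF pos] show ?thesis .
      qed
      finally show ?thesis using True by (auto simp: cube_def intro!: ennreal_leI)
    qed simp
  qed
  also have "\<dots> \<le> ennreal (vol ?A)"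
    unfolding vol_def using assms(1) A M_pos by (intro gaussian_volume) auto
  finally show ?thesis .
qed

lemma log_spline_close:
  assumes "\<theta> \<in> cube J (M + 1)" "\<theta>' \<in> cube J (M + 1)" "\<And>j. j < J \<Longrightarrow> \<bar>\<theta> j - \<theta>' j\<bar> \<le> \<delta>" "x \<in> {0..1}"
  shows "\<bar>log_spline q J \<theta> x - log_spline q J \<theta>' x\<bar> \<le> 2 * \<Lambda> * \<delta>"
proof -
  have "\<bar>log_spline q J \<theta> x - log_spline q J \<theta>' x\<bar> \<le> \<Lambda> * \<bar>ln (log_spline q J \<theta> x) - ln (log_spline q J \<theta>' x)\<bar>"
    using good_cube[OF assms(1)] good_cube[OF assms(2)] assms(4) log_spline_pos
    by (intro diff_ln_bound) (auto simp: good_def)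
  also have "\<dots> \<le> \<Lambda> * (2 * \<delta>)" using ln_log_spline_perturb[OF assms(3,4)] L0 by (intro mult_left_mono) auto
  finally show ?thesis by simp
qed

lemma prior_sigma_finite: "sigma_finite_measure \<mu>"
proof -
  interpret prob_space \<mu> by (rule prior_prob)
  show ?thesis by unfold_locales
qed

text \<open>The averaging measure of the test. It is not the prior: for \<theta> near the boundary
  of the block the prior cuts cubes off, whereas on the larger cube every \<delta>-ball around a
  prior coefficient vector keeps its full volume.\<close>

definition nu :: "(nat \<Rightarrow> real) measure" where
  "nu = density (hyperplane_lebesgue J) (indicator (cube J (M + 1)))"

text \<open>\<open>bayes_test\<close> leaves the exponent -n sqd / (32 \<Lambda>). Half of it
  becomes the factor exp (-n r / (64 \<Lambda>)) on the far set, and the other half stays under the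
  integral to produce the Gaussian volume. The 20 is 5 \<Lambda>^3 (2 \<Lambda> \<delta>)^2 = 20
  \<Lambda>^5 \<delta>^2.\<close>

lemma far_bound:
  assumes K: "2 \<le> K" and n: "1 \<le> n" and \<delta>: "0 < \<delta>" "\<delta> \<le> 1" and u: "0 < u"
  shows "(\<integral>\<^sup>+X. min 1 (k * (\<integral>\<^sup>+\<theta>\<in>{\<theta> \<in> space (PiM {..<J} (\<lambda>_. borel)). r \<le> sqd (log_spline q J \<theta>)}. ennreal (lr \<theta> X) \<partial>\<mu>)) \<partial>sample)
    \<le> ennreal (vol (real n / (32 * real K * \<Lambda> ^ 3))) / ennreal u +
      k * ennreal (u / \<delta> ^ (J - 1)) * ennreal (exp (20 * real n * \<Lambda> ^ 5 * \<delta>\<^sup>2 - real n * r / (64 * \<Lambda>)) * (D ^ J * vol (real n / (256 * real K * \<Lambda> ^ 3))))"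
proof -
  let ?T = "PiM {..<J} (\<lambda>_. borel) :: (nat \<Rightarrow> real) measure"
  let ?S = "{\<theta> \<in> space ?T. r \<le> sqd (log_spline q J \<theta>)}"
  have pn: "0 < real n" using n by simp
  have S: "?S \<in> sets ?T" by measurable
  have sets_nu: "sets nu = sets ?T" unfolding nu_def by simp
  have vol1: "(\<integral>\<^sup>+\<theta>. ennreal (exp (- (real n * sqd (log_spline q J \<theta>) / (8 * \<Lambda>)))) \<partial>nu) \<le> ennreal (vol (real n / (32 * real K * \<Lambda> ^ 3)))"
  proof -
    have "(\<integral>\<^sup>+\<theta>. ennreal (exp (- (real n * sqd (log_spline q J \<theta>) / (8 * \<Lambda>)))) \<partial>nu)
      = (\<integral>\<^sup>+\<theta>. indicator (cube J (M + 1)) \<theta> * ennreal (exp (- (real n / (8 * \<Lambda>)) * sqd (log_spline q J \<theta>))) \<partial>hyperplane_lebesgue J)"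
      unfolding nu_def by (subst nn_integral_density) (auto simp: cong: nn_integral_cong)
    also have "\<dots> \<le> ennreal (vol (real n / (8 * \<Lambda>) / (4 * real K * \<Lambda>\<^sup>2)))"
      using pn L0 by (intro exp_sqd_integral K) simp
    also have "real n / (8 * \<Lambda>) / (4 * real K * \<Lambda>\<^sup>2) = real n / (32 * real K * \<Lambda> ^ 3)"
      by (simp add: power2_eq_square power3_eq_cube mult_ac)
    finally show ?thesis .
  qed
  have emb: "emeasure nu b = emeasure (hyperplane_lebesgue J) b" if "b \<in> sets ?T" "b \<subseteq> cube J (M + 1)" for b
  proof -
    have "emeasure nu b = (\<integral>\<^sup>+\<theta>. indicator (cube J (M + 1)) \<theta> * indicator b \<theta> \<partial>hyperplane_lebesgue J)"
      unfolding nu_def using that by (subst emeasure_density) auto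
    also have "\<dots> = (\<integral>\<^sup>+\<theta>. indicator b \<theta> \<partial>hyperplane_lebesgue J)"
      using that(2) by (intro nn_integral_cong) (auto simp: indicator_def)
    finally show ?thesis using that by simp
  qed
  \<comment> \<open>Finiteness of the volume of the enlarged cube is read off from the Gaussian
    bound, since the Gaussian factor is bounded below when sqd \<le> \<Lambda>^2.\<close>
  have fin: "emeasure nu b < \<infinity>" for b
  proof -
    have "emeasure nu (space nu) = (\<integral>\<^sup>+\<theta>. indicator (cube J (M + 1)) \<theta> * 1 \<partial>hyperplane_lebesgue J)"
      unfolding nu_def by (subst emeasure_density) (auto intro!: nn_integral_cong)
    also have "\<dots> \<le> (\<integral>\<^sup>+\<theta>. ennreal (exp (real n * \<Lambda>\<^sup>2)) * (indicator (cube J (M + 1)) \<theta> * ennreal (exp (- (real n) * sqd (log_spline q J \<theta>)))) \<partial>hyperplane_lebesgue J)"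
    proof (intro nn_integral_mono)
      fix \<theta>
      show "indicator (cube J (M + 1)) \<theta> * 1 \<le> ennreal (exp (real n * \<Lambda>\<^sup>2)) * (indicator (cube J (M + 1)) \<theta> * ennreal (exp (- (real n) * sqd (log_spline q J \<theta>))))"
      proof (cases "\<theta> \<in> cube J (M + 1)")
        case True
        have "sqd (log_spline q J \<theta>) \<le> (LINT x|unit_lebesgue. \<Lambda>\<^sup>2)"
          unfolding sqd_def
        proof (intro integral_mono good_sq_integrable good_cube[OF True] good_p0)
          fix x assume "x \<in> space unit_lebesgue"
          then show "(log_spline q J \<theta> x - p0 x)\<^sup>2 \<le> \<Lambda>\<^sup>2"
            using power_mono[OF good_diff_bound[OF good_cube[OF True] good_p0, of x], of 2] by simp
        qed simp
        then have "sqd (log_spline q J \<theta>) \<le> \<Lambda>\<^sup>2" by (simp add: prob_unit_lebesgue)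
        then have "real n * sqd (log_spline q J \<theta>) \<le> real n * \<Lambda>\<^sup>2" by (intro mult_left_mono) auto
        then have "1 \<le> exp (real n * \<Lambda>\<^sup>2) * exp (- (real n) * sqd (log_spline q J \<theta>))" by (simp flip: exp_add)
        then have "ennreal 1 \<le> ennreal (exp (real n * \<Lambda>\<^sup>2)) * ennreal (exp (- (real n) * sqd (log_spline q J \<theta>)))"
          by (subst ennreal_mult[symmetric]) (auto intro: ennreal_leI)
        then show ?thesis using True by simp
      qed simp
    qed
    also have "\<dots> = ennreal (exp (real n * \<Lambda>\<^sup>2)) * (\<integral>\<^sup>+\<theta>. indicator (cube J (M + 1)) \<theta> * ennreal (exp (- (real n) * sqd (log_spline q J \<theta>))) \<partial>hyperplane_lebesgue J)"
      by (rule nn_integral_cmult) measurable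
    also have "\<dots> \<le> ennreal (exp (real n * \<Lambda>\<^sup>2)) * ennreal (vol (real n / (4 * real K * \<Lambda>\<^sup>2)))"
      using pn by (intro mult_left_mono exp_sqd_integral K) auto
    also have "\<dots> < \<infinity>" by (simp add: ennreal_mult_less_top)
    finally have "emeasure nu (space nu) < \<infinity>" .
    then show ?thesis by (rule le_less_trans[OF emeasure_space])
  qed
  have sf: "sigma_finite_measure nu"
  proof -
    interpret finite_measure nu using fin[of "space nu"] by (intro finite_measureI) auto
    show ?thesis by unfold_locales
  qed
  have good_nu: "AE \<theta> in nu. good (log_spline q J \<theta>)"
    unfolding nu_def by (subst AE_density) (auto simp: indicator_def intro!: AE_I2 good_cube)
  have ball: "AE \<theta> in \<mu>. \<theta> \<in> ?S \<longrightarrow> good (log_spline q J \<theta>) \<and>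
     (\<exists>b\<in>sets ?T. ennreal (\<delta> ^ (J - 1)) \<le> emeasure nu b \<and> emeasure nu b < \<infinity> \<and>
        (\<forall>\<theta>'\<in>b. good (log_spline q J \<theta>') \<and> (\<forall>x\<in>{0..1}. \<bar>log_spline q J \<theta> x - log_spline q J \<theta>' x\<bar> \<le> 2 * \<Lambda> * \<delta>)))"
    using AE_prior
  proof (elim eventually_mono, intro impI)
    fix \<theta> assume *: "\<theta> \<in> zero_sum_hyperplane J \<and> \<theta> \<in> cube J M"
    then have \<theta>: "\<theta> \<in> cube J (M + 1)" using cube_M_subset by auto
    have sub: "coeff_ball \<theta> \<delta> \<subseteq> cube J (M + 1)" using * \<delta> by (intro coeff_ball_cube[of \<theta> M]) auto
    show "good (log_spline q J \<theta>) \<and>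
     (\<exists>b\<in>sets ?T. ennreal (\<delta> ^ (J - 1)) \<le> emeasure nu b \<and> emeasure nu b < \<infinity> \<and>
        (\<forall>\<theta>'\<in>b. good (log_spline q J \<theta>') \<and> (\<forall>x\<in>{0..1}. \<bar>log_spline q J \<theta> x - log_spline q J \<theta>' x\<bar> \<le> 2 * \<Lambda> * \<delta>)))"
    proof (intro conjI bexI[of _ "coeff_ball \<theta> \<delta>"] ballI)
      show "good (log_spline q J \<theta>)" by (rule good_cube[OF \<theta>])
      show "ennreal (\<delta> ^ (J - 1)) \<le> emeasure nu (coeff_ball \<theta> \<delta>)"
        using hyperplane_ball_lower[OF J1 \<delta>(1)] * emb[OF coeff_ball_sets sub] unfolding coeff_ball_def by simp
      show "good (log_spline q J \<theta>')" if "\<theta>' \<in> coeff_ball \<theta> \<delta>" for \<theta>' using sub that good_cube by auto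
      show "\<bar>log_spline q J \<theta> x - log_spline q J \<theta>' x\<bar> \<le> 2 * \<Lambda> * \<delta>" if "\<theta>' \<in> coeff_ball \<theta> \<delta>" "x \<in> {0..1}" for \<theta>' x
        using that sub by (intro log_spline_close \<theta>) (auto simp: coeff_ball_def abs_minus_commute)
    qed (use fin in auto)
  qed
  have s1: "(\<integral>\<^sup>+X. min 1 (k * (\<integral>\<^sup>+\<theta>\<in>?S. ennreal (lr \<theta> X) \<partial>\<mu>)) \<partial>sample)
    \<le> ennreal (vol (real n / (32 * real K * \<Lambda> ^ 3))) / ennreal u +
     k * ennreal (u / \<delta> ^ (J - 1)) * (\<integral>\<^sup>+\<theta>\<in>?S. ennreal (exp (real n * (5 * \<Lambda> ^ 3 * (2 * \<Lambda> * \<delta>)\<^sup>2 - sqd (log_spline q J \<theta>) / (32 * \<Lambda>)))) \<partial>\<mu>)"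
    using \<delta> by (intro bayes_test[OF sets_mu sets_nu prior_sigma_finite sf S good_nu u _ ball vol1]) auto
  have s2: "(\<integral>\<^sup>+\<theta>\<in>?S. ennreal (exp (real n * (5 * \<Lambda> ^ 3 * (2 * \<Lambda> * \<delta>)\<^sup>2 - sqd (log_spline q J \<theta>) / (32 * \<Lambda>)))) \<partial>\<mu>)
    \<le> ennreal (exp (20 * real n * \<Lambda> ^ 5 * \<delta>\<^sup>2 - real n * r / (64 * \<Lambda>)) * (D ^ J * vol (real n / (256 * real K * \<Lambda> ^ 3))))"
  proof -
    let ?E = "exp (20 * real n * \<Lambda> ^ 5 * \<delta>\<^sup>2 - real n * r / (64 * \<Lambda>))"
    have "(\<integral>\<^sup>+\<theta>\<in>?S. ennreal (exp (real n * (5 * \<Lambda> ^ 3 * (2 * \<Lambda> * \<delta>)\<^sup>2 - sqd (log_spline q J \<theta>) / (32 * \<Lambda>)))) \<partial>\<mu>)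
      \<le> (\<integral>\<^sup>+\<theta>. ennreal ?E * ennreal (exp (- (real n / (64 * \<Lambda>)) * sqd (log_spline q J \<theta>))) \<partial>\<mu>)"
    proof (intro nn_integral_mono)
      fix \<theta>
      show "ennreal (exp (real n * (5 * \<Lambda> ^ 3 * (2 * \<Lambda> * \<delta>)\<^sup>2 - sqd (log_spline q J \<theta>) / (32 * \<Lambda>)))) * indicator ?S \<theta>
        \<le> ennreal ?E * ennreal (exp (- (real n / (64 * \<Lambda>)) * sqd (log_spline q J \<theta>)))"
      proof (cases "\<theta> \<in> ?S")
        case True
        define y where "y = sqd (log_spline q J \<theta>)"
        have "r \<le> y" using True by (simp add: y_def)
        then have "real n * r / (64 * \<Lambda>) \<le> real n * y / (64 * \<Lambda>)" using pn L0 by (intro divide_right_mono mult_left_mono) auto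
        moreover have "real n * (5 * \<Lambda> ^ 3 * (2 * \<Lambda> * \<delta>)\<^sup>2 - y / (32 * \<Lambda>))
           = 20 * real n * \<Lambda> ^ 5 * \<delta>\<^sup>2 - real n * y / (64 * \<Lambda>) - (real n / (64 * \<Lambda>)) * y"
          using L0 by (simp add: power2_eq_square eval_nat_numeral field_simps)
        ultimately have "real n * (5 * \<Lambda> ^ 3 * (2 * \<Lambda> * \<delta>)\<^sup>2 - y / (32 * \<Lambda>)) \<le> (20 * real n * \<Lambda> ^ 5 * \<delta>\<^sup>2 - real n * r / (64 * \<Lambda>)) + - (real n / (64 * \<Lambda>)) * y"
          by linarith
        then have "exp (real n * (5 * \<Lambda> ^ 3 * (2 * \<Lambda> * \<delta>)\<^sup>2 - y / (32 * \<Lambda>))) \<le> ?E * exp (- (real n / (64 * \<Lambda>)) * y)"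
          unfolding exp_add[symmetric] exp_le_cancel_iff .
        then show ?thesis using True unfolding y_def by (simp add: ennreal_mult[symmetric] ennreal_leI)
      qed simp
    qed
    also have "\<dots> = ennreal ?E * (\<integral>\<^sup>+\<theta>. ennreal (exp (- (real n / (64 * \<Lambda>)) * sqd (log_spline q J \<theta>))) \<partial>\<mu>)"
      by (rule nn_integral_cmult) (simp add: measurable_cong_sets[OF sets_mu refl])
    also have "(\<integral>\<^sup>+\<theta>. ennreal (exp (- (real n / (64 * \<Lambda>)) * sqd (log_spline q J \<theta>))) \<partial>\<mu>)
      \<le> ennreal (D ^ J) * (\<integral>\<^sup>+\<theta>. indicator (cube J M) \<theta> * ennreal (exp (- (real n / (64 * \<Lambda>)) * sqd (log_spline q J \<theta>))) \<partial>hyperplane_lebesgue J)"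
      by (rule prior_integral_le) measurable
    also have "\<dots> \<le> ennreal (D ^ J) * (\<integral>\<^sup>+\<theta>. indicator (cube J (M + 1)) \<theta> * ennreal (exp (- (real n / (64 * \<Lambda>)) * sqd (log_spline q J \<theta>))) \<partial>hyperplane_lebesgue J)"
      using cube_M_subset by (intro mult_left_mono nn_integral_mono mult_right_mono) (auto simp: indicator_def)
    also have "\<dots> \<le> ennreal (D ^ J) * ennreal (vol (real n / (64 * \<Lambda>) / (4 * real K * \<Lambda>\<^sup>2)))"
      using pn L0 by (intro mult_left_mono exp_sqd_integral K) auto
    also have "real n / (64 * \<Lambda>) / (4 * real K * \<Lambda>\<^sup>2) = real n / (256 * real K * \<Lambda> ^ 3)"
      by (simp add: power2_eq_square power3_eq_cube mult_ac)
    finally show ?thesis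
      using d_pos dD by (simp add: ennreal_mult' ennreal_mult'' mult_left_mono)
  qed
  show ?thesis by (rule order_trans[OF s1 add_left_mono[OF mult_left_mono[OF s2]]]) simp
qed

text \<open>One factor \<Lambda> comes from the chi-square bound and \<Lambda>^2 from passing from
  logarithms to densities; 2 \<delta> is the move inside the ball, spline and normalising constant
  changing by \<delta> each.\<close>

lemma evidence_lower_bound:
  assumes \<delta>: "0 < \<delta>" and \<theta>0: "\<theta>0 \<in> zero_sum_hyperplane J" "\<theta>0 \<in> cube J (M - \<delta>)"
    and e: "\<And>x. x \<in> {0..1} \<Longrightarrow> \<bar>ln (log_spline q J \<theta>0 x) - ln (p0 x)\<bar> \<le> e"
  shows "(\<integral>\<^sup>+X. inverse (\<integral>\<^sup>+\<theta>. ennreal (lr \<theta> X) \<partial>\<mu>) \<partial>sample)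
    \<le> ennreal (exp (real n * (\<Lambda> ^ 3 * (2 * \<delta> + e)\<^sup>2)) / (d ^ J * \<delta> ^ (J - 1)))"
proof -
  interpret prob_space \<mu> by (rule prior_prob)
  let ?b = "coeff_ball \<theta>0 \<delta>" and ?v = "d ^ J * \<delta> ^ (J - 1)"
  have v: "0 < ?v" using d_pos \<delta> by simp
  note lower = prior_ball_lower[OF \<delta> \<theta>0]
  have sub: "?b \<subseteq> cube J (M + 1)" using \<theta>0 \<delta> by (intro coeff_ball_cube[of _ "M - \<delta>"]) auto
  have e0: "0 \<le> e" using e[of 0] by simp
  have gb: "good (log_spline q J \<theta>) \<and> sqd (log_spline q J \<theta>) \<le> \<Lambda>\<^sup>2 * (2 * \<delta> + e)\<^sup>2" if \<theta>: "\<theta> \<in> ?b" for \<theta>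
  proof -
    have g: "good (log_spline q J \<theta>)" using \<theta> sub good_cube by auto
    have "sqd (log_spline q J \<theta>) \<le> (LINT x|unit_lebesgue. \<Lambda>\<^sup>2 * (2 * \<delta> + e)\<^sup>2)"
      unfolding sqd_def
    proof (intro integral_mono good_sq_integrable g good_p0)
      fix x assume "x \<in> space unit_lebesgue"
      then have x: "x \<in> {0..1}" by simp
      have "\<bar>ln (log_spline q J \<theta> x) - ln (log_spline q J \<theta>0 x)\<bar> \<le> 2 * \<delta>"
        using \<theta> by (intro ln_log_spline_perturb x) (auto simp: coeff_ball_def)
      with e[OF x] have l: "\<bar>ln (log_spline q J \<theta> x) - ln (p0 x)\<bar> \<le> 2 * \<delta> + e" by linarith
      have "\<bar>log_spline q J \<theta> x - p0 x\<bar> \<le> \<Lambda> * \<bar>ln (log_spline q J \<theta> x) - ln (p0 x)\<bar>"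
        using g good_p0 x log_spline_pos p0_pos[OF x] by (intro diff_ln_bound) (auto simp: good_def)
      also have "\<dots> \<le> \<Lambda> * (2 * \<delta> + e)" using l L0 by (intro mult_left_mono) auto
      finally have "\<bar>log_spline q J \<theta> x - p0 x\<bar>\<^sup>2 \<le> (\<Lambda> * (2 * \<delta> + e))\<^sup>2" by (rule power_mono) simp
      then show "(log_spline q J \<theta> x - p0 x)\<^sup>2 \<le> \<Lambda>\<^sup>2 * (2 * \<delta> + e)\<^sup>2" by (simp add: power_mult_distrib)
    qed simp
    then show ?thesis using g by (simp add: prob_unit_lebesgue)
  qed
  have "(\<integral>\<^sup>+X. inverse (\<integral>\<^sup>+\<theta>. ennreal (lr \<theta> X) \<partial>\<mu>) \<partial>sample)
    \<le> ennreal (exp (real n * (\<Lambda> * (\<Lambda>\<^sup>2 * (2 * \<delta> + e)\<^sup>2)))) / emeasure \<mu> ?b"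
  proof (rule evidence_bound[OF sets_mu prior_sigma_finite coeff_ball_sets _ _ gb])
    show "0 < emeasure \<mu> ?b" using lower v by (auto intro: less_le_trans[of 0 "ennreal ?v"])
    show "emeasure \<mu> ?b < \<infinity>" using emeasure_finite by (simp add: less_top[symmetric])
  qed
  also have "\<dots> \<le> ennreal (exp (real n * (\<Lambda> * (\<Lambda>\<^sup>2 * (2 * \<delta> + e)\<^sup>2)))) / ennreal ?v"
    unfolding divide_ennreal_def by (intro mult_left_mono inverse_ennreal_antimono lower) simp
  also have "\<dots> = ennreal (exp (real n * (\<Lambda> * (\<Lambda>\<^sup>2 * (2 * \<delta> + e)\<^sup>2))) / ?v)" using v by (simp add: divide_ennreal)
  also have "\<Lambda> * (\<Lambda>\<^sup>2 * (2 * \<delta> + e)\<^sup>2) = \<Lambda> ^ 3 * (2 * \<delta> + e)\<^sup>2" by (simp add: power2_eq_square power3_eq_cube)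
  finally show ?thesis .
qed

end

text \<open>The factor per coordinate in \<open>vol\<close> at A = n / (256 K \<Lambda>^3), with
  sqrt (K/n) replaced by \<epsilon>; 2^q (q-1)! is the reciprocal of the diagonal entry from
  \<open>avg_B_spline_lower\<close>.\<close>

definition base_const :: "nat \<Rightarrow> real \<Rightarrow> real" where
  "base_const q \<Lambda> = sqrt (256 * pi * \<Lambda> ^ 3) * (2 ^ q * fact (q - 1))"

text \<open>Of the two factors e in exp 2, one is the threshold V e^J and one absorbs polynomial
  factors. The term 40 \<Lambda>^5 is 20 \<Lambda>^5 n \<epsilon>^2 with n \<epsilon>^2 \<le> 2 J,
  the square comes from the two Gaussian volumes, and D from the prior density.\<close>

definition rate_const :: "nat \<Rightarrow> real \<Rightarrow> real \<Rightarrow> real" where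
  "rate_const q \<Lambda> D = exp (2 + 40 * \<Lambda> ^ 5) * (base_const q \<Lambda>)\<^sup>2 * max D 1"

lemma base_const_ge_1:
  assumes "1 \<le> \<Lambda>"
  shows "1 \<le> base_const q \<Lambda>"
proof -
  have "1 \<le> 256 * pi" using pi_ge_two by linarith
  then have "1 * 1 \<le> (256 * pi) * \<Lambda> ^ 3" using assms by (intro mult_mono) auto
  then have 1: "1 \<le> sqrt (256 * pi * \<Lambda> ^ 3)" by simp
  have "1 * 1 \<le> (2::real) ^ q * fact (q - 1)" by (intro mult_mono) auto
  with 1 have "1 * 1 \<le> sqrt (256 * pi * \<Lambda> ^ 3) * (2 ^ q * fact (q - 1))" by (intro mult_mono) auto
  then show ?thesis by (simp add: base_const_def)
qed

context log_spline_experiment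
begin

abbreviation bc where "bc \<equiv> base_const q \<Lambda>"

definition vol_rate :: "real \<Rightarrow> real" where
  "vol_rate \<epsilon> = sqrt (real J) * ((2 * (M + 1)) ^ q * (bc * \<epsilon>) ^ (K - 2))"

text \<open>The last clause bounds what remains when the exponents K - 2 and J - 1 in the volumes
  are all replaced by J.\<close>

definition regular :: "real \<Rightarrow> bool" where
  "regular \<epsilon> \<longleftrightarrow> 2 \<le> K \<and> 1 \<le> n \<and> 0 < \<epsilon> \<and> \<epsilon> \<le> 1 \<and> real J \<le> real n * \<epsilon>\<^sup>2 \<and> real n * \<epsilon>\<^sup>2 \<le> 2 * real J \<and>
     real J * (2 * (M + 1)) ^ (2 * q) / \<epsilon> ^ (1 + 2 * q) \<le> exp (real J)"

lemma vol_le: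
  assumes "regular \<epsilon>" "0 < c" "c \<le> 256"
  shows "vol (real n / (c * real K * \<Lambda> ^ 3)) \<le> vol_rate \<epsilon>"
proof -
  have r: "1 \<le> n" "0 < \<epsilon>" "real J \<le> real n * \<epsilon>\<^sup>2" using assms by (auto simp: regular_def)
  have pn: "0 < real n" using r by simp
  have KJ: "real K \<le> real J" using J_eq q1 by simp
  have "pi / (real n / (c * real K * \<Lambda> ^ 3)) = pi * c * \<Lambda> ^ 3 * (real K / real n)"
    using pn by simp
  also have "\<dots> \<le> pi * 256 * \<Lambda> ^ 3 * \<epsilon>\<^sup>2"
  proof (intro mult_mono)
    show "real K / real n \<le> \<epsilon>\<^sup>2" using KJ r pn by (simp add: field_simps)
  qed (use assms L0 in auto)
  finally have "sqrt (pi / (real n / (c * real K * \<Lambda> ^ 3))) \<le> sqrt (pi * 256 * \<Lambda> ^ 3 * \<epsilon>\<^sup>2)"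
    by (rule real_sqrt_le_mono)
  also have "\<dots> = sqrt (256 * pi * \<Lambda> ^ 3) * \<epsilon>" using r by (simp add: real_sqrt_mult mult_ac)
  finally have s: "sqrt (pi / (real n / (c * real K * \<Lambda> ^ 3))) \<le> sqrt (256 * pi * \<Lambda> ^ 3) * \<epsilon>" .
  have "sqrt (pi / (real n / (c * real K * \<Lambda> ^ 3))) / ((1 / 2) ^ q / fact (q - 1)) \<le> bc * \<epsilon>"
  proof -
    have "sqrt (pi / (real n / (c * real K * \<Lambda> ^ 3))) / ((1 / 2) ^ q / fact (q - 1)) = sqrt (pi / (real n / (c * real K * \<Lambda> ^ 3))) * (2 ^ q * fact (q - 1))"
      by (simp add: power_one_over field_simps)
    also have "\<dots> \<le> (sqrt (256 * pi * \<Lambda> ^ 3) * \<epsilon>) * (2 ^ q * fact (q - 1))"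
      using s by (intro mult_right_mono) auto
    finally show ?thesis by (simp add: base_const_def mult_ac)
  qed
  then show ?thesis
    unfolding vol_def vol_rate_def using M_pos assms(2) L0 by (intro mult_left_mono power_mono) auto
qed

lemma power_split:
  fixes \<epsilon> :: real
  assumes "2 \<le> K" "0 < \<epsilon>"
  shows "\<epsilon> ^ (K - 2) = \<epsilon> ^ J / \<epsilon> ^ (1 + q)"
proof -
  have "K - 2 + (1 + q) = J" using J_eq assms(1) q1 by simp
  then have "\<epsilon> ^ (K - 2) * \<epsilon> ^ (1 + q) = \<epsilon> ^ J" unfolding power_add[symmetric] by (simp only:)
  then show ?thesis using assms(2) by (simp add: field_simps)
qed

text \<open>\<open>far_bound\<close> with ball radius \<epsilon> and threshold u = V e^J. The first
  error is V/u = exp (-J), and in the second V V / \<epsilon>^(J-1) leaves one power of \<epsilon>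
  per coordinate.\<close>

lemma far_rate:
  assumes "regular \<epsilon>"
  shows "(\<integral>\<^sup>+X. min 1 (k * (\<integral>\<^sup>+\<theta>\<in>{\<theta> \<in> space (PiM {..<J} (\<lambda>_. borel)). r \<le> sqd (log_spline q J \<theta>)}. ennreal (lr \<theta> X) \<partial>\<mu>)) \<partial>sample)
    \<le> ennreal (exp (- real J)) + k * ennreal ((rate_const q \<Lambda> D * \<epsilon>) ^ J * exp (- (real n * r / (64 * \<Lambda>))))"
proof -
  have g: "2 \<le> K" "1 \<le> n" "0 < \<epsilon>" "\<epsilon> \<le> 1" "real n * \<epsilon>\<^sup>2 \<le> 2 * real J"
      "real J * (2 * (M + 1)) ^ (2 * q) / \<epsilon> ^ (1 + 2 * q) \<le> exp (real J)"
    using assms by (auto simp: regular_def)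
  have b: "1 \<le> bc" using base_const_ge_1[OF Lam1] .
  define V where "V = vol_rate \<epsilon>"
  have V: "0 < V" unfolding V_def vol_rate_def using M_pos g b J1 by (auto intro!: mult_pos_pos)
  define u where "u = V * exp (real J)"
  have u: "0 < u" using V by (simp add: u_def)
  define E where "E = exp (20 * real n * \<Lambda> ^ 5 * \<epsilon>\<^sup>2 - real n * r / (64 * \<Lambda>))"
  have "(\<integral>\<^sup>+X. min 1 (k * (\<integral>\<^sup>+\<theta>\<in>{\<theta> \<in> space (PiM {..<J} (\<lambda>_. borel)). r \<le> sqd (log_spline q J \<theta>)}. ennreal (lr \<theta> X) \<partial>\<mu>)) \<partial>sample)
    \<le> ennreal (vol (real n / (32 * real K * \<Lambda> ^ 3))) / ennreal u +
      k * ennreal (u / \<epsilon> ^ (J - 1)) * ennreal (E * (D ^ J * vol (real n / (256 * real K * \<Lambda> ^ 3))))"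
    unfolding E_def by (rule far_bound[OF g(1-4) u])
  also have "\<dots> \<le> ennreal (exp (- real J)) + k * ennreal ((rate_const q \<Lambda> D * \<epsilon>) ^ J * exp (- (real n * r / (64 * \<Lambda>))))"
  proof (intro add_mono)
    have "vol (real n / (32 * real K * \<Lambda> ^ 3)) / u \<le> V / u"
      using vol_le[OF assms, of 32] u by (intro divide_right_mono) (auto simp: V_def)
    also have "V / u = exp (- real J)" using V by (simp add: u_def exp_minus field_simps)
    finally show "ennreal (vol (real n / (32 * real K * \<Lambda> ^ 3))) / ennreal u \<le> ennreal (exp (- real J))"
      using u M_pos L0 by (subst divide_ennreal) (auto simp: vol_def intro!: ennreal_leI)
    have E: "E \<le> exp (40 * \<Lambda> ^ 5) ^ J * exp (- (real n * r / (64 * \<Lambda>)))"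
    proof -
      have "20 * \<Lambda> ^ 5 * (real n * \<epsilon>\<^sup>2) \<le> 20 * \<Lambda> ^ 5 * (2 * real J)" using g L0 by (intro mult_left_mono) auto
      then have "20 * real n * \<Lambda> ^ 5 * \<epsilon>\<^sup>2 - real n * r / (64 * \<Lambda>) \<le> real J * (40 * \<Lambda> ^ 5) + - (real n * r / (64 * \<Lambda>))"
        by (simp add: mult_ac)
      then have "E \<le> exp (real J * (40 * \<Lambda> ^ 5) + - (real n * r / (64 * \<Lambda>)))" unfolding E_def by simp
      then show ?thesis by (simp only: exp_add exp_of_nat_mult)
    qed
    have VV: "V * V / \<epsilon> ^ (J - 1) \<le> (\<epsilon> ^ J) * (bc\<^sup>2) ^ J * exp (real J)"
    proof -
      have "\<epsilon> ^ J = \<epsilon> * \<epsilon> ^ (J - 1)" using J1 by (cases J) auto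
      then have e: "\<epsilon> ^ (K - 2) * \<epsilon> ^ (K - 2) / \<epsilon> ^ (J - 1) = \<epsilon> ^ J / \<epsilon> ^ (1 + 2 * q)"
      proof -
        have x: "\<epsilon> ^ (1 + q) * \<epsilon> ^ (1 + q) = \<epsilon> ^ Suc (1 + 2 * q)"
          unfolding power_add[symmetric] by (rule arg_cong[where f = "power \<epsilon>"]) simp
        have "(a / x) * (a / x) / y = a / z" if "a = e * y" "x * x = e * z" "0 < e" "0 < y" "0 < z" for a e x y z :: real
          using that by (simp add: divide_simps)
        from this[OF \<open>\<epsilon> ^ J = _\<close> x[unfolded power_Suc]] show ?thesis
          unfolding power_split[OF g(1,3)] using g(3) by simp
      qed
      have "V * V / \<epsilon> ^ (J - 1) = (sqrt (real J) * sqrt (real J)) * ((2 * (M + 1)) ^ q * (2 * (M + 1)) ^ q) * (bc ^ (K - 2) * bc ^ (K - 2)) * (\<epsilon> ^ (K - 2) * \<epsilon> ^ (K - 2) / \<epsilon> ^ (J - 1))"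
        unfolding V_def vol_rate_def power_mult_distrib[of bc] by (simp add: mult_ac)
      also have "\<dots> = (\<epsilon> ^ J) * (bc\<^sup>2) ^ (K - 2) * (real J * (2 * (M + 1)) ^ (2 * q) / \<epsilon> ^ (1 + 2 * q))"
        unfolding e by (simp add: power_mult_distrib[symmetric] power2_eq_square power_mult mult_ac)
      also have "\<dots> \<le> (\<epsilon> ^ J) * (bc\<^sup>2) ^ J * exp (real J)"
      proof (rule mult_mono[OF mult_mono[OF order.refl power_increasing] g(6)])
        show "K - 2 \<le> J" using J_eq q1 by simp
        show "1 \<le> bc\<^sup>2" using b by simp
      qed (use g M_pos in auto)
      finally show ?thesis .
    qed
    have "ennreal (u / \<epsilon> ^ (J - 1)) * ennreal (E * (D ^ J * vol (real n / (256 * real K * \<Lambda> ^ 3))))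
      = ennreal (u / \<epsilon> ^ (J - 1) * (E * (D ^ J * vol (real n / (256 * real K * \<Lambda> ^ 3)))))"
      using u g by (intro ennreal_mult'[symmetric]) auto
    also have "\<dots> \<le> ennreal ((rate_const q \<Lambda> D * \<epsilon>) ^ J * exp (- (real n * r / (64 * \<Lambda>))))"
    proof (intro ennreal_leI)
      have "u / \<epsilon> ^ (J - 1) * (E * (D ^ J * vol (real n / (256 * real K * \<Lambda> ^ 3)))) \<le> u / \<epsilon> ^ (J - 1) * (E * (D ^ J * V))"
        using vol_le[OF assms, of 256] u g d_pos dD unfolding V_def E_def by (intro mult_left_mono) auto
      also have "\<dots> = exp 1 ^ J * D ^ J * E * (V * V / \<epsilon> ^ (J - 1))" by (simp add: u_def flip: exp_of_nat_mult)
      also have "\<dots> \<le> exp 1 ^ J * (max D 1) ^ J * (exp (40 * \<Lambda> ^ 5) ^ J * exp (- (real n * r / (64 * \<Lambda>)))) * ((\<epsilon> ^ J) * (bc\<^sup>2) ^ J * exp (real J))"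
        using V g b d_pos dD by (intro mult_mono E VV power_mono) (auto simp: E_def)
      also have "exp (real J) = exp 1 ^ J" by (simp flip: exp_of_nat_mult)
      also have "exp 1 ^ J * (max D 1) ^ J * (exp (40 * \<Lambda> ^ 5) ^ J * exp (- (real n * r / (64 * \<Lambda>)))) * ((\<epsilon> ^ J) * (bc\<^sup>2) ^ J * exp 1 ^ J)
         = ((exp 1 * exp 1 * exp (40 * \<Lambda> ^ 5)) * bc\<^sup>2 * max D 1 * \<epsilon>) ^ J * exp (- (real n * r / (64 * \<Lambda>)))"
        by (simp only: power_mult_distrib mult_ac)
      also have "exp 1 * exp 1 * exp (40 * \<Lambda> ^ 5) = exp (2 + 40 * \<Lambda> ^ 5)"
        by (simp flip: exp_add)
      finally show "u / \<epsilon> ^ (J - 1) * (E * (D ^ J * vol (real n / (256 * real K * \<Lambda> ^ 3)))) \<le> (rate_const q \<Lambda> D * \<epsilon>) ^ J * exp (- (real n * r / (64 * \<Lambda>)))"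
        unfolding rate_const_def .
    qed
    finally show "k * ennreal (u / \<epsilon> ^ (J - 1)) * ennreal (E * (D ^ J * vol (real n / (256 * real K * \<Lambda> ^ 3))))
      \<le> k * ennreal ((rate_const q \<Lambda> D * \<epsilon>) ^ J * exp (- (real n * r / (64 * \<Lambda>))))"
      by (simp add: mult.assoc mult_left_mono)
  qed
  finally show ?thesis .
qed

section \<open>Likelihood integrals over densities as integrals over coefficients\<close>

lemma L2_dist_sqd: "L2_dist f p0 = sqrt (sqd f)"
  by (simp add: L2_dist_def sqd_def)

lemma prod_p0_pos: "X \<in> space sample \<Longrightarrow> 0 < (\<Prod>i<n. p0 (X i))"
  using p0_pos sample_component by (intro prod_pos) auto

lemma likelihood_lr:
  assumes "X \<in> space sample"
  shows "(\<Prod>i<n. log_spline q J \<theta> (X i)) = (\<Prod>i<n. p0 (X i)) * lr \<theta> X"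
proof -
  have "(\<Prod>i<n. p0 (X i)) * lr \<theta> X = (\<Prod>i<n. p0 (X i) * (log_spline q J \<theta> (X i) / p0 (X i)))"
    unfolding lr_def by (rule prod.distrib[symmetric])
  also have "\<dots> = (\<Prod>i<n. log_spline q J \<theta> (X i))"
    using p0_pos sample_component[OF assms] by (intro prod.cong refl) (force simp: less_imp_neq[symmetric])
  finally show ?thesis by simp
qed

lemma p0_densities: "p0 \<in> densities"
proof -
  have "(\<integral>\<^sup>+x. ennreal (p0 x) \<partial>unit_lebesgue) = 1"
    using good_integrable[OF good_p0] good_p0 p0_pos
    by (subst nn_integral_eq_integral) (auto simp: good_def intro!: AE_I2 less_imp_le)
  moreover have "integrable unit_lebesgue (\<lambda>x. (p0 x)\<^sup>2)"
  proof (rule integrable_unit_bounded)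
    show "\<bar>(p0 x)\<^sup>2\<bar> \<le> \<Lambda>\<^sup>2" if "x \<in> {0..1}" for x
      using p0_bounds[OF that] p0_pos[OF that] by (auto intro!: power_mono)
  qed measurable
  ultimately show ?thesis unfolding densities_def using p0_pos by (auto intro: less_imp_le)
qed

text \<open>The posterior is made of Bochner integrals over densities. They are pulled back to
  coefficients and turned into nonnegative integrals, with the likelihood of p0 as a factor that
  later cancels between numerator and denominator.\<close>

lemma numerator_eq:
  assumes X: "X \<in> space sample" and S: "S \<in> sets density_space"
    and T: "T \<in> sets (PiM {..<J} (\<lambda>_. borel))"
    and ST: "\<And>\<theta>. \<theta> \<in> space (PiM {..<J} (\<lambda>_. borel)) \<Longrightarrow> log_spline q J \<theta> \<in> S \<longleftrightarrow> \<theta> \<in> T"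
  shows "0 \<le> (LINT p:S|log_spline_prior q J \<mu>. (\<Prod>i<n. p (X i)))"
    "ennreal (LINT p:S|log_spline_prior q J \<mu>. (\<Prod>i<n. p (X i))) = ennreal (\<Prod>i<n. p0 (X i)) * (\<integral>\<^sup>+\<theta>\<in>T. ennreal (lr \<theta> X) \<partial>\<mu>)"
proof -
  interpret prob_space \<mu> by (rule prior_prob)
  let ?P = "\<Prod>i<n. p0 (X i)"
  have m: "log_spline q J \<in> \<mu> \<rightarrow>\<^sub>M density_space"
    using log_spline_density_space by (simp add: measurable_cong_sets[OF sets_mu refl])
  have sp: "space \<mu> = space (PiM {..<J} (\<lambda>_. borel))" by (rule sets_eq_imp_space_eq[OF sets_mu])
  have [measurable]: "(\<lambda>p. p (X i)) \<in> borel_measurable density_space" if "i < n" for i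
    using evaluation_meas[OF sample_component[OF X that]] .
  have [measurable]: "(\<lambda>p. indicator S p *\<^sub>R (\<Prod>i<n. p (X i))) \<in> borel_measurable density_space"
    using S by (intro borel_measurable_scaleR borel_measurable_prod) auto
  have [measurable]: "(\<lambda>\<theta>. lr \<theta> X) \<in> borel_measurable \<mu>"
    using measurable_compose[OF measurable_Pair2'[OF X] measurable_param(1)[OF sets_mu]] by simp
  have [measurable]: "T \<in> sets \<mu>" using T sets_mu by simp
  have "(LINT p:S|log_spline_prior q J \<mu>. (\<Prod>i<n. p (X i))) = (LINT \<theta>|\<mu>. indicator S (log_spline q J \<theta>) *\<^sub>R (\<Prod>i<n. log_spline q J \<theta> (X i)))"
    unfolding set_lebesgue_integral_def log_spline_prior_def by (rule integral_distr[OF m]) measurable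
  also have "\<dots> = (LINT \<theta>|\<mu>. ?P * (lr \<theta> X * indicator T \<theta>))"
    using ST sp likelihood_lr[OF X]
    by (intro Bochner_Integration.integral_cong) (auto simp: indicator_def)
  finally have eq: "(LINT p:S|log_spline_prior q J \<mu>. (\<Prod>i<n. p (X i))) = (LINT \<theta>|\<mu>. ?P * (lr \<theta> X * indicator T \<theta>))" .
  have pos: "AE \<theta> in \<mu>. 0 \<le> ?P * (lr \<theta> X * indicator T \<theta>)"
    using AE_prior
  proof eventually_elim
    case (elim \<theta>)
    then have "\<theta> \<in> cube J (M + 1)" using cube_M_subset by auto
    then show ?case
      using lr_pos[OF good_cube X, of \<theta>] prod_p0_pos[OF X] by (intro mult_nonneg_nonneg) (auto intro: less_imp_le)
  qed
  show "0 \<le> (LINT p:S|log_spline_prior q J \<mu>. (\<Prod>i<n. p (X i)))"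
    unfolding eq using pos by (rule integral_nonneg_AE)
  \<comment> \<open>Boundedness gives integrability; a non-integrable likelihood would have Bochner
    integral 0 and the identity could fail.\<close>
  have bnd: "AE \<theta> in \<mu>. norm (?P * (lr \<theta> X * indicator T \<theta>)) \<le> \<Lambda> ^ n"
    using AE_prior
  proof eventually_elim
    case (elim \<theta>)
    then have "\<theta> \<in> cube J (M + 1)" using cube_M_subset by auto
    then have g: "good (log_spline q J \<theta>)" by (rule good_cube)
    have "?P * lr \<theta> X \<le> (\<Prod>i<n. \<Lambda>)"
      unfolding likelihood_lr[OF X, symmetric] using g sample_component[OF X] log_spline_pos[of q J \<theta>]
      by (intro prod_mono) (auto simp: good_def intro: less_imp_le)
    then show ?case using lr_pos[OF g X] prod_p0_pos[OF X] L0 by (auto simp: indicator_def abs_mult less_imp_le)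
  qed
  have int: "integrable \<mu> (\<lambda>\<theta>. ?P * (lr \<theta> X * indicator T \<theta>))"
    by (rule integrable_const_bound[OF bnd]) measurable
  have "ennreal (LINT \<theta>|\<mu>. ?P * (lr \<theta> X * indicator T \<theta>)) = (\<integral>\<^sup>+\<theta>. ennreal (?P * (lr \<theta> X * indicator T \<theta>)) \<partial>\<mu>)"
    by (rule nn_integral_eq_integral[OF int pos, symmetric])
  also have "\<dots> = (\<integral>\<^sup>+\<theta>. ennreal ?P * (ennreal (lr \<theta> X) * indicator T \<theta>) \<partial>\<mu>)"
    using prod_p0_pos[OF X] by (intro nn_integral_cong) (auto simp: ennreal_mult' less_imp_le indicator_def)
  also have "\<dots> = ennreal ?P * (\<integral>\<^sup>+\<theta>\<in>T. ennreal (lr \<theta> X) \<partial>\<mu>)"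
    by (rule nn_integral_cmult) measurable
  finally show "ennreal (LINT p:S|log_spline_prior q J \<mu>. (\<Prod>i<n. p (X i))) = ennreal ?P * (\<integral>\<^sup>+\<theta>\<in>T. ennreal (lr \<theta> X) \<partial>\<mu>)"
    unfolding eq .
qed

lemma denominator_eq:
  assumes X: "X \<in> space sample"
  shows "0 \<le> (LINT p|log_spline_prior q J \<mu>. (\<Prod>i<n. p (X i)))"
    "ennreal (LINT p|log_spline_prior q J \<mu>. (\<Prod>i<n. p (X i))) = ennreal (\<Prod>i<n. p0 (X i)) * (\<integral>\<^sup>+\<theta>. ennreal (lr \<theta> X) \<partial>\<mu>)"
proof -
  let ?T = "PiM {..<J} (\<lambda>_. borel) :: (nat \<Rightarrow> real) measure"
  have sp: "space \<mu> = space ?T" by (rule sets_eq_imp_space_eq[OF sets_mu])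
  have sps: "space (log_spline_prior q J \<mu>) = space density_space" by (simp add: log_spline_prior_def)
  have a: "(LINT p:space density_space|log_spline_prior q J \<mu>. (\<Prod>i<n. p (X i))) = (LINT p|log_spline_prior q J \<mu>. (\<Prod>i<n. p (X i)))"
    unfolding set_lebesgue_integral_def using sps by (intro Bochner_Integration.integral_cong) auto
  have b: "(\<integral>\<^sup>+\<theta>\<in>space ?T. ennreal (lr \<theta> X) \<partial>\<mu>) = (\<integral>\<^sup>+\<theta>. ennreal (lr \<theta> X) \<partial>\<mu>)"
    using sp by (intro nn_integral_cong) auto
  have c: "log_spline q J \<theta> \<in> space density_space \<longleftrightarrow> \<theta> \<in> space ?T" if "\<theta> \<in> space ?T" for \<theta>
    using that log_spline_densities by (simp add: space_density_space)
  show "0 \<le> (LINT p|log_spline_prior q J \<mu>. (\<Prod>i<n. p (X i)))"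
    "ennreal (LINT p|log_spline_prior q J \<mu>. (\<Prod>i<n. p (X i))) = ennreal (\<Prod>i<n. p0 (X i)) * (\<integral>\<^sup>+\<theta>. ennreal (lr \<theta> X) \<partial>\<mu>)"
    using numerator_eq[OF X sets.top sets.top c] unfolding a b by auto
qed

end

section \<open>Dimensions and rates\<close>

context
  fixes \<alpha> :: real
  assumes \<alpha>: "0 < \<alpha>"
begin

lemma model_dim_bounds:
  assumes "1 \<le> n"
  shows "real (model_dim n \<alpha>) \<le> real n powr (1 / (2 * \<alpha> + 1))"
    "real n powr (1 / (2 * \<alpha> + 1)) \<le> real (model_dim n \<alpha>) + 1" "1 \<le> model_dim n \<alpha>"
proof -
  let ?m = "real n powr (1 / (2 * \<alpha> + 1))"
  have m1: "1 \<le> ?m" using assms \<alpha> by (intro ge_one_powr_ge_zero) auto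
  then have f: "1 \<le> \<lfloor>?m\<rfloor>" by (simp add: le_floor_iff)
  then have e: "real (model_dim n \<alpha>) = of_int \<lfloor>?m\<rfloor>" unfolding model_dim_def by simp
  show "real (model_dim n \<alpha>) \<le> ?m" "?m \<le> real (model_dim n \<alpha>) + 1" unfolding e by linarith+
  show "1 \<le> model_dim n \<alpha>" using f unfolding model_dim_def by (simp add: le_nat_iff)
qed

lemma rate_pos: "1 \<le> n \<Longrightarrow> 0 < rate n \<alpha>"
  unfolding rate_def by simp

lemma rate_le_1: "1 \<le> n \<Longrightarrow> rate n \<alpha> \<le> 1"
  unfolding rate_def using \<alpha> powr_mono[of "- \<alpha> / (2 * \<alpha> + 1)" 0 "real n"] by simp

lemma n_rate_sq:
  assumes "1 \<le> n"
  shows "real n * (rate n \<alpha>)\<^sup>2 = real n powr (1 / (2 * \<alpha> + 1))"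
proof -
  have "real n * (rate n \<alpha>)\<^sup>2 = real n powr (1 + 2 * (- \<alpha> / (2 * \<alpha> + 1)))"
    unfolding rate_def powr_add using assms by (simp add: power2_eq_square flip: powr_add)
  also have "1 + 2 * (- \<alpha> / (2 * \<alpha> + 1)) = 1 / (2 * \<alpha> + 1)" using \<alpha> by (simp add: field_simps)
  finally show ?thesis .
qed

lemma rate_eq_powr: "rate n \<alpha> = (real n powr (1 / (2 * \<alpha> + 1))) powr (- \<alpha>)"
  unfolding rate_def powr_powr by simp

lemma n_rate_sq_bounds:
  assumes "1 \<le> n"
  shows "real (model_dim n \<alpha>) \<le> real n * (rate n \<alpha>)\<^sup>2" "real n * (rate n \<alpha>)\<^sup>2 \<le> 2 * real (model_dim n \<alpha>)"
  using model_dim_bounds[OF assms] unfolding n_rate_sq[OF assms] by linarith+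

lemma powr_at_top: "filterlim (\<lambda>n. real n powr (1 / (2 * \<alpha> + 1))) at_top sequentially"
proof -
  have "0 < 1 / (2 * \<alpha> + 1)" using \<alpha> by simp
  then have "filterlim (\<lambda>n. real n powr c) at_top sequentially" if "c = 1 / (2 * \<alpha> + 1)" for c
    unfolding that[symmetric] by real_asymp
  then show ?thesis by blast
qed

lemma model_dim_at_top: "filterlim (\<lambda>n. real (model_dim n \<alpha>)) at_top sequentially"
proof (rule filterlim_at_top_mono)
  show "filterlim (\<lambda>n. real n powr (1 / (2 * \<alpha> + 1)) - 1) at_top sequentially"
    using filterlim_tendsto_add_at_top[OF tendsto_const powr_at_top, of "-1"] by simp
  show "\<forall>\<^sub>F n in sequentially. real n powr (1 / (2 * \<alpha> + 1)) - 1 \<le> real (model_dim n \<alpha>)"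
    using eventually_ge_at_top[of 1] by eventually_elim (use model_dim_bounds(2) in force)
qed

lemma eventually_model_dim_ge: "\<forall>\<^sub>F n in sequentially. N \<le> model_dim n \<alpha>"
  using filterlim_at_top[THEN iffD1, OF model_dim_at_top, rule_format, of "real N"] by simp

lemma exp_neg_model_dim_tendsto: "(\<lambda>n. exp (- real (model_dim n \<alpha>))) \<longlonglongrightarrow> 0"
  using filterlim_compose[OF exp_at_bot filterlim_compose[OF filterlim_uminus_at_bot_at_top model_dim_at_top]] .

lemma rate_tendsto: "(\<lambda>n. rate n \<alpha>) \<longlonglongrightarrow> 0"
proof -
  have "((\<lambda>m::real. m powr (- \<alpha>)) \<longlongrightarrow> 0) at_top" using \<alpha> by real_asymp
  from filterlim_compose[OF this powr_at_top] show ?thesis unfolding rate_eq_powr .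
qed

lemma eventually_rate_le: "0 < c \<Longrightarrow> \<forall>\<^sub>F n in sequentially. rate n \<alpha> \<le> c"
  using order_tendstoD(2)[OF rate_tendsto, of c] by (auto elim: eventually_mono)

text \<open>Provides the last clause of \<open>regular\<close>: with m = n powr (1 / (2 \<alpha> +
  1)) the rate is m powr (- \<alpha>), so the left side is polynomial in m.\<close>

lemma eventually_polynomial_le_exp:
  assumes "0 \<le> c"
  shows "\<forall>\<^sub>F n in sequentially. real (model_dim n \<alpha>) * c / rate n \<alpha> ^ k \<le> exp (real (model_dim n \<alpha>))"
proof -
  define a where "a = \<alpha> * real k"
  have "((\<lambda>m::real. m * c * m powr a / exp (m - 1)) \<longlongrightarrow> 0) at_top" by real_asymp
  then have "\<forall>\<^sub>F m in at_top. m * c * m powr a / exp (m - 1) < 1" by (rule order_tendstoD) simp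
  from eventually_compose_filterlim[OF this powr_at_top] eventually_ge_at_top[of 1]
  show ?thesis
  proof eventually_elim
    case (elim n)
    let ?m = "real n powr (1 / (2 * \<alpha> + 1))"
    note b = model_dim_bounds[OF elim(2)]
    have m0: "0 < ?m" using elim(2) by simp
    have "rate n \<alpha> ^ k = ?m powr (- a)"
      unfolding rate_eq_powr a_def using m0 by (simp add: powr_powr powr_power mult_ac flip: powr_realpow)
    then have "real (model_dim n \<alpha>) * c / rate n \<alpha> ^ k = real (model_dim n \<alpha>) * c * ?m powr a"
      by (simp add: powr_minus field_simps)
    also have "\<dots> \<le> ?m * c * ?m powr a" using b assms by (intro mult_right_mono) auto
    also have "\<dots> \<le> exp (?m - 1)" using elim(1) by (simp add: field_simps)
    also have "\<dots> \<le> exp (real (model_dim n \<alpha>))" using b by simp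
    finally show ?case .
  qed
qed

end

text \<open>The logarithm of the left side is at most of order J_\<gamma> ln n. The exponent \<tau>
  is arbitrary so that several such factors can share a budget of J_\<alpha>.\<close>

lemma eventually_inverse_rate_power_le:
  assumes "0 < \<alpha>" "\<alpha> < \<gamma>" "0 < c" "0 < \<tau>"
  shows "\<forall>\<^sub>F n in sequentially. 1 / (c * rate n \<gamma>) ^ model_dim n \<gamma> \<le> exp (\<tau> * real (model_dim n \<alpha>))"
proof -
  define a b where "a = 1 / (2 * \<gamma> + 1)" and "b = 1 / (2 * \<alpha> + 1)"
  have ab: "0 < a" "a < b" using assms by (auto simp: a_def b_def field_simps)
  define L where "L = \<bar>ln c\<bar>"
  \<comment> \<open>The summand \<tau> makes room for the rounding in J_\<alpha> \<ge> n powr b -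
    1.\<close>
  have "((\<lambda>x::real. (x powr a * (L + ln x) + \<tau>) / x powr b) \<longlongrightarrow> 0) at_top" using ab by real_asymp
  then have "\<forall>\<^sub>F x in at_top. (x powr a * (L + ln x) + \<tau>) / x powr b < \<tau>"
    using assms(4) by (rule order_tendstoD)
  from eventually_compose_filterlim[OF this filterlim_real_sequentially] eventually_ge_at_top[of 1]
  show ?thesis
  proof eventually_elim
    case (elim n)
    have g: "0 < \<gamma>" using assms by simp
    note bg = model_dim_bounds[OF g elim(2)] and ba = model_dim_bounds[OF assms(1) elim(2)]
    have n0: "0 < real n" "0 \<le> ln (real n)" using elim(2) by auto
    have x: "0 < c * rate n \<gamma>" using assms rate_pos[OF g elim(2)] by simp
    have "- ln (c * rate n \<gamma>) \<le> L + ln (real n)"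
    proof -
      have "ln (c * rate n \<gamma>) = ln c + (- \<gamma> / (2 * \<gamma> + 1)) * ln (real n)"
        using assms n0 rate_pos[OF g elim(2)] by (simp add: ln_mult) (simp add: rate_def ln_powr)
      moreover have "(\<gamma> / (2 * \<gamma> + 1)) * ln (real n) \<le> 1 * ln (real n)"
        using g n0 by (intro mult_right_mono) auto
      ultimately show ?thesis unfolding L_def by (simp add: abs_if split: if_splits)
    qed
    then have "real (model_dim n \<gamma>) * (- ln (c * rate n \<gamma>)) \<le> real (model_dim n \<gamma>) * (L + ln (real n))"
      by (intro mult_left_mono) auto
    also have "\<dots> \<le> real n powr a * (L + ln (real n))"
      using bg(1) n0 unfolding a_def L_def by (intro mult_right_mono) auto
    also have "\<dots> \<le> \<tau> * (real n powr b - 1)" using elim(1) n0 by (simp add: field_simps)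
    also have "\<dots> \<le> \<tau> * real (model_dim n \<alpha>)" using ba(2) assms(4) unfolding b_def by (intro mult_left_mono) auto
    finally have "exp (real (model_dim n \<gamma>) * (- ln (c * rate n \<gamma>))) \<le> exp (\<tau> * real (model_dim n \<alpha>))" by simp
    moreover have "exp (real (model_dim n \<gamma>) * (- ln (c * rate n \<gamma>))) = 1 / (c * rate n \<gamma>) ^ model_dim n \<gamma>"
      using x by (simp add: exp_of_nat_mult exp_minus power_inverse[symmetric] inverse_eq_divide power_one_over)
    ultimately show ?case by (simp only:)
  qed
qed

section \<open>The posterior of the mixture\<close>

text \<open>The posterior enters as F, through domination alone. If F is not integrable, its Bochner
  integral is 0, which lies within the bounds as well.\<close>

lemma integral_bounded_by_nn_integral:
  fixes F :: "'a \<Rightarrow> real"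
  assumes "\<And>x. x \<in> space M \<Longrightarrow> 0 \<le> F x" "(\<integral>\<^sup>+x. ennreal (F x) \<partial>M) \<le> ennreal c" "0 \<le> c"
  shows "0 \<le> (LINT x|M. F x) \<and> (LINT x|M. F x) \<le> c"
proof (cases "integrable M F")
  case True
  have nn: "0 \<le> (LINT x|M. F x)" using assms(1) by (rule Bochner_Integration.integral_nonneg)
  have "ennreal (LINT x|M. F x) = (\<integral>\<^sup>+x. ennreal (F x) \<partial>M)"
    using True assms(1) by (intro nn_integral_eq_integral[symmetric]) auto
  then have "ennreal (LINT x|M. F x) \<le> ennreal c" using assms(2) by simp
  then show ?thesis using nn assms(3) by (simp add: ennreal_le_iff)
next
  case False
  then show ?thesis using assms(3) by (simp add: not_integrable_integral_eq)
qed

text \<open>Placed outside the locales because the mixture combines models with different q, J and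
  \<mu>; extended nonnegative values allow reciprocals and Fubini without side conditions.\<close>

definition evidence :: "(real \<Rightarrow> real) \<Rightarrow> nat \<Rightarrow> nat \<Rightarrow> nat \<Rightarrow> (nat \<Rightarrow> real) measure \<Rightarrow> (nat \<Rightarrow> real) \<Rightarrow> ennreal" where
  "evidence p0 n q J \<mu> X = (\<integral>\<^sup>+\<theta>. ennreal (sampling_model.lr p0 n (log_spline q J) \<theta> X) \<partial>\<mu>)"

definition far_evidence :: "(real \<Rightarrow> real) \<Rightarrow> nat \<Rightarrow> nat \<Rightarrow> nat \<Rightarrow> (nat \<Rightarrow> real) measure \<Rightarrow> real \<Rightarrow> (nat \<Rightarrow> real) \<Rightarrow> ennreal" where
  "far_evidence p0 n q J \<mu> r X =
     (\<integral>\<^sup>+\<theta>\<in>{\<theta> \<in> space (PiM {..<J} (\<lambda>_. borel)). r \<le> sampling.sqd p0 (log_spline q J \<theta>)}.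
        ennreal (sampling_model.lr p0 n (log_spline q J) \<theta> X) \<partial>\<mu>)"

context log_spline_experiment
begin

lemma far_evidence_le: "far_evidence p0 n q J \<mu> r X \<le> evidence p0 n q J \<mu> X"
  unfolding evidence_def far_evidence_def by (intro nn_integral_mono) (auto simp: indicator_def)

lemma evidence_measurable:
  "evidence p0 n q J \<mu> \<in> borel_measurable sample" "far_evidence p0 n q J \<mu> r \<in> borel_measurable sample"
proof -
  interpret mu: sigma_finite_measure \<mu> by (rule prior_sigma_finite)
  note [measurable_cong] = sets_mu
  have [measurable]: "(\<lambda>z. lr (snd z) (fst z)) \<in> borel_measurable (sample \<Otimes>\<^sub>M \<mu>)"
    using measurable_compose[OF measurable_pair_swap' measurable_param(1)[OF sets_mu]]
    by (simp_all add: split_beta')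
  show "evidence p0 n q J \<mu> \<in> borel_measurable sample" unfolding evidence_def[abs_def] by measurable
  show "far_evidence p0 n q J \<mu> r \<in> borel_measurable sample" unfolding far_evidence_def[abs_def] by measurable
qed

lemma posterior_numerator:
  assumes X: "X \<in> space sample" and "0 \<le> \<rho>"
  shows "0 \<le> (LINT p:{p \<in> space density_space. L2_dist p p0 \<ge> \<rho>}|log_spline_prior q J \<mu>. (\<Prod>i<n. p (X i)))"
    "ennreal (LINT p:{p \<in> space density_space. L2_dist p p0 \<ge> \<rho>}|log_spline_prior q J \<mu>. (\<Prod>i<n. p (X i)))
      = ennreal (\<Prod>i<n. p0 (X i)) * far_evidence p0 n q J \<mu> (\<rho>\<^sup>2) X"
proof -
  let ?T = "{\<theta> \<in> space (PiM {..<J} (\<lambda>_. borel)). \<rho>\<^sup>2 \<le> sqd (log_spline q J \<theta>)}"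
  have T: "?T \<in> sets (PiM {..<J} (\<lambda>_. borel))" by measurable
  have "log_spline q J \<theta> \<in> {p \<in> space density_space. L2_dist p p0 \<ge> \<rho>} \<longleftrightarrow> \<theta> \<in> ?T"
    if "\<theta> \<in> space (PiM {..<J} (\<lambda>_. borel))" for \<theta>
  proof -
    have "\<rho> \<le> sqrt (sqd (log_spline q J \<theta>)) \<longleftrightarrow> \<rho>\<^sup>2 \<le> sqd (log_spline q J \<theta>)"
    proof
      assume "\<rho> \<le> sqrt (sqd (log_spline q J \<theta>))"
      then have "\<rho>\<^sup>2 \<le> (sqrt (sqd (log_spline q J \<theta>)))\<^sup>2" using assms(2) by (rule power_mono)
      then show "\<rho>\<^sup>2 \<le> sqd (log_spline q J \<theta>)" by (simp only: real_sqrt_pow2[OF sqd_nonneg])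
    qed (rule real_le_rsqrt)
    then show ?thesis using that log_spline_densities by (simp add: space_density_space L2_dist_sqd)
  qed
  note * = numerator_eq[OF X L2_far_sets[OF p0_densities] T this]
  show "0 \<le> (LINT p:{p \<in> space density_space. L2_dist p p0 \<ge> \<rho>}|log_spline_prior q J \<mu>. (\<Prod>i<n. p (X i)))"
    by (rule *(1))
  show "ennreal (LINT p:{p \<in> space density_space. L2_dist p p0 \<ge> \<rho>}|log_spline_prior q J \<mu>. (\<Prod>i<n. p (X i)))
      = ennreal (\<Prod>i<n. p0 (X i)) * far_evidence p0 n q J \<mu> (\<rho>\<^sup>2) X"
    unfolding far_evidence_def by (rule *(2))
qed

end

lemma ratio_min_bound:
  fixes wa Den c :: real
  assumes "0 \<le> wa" "wa \<le> Den" "0 < c" "c \<le> Den"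
  shows "ennreal (wa / Den) \<le> min 1 (ennreal (wa / c))"
proof -
  have "wa / Den \<le> 1" using assms by simp
  moreover have "wa / Den \<le> wa / c" using assms by (intro divide_left_mono) auto
  ultimately show ?thesis by (simp add: ennreal_leI flip: ennreal_1)
qed

text \<open>If the evidence of model \<beta> is at most s, the posterior is bounded by 1 \<le> s /
  evidence. Otherwise the denominator is at least w \<beta> * P * s with P the likelihood of p0, and
  P cancels. Each summand is also at most one, which is the form \<open>bayes_test\<close>
  requires.\<close>

lemma posterior_pointwise:
  fixes \<mu> :: "real \<Rightarrow> (nat \<Rightarrow> real) measure"
  assumes A: "finite A" "\<beta> \<in> A"
    and exp: "\<And>\<alpha>. \<alpha> \<in> A \<Longrightarrow> log_spline_experiment (q \<alpha>) (J \<alpha>) M d D (\<mu> \<alpha>) P0 p0 \<Lambda>"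
    and w: "\<And>\<alpha>. \<alpha> \<in> A \<Longrightarrow> 0 < w \<alpha>" and s: "0 < s" and \<rho>: "0 \<le> \<rho>"
    and X: "X \<in> space (PiM {..<n} (\<lambda>_. P0))"
  defines "post \<equiv> posterior A w (\<lambda>\<alpha>. log_spline_prior (q \<alpha>) (J \<alpha>) (\<mu> \<alpha>)) n X {p \<in> space density_space. L2_dist p p0 \<ge> \<rho>}"
  shows "0 \<le> post"
    "ennreal post \<le> ennreal s * inverse (evidence p0 n (q \<beta>) (J \<beta>) (\<mu> \<beta>) X) +
       (\<Sum>\<alpha>\<in>A. min 1 (ennreal (w \<alpha> / (w \<beta> * s)) * far_evidence p0 n (q \<alpha>) (J \<alpha>) (\<mu> \<alpha>) (\<rho>\<^sup>2) X))"
proof -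
  define P where "P = (\<Prod>i<n. p0 (X i))"
  define a where "a \<alpha> = (LINT p:{p \<in> space density_space. L2_dist p p0 \<ge> \<rho>}|log_spline_prior (q \<alpha>) (J \<alpha>) (\<mu> \<alpha>). (\<Prod>i<n. p (X i)))" for \<alpha>
  define t where "t \<alpha> = (LINT p|log_spline_prior (q \<alpha>) (J \<alpha>) (\<mu> \<alpha>). (\<Prod>i<n. p (X i)))" for \<alpha>
  define F where "F \<alpha> = far_evidence p0 n (q \<alpha>) (J \<alpha>) (\<mu> \<alpha>) (\<rho>\<^sup>2) X" for \<alpha>
  define T where "T \<alpha> = evidence p0 n (q \<alpha>) (J \<alpha>) (\<mu> \<alpha>) X" for \<alpha>
  define Den where "Den = (\<Sum>\<alpha>\<in>A. w \<alpha> * t \<alpha>)"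
  have post: "post = (\<Sum>\<alpha>\<in>A. w \<alpha> * a \<alpha>) / Den"
    unfolding post_def posterior_def a_def t_def Den_def ..
  have P: "0 < P"
  proof -
    interpret log_spline_experiment "q \<beta>" "J \<beta>" M d D "\<mu> \<beta>" P0 p0 n \<Lambda> by (rule exp[OF A(2)])
    show ?thesis unfolding P_def by (rule prod_p0_pos[OF X])
  qed
  have a: "0 \<le> a \<alpha>" "ennreal (a \<alpha>) = ennreal P * F \<alpha>" and t: "0 \<le> t \<alpha>" "ennreal (t \<alpha>) = ennreal P * T \<alpha>"
    and FT: "F \<alpha> \<le> T \<alpha>" if "\<alpha> \<in> A" for \<alpha>
  proof -
    interpret log_spline_experiment "q \<alpha>" "J \<alpha>" M d D "\<mu> \<alpha>" P0 p0 n \<Lambda> by (rule exp[OF that])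
    show "0 \<le> a \<alpha>" "ennreal (a \<alpha>) = ennreal P * F \<alpha>"
      unfolding a_def P_def F_def by (rule posterior_numerator[OF X \<rho>])+
    show "0 \<le> t \<alpha>" "ennreal (t \<alpha>) = ennreal P * T \<alpha>"
      unfolding t_def P_def T_def evidence_def by (rule denominator_eq[OF X])+
    show "F \<alpha> \<le> T \<alpha>" unfolding F_def T_def by (rule far_evidence_le)
  qed
  have at: "a \<alpha> \<le> t \<alpha>" if "\<alpha> \<in> A" for \<alpha>
  proof -
    have "ennreal (a \<alpha>) \<le> ennreal (t \<alpha>)" unfolding a(2)[OF that] t(2)[OF that] by (intro mult_left_mono FT that) simp
    then show ?thesis using t(1)[OF that] by (simp add: ennreal_le_iff)
  qed
  have wt: "0 \<le> w \<alpha> * t \<alpha>" "w \<alpha> * a \<alpha> \<le> w \<alpha> * t \<alpha>" "0 \<le> w \<alpha> * a \<alpha>" if "\<alpha> \<in> A" for \<alpha>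
    using w[OF that] t(1)[OF that] a(1)[OF that] at[OF that] by (auto intro: mult_left_mono)
  have Den0: "0 \<le> Den" unfolding Den_def using wt by (intro sum_nonneg) auto
  have wDen: "w \<alpha> * t \<alpha> \<le> Den" if "\<alpha> \<in> A" for \<alpha>
    unfolding Den_def using that A wt by (intro member_le_sum) auto
  show "0 \<le> post" unfolding post using Den0 wt by (intro divide_nonneg_nonneg sum_nonneg) auto
  have le1: "post \<le> 1"
  proof -
    have "(\<Sum>\<alpha>\<in>A. w \<alpha> * a \<alpha>) \<le> Den" unfolding Den_def using wt by (intro sum_mono) auto
    \<comment> \<open>A vanishing denominator makes the quotient 0.\<close>
    then show ?thesis unfolding post using Den0 by (cases "Den = 0") (auto simp: divide_le_eq)
  qed
  show "ennreal post \<le> ennreal s * inverse (evidence p0 n (q \<beta>) (J \<beta>) (\<mu> \<beta>) X) +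
       (\<Sum>\<alpha>\<in>A. min 1 (ennreal (w \<alpha> / (w \<beta> * s)) * far_evidence p0 n (q \<alpha>) (J \<alpha>) (\<mu> \<alpha>) (\<rho>\<^sup>2) X))"
    unfolding T_def[symmetric] F_def[symmetric]
  proof (cases "T \<beta> \<le> ennreal s")
    case True
    have "1 \<le> ennreal s * inverse (T \<beta>)"
    proof (cases "T \<beta> = 0")
      case True
      then show ?thesis using s by (simp add: ennreal_mult_top)
    next
      case False
      have "T \<beta> \<noteq> top" using True by (auto simp: top_unique)
      then have "1 = T \<beta> * inverse (T \<beta>)" using False by (simp add: ennreal_divide_self less_top flip: divide_ennreal_def)
      also have "\<dots> \<le> ennreal s * inverse (T \<beta>)" using True by (intro mult_right_mono) auto
      finally show ?thesis .
    qed
    moreover have "ennreal post \<le> 1" using le1 by (simp add: ennreal_leI flip: ennreal_1)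
    ultimately show "ennreal post \<le> ennreal s * inverse (T \<beta>) + (\<Sum>\<alpha>\<in>A. min 1 (ennreal (w \<alpha> / (w \<beta> * s)) * F \<alpha>))"
      by (meson add_increasing2 order_trans zero_le)
  next
    case False
    have "ennreal (P * s) \<le> ennreal (t \<beta>)"
      unfolding t(2)[OF A(2)] using False P s by (simp add: ennreal_mult' mult_left_mono)
    then have "P * s \<le> t \<beta>" using t(1)[OF A(2)] by (simp add: ennreal_le_iff)
    then have "w \<beta> * (P * s) \<le> w \<beta> * t \<beta>" using w[OF A(2)] by (intro mult_left_mono) auto
    then have c: "w \<beta> * (P * s) \<le> Den" "0 < w \<beta> * (P * s)" using order_trans[OF _ wDen[OF A(2)]] w[OF A(2)] P s by auto
    have "ennreal post = ennreal (\<Sum>\<alpha>\<in>A. w \<alpha> * a \<alpha> / Den)" unfolding post by (simp add: sum_divide_distrib)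
    also have "\<dots> = (\<Sum>\<alpha>\<in>A. ennreal (w \<alpha> * a \<alpha> / Den))"
      using wt Den0 by (intro sum_ennreal[symmetric]) (auto intro: divide_nonneg_nonneg)
    also have "\<dots> \<le> (\<Sum>\<alpha>\<in>A. min 1 (ennreal (w \<alpha> / (w \<beta> * s)) * F \<alpha>))"
    proof (intro sum_mono)
      fix \<alpha> assume \<alpha>: "\<alpha> \<in> A"
      have "ennreal (w \<alpha> * a \<alpha> / Den) \<le> min 1 (ennreal (w \<alpha> * a \<alpha> / (w \<beta> * (P * s))))"
        using wt[OF \<alpha>] wDen[OF \<alpha>] c by (intro ratio_min_bound) auto
      also have "ennreal (w \<alpha> * a \<alpha> / (w \<beta> * (P * s))) = ennreal (w \<alpha> / (w \<beta> * s)) * F \<alpha>"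
      proof -
        have "w \<alpha> * a \<alpha> / (w \<beta> * (P * s)) = w \<alpha> / (w \<beta> * s) * (1 / P) * a \<alpha>" by simp
        then have "ennreal (w \<alpha> * a \<alpha> / (w \<beta> * (P * s))) = ennreal (w \<alpha> / (w \<beta> * s) * (1 / P)) * ennreal (a \<alpha>)"
          using a(1)[OF \<alpha>] by (simp only: ennreal_mult'')
        also have "\<dots> = ennreal (w \<alpha> / (w \<beta> * s)) * (ennreal (1 / P) * ennreal P) * F \<alpha>"
        proof -
          have "ennreal (w \<alpha> / (w \<beta> * s) * (1 / P)) = ennreal (w \<alpha> / (w \<beta> * s)) * ennreal (1 / P)"
            by (rule ennreal_mult'') (use P in simp)
          then show ?thesis unfolding a(2)[OF \<alpha>] by (simp only: mult.assoc)
        qed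
        also have "ennreal (1 / P) * ennreal P = 1" using P by (simp flip: ennreal_mult')
        finally show ?thesis by simp
      qed
      finally show "ennreal (w \<alpha> * a \<alpha> / Den) \<le> min 1 (ennreal (w \<alpha> / (w \<beta> * s)) * F \<alpha>)" .
    qed
    finally show "ennreal post \<le> ennreal s * inverse (T \<beta>) + (\<Sum>\<alpha>\<in>A. min 1 (ennreal (w \<alpha> / (w \<beta> * s)) * F \<alpha>))"
      by (meson add_increasing order_trans zero_le)
  qed
qed

lemma posterior_expectation:
  fixes \<mu> :: "real \<Rightarrow> (nat \<Rightarrow> real) measure"
  assumes A: "finite A" "\<beta> \<in> A"
    and exp: "\<And>\<alpha>. \<alpha> \<in> A \<Longrightarrow> log_spline_experiment (q \<alpha>) (J \<alpha>) M d D (\<mu> \<alpha>) P0 p0 \<Lambda>"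
    and w: "\<And>\<alpha>. \<alpha> \<in> A \<Longrightarrow> 0 < w \<alpha>" and s: "0 < s" and \<rho>: "0 \<le> \<rho>"
    and reg: "\<And>\<alpha>. \<alpha> \<in> A \<Longrightarrow> log_spline_experiment.regular (q \<alpha>) (J \<alpha>) M n (\<epsilon> \<alpha>)"
    and ev: "(\<integral>\<^sup>+X. inverse (evidence p0 n (q \<beta>) (J \<beta>) (\<mu> \<beta>) X) \<partial>PiM {..<n} (\<lambda>_. P0)) \<le> ennreal e"
    and e0: "0 \<le> e"
  shows "0 \<le> (LINT X|PiM {..<n} (\<lambda>_. P0). posterior A w (\<lambda>\<alpha>. log_spline_prior (q \<alpha>) (J \<alpha>) (\<mu> \<alpha>)) n X {p \<in> space density_space. L2_dist p p0 \<ge> \<rho>})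
    \<and> (LINT X|PiM {..<n} (\<lambda>_. P0). posterior A w (\<lambda>\<alpha>. log_spline_prior (q \<alpha>) (J \<alpha>) (\<mu> \<alpha>)) n X {p \<in> space density_space. L2_dist p p0 \<ge> \<rho>})
     \<le> s * e + (\<Sum>\<alpha>\<in>A. exp (- real (J \<alpha>)) + w \<alpha> / (w \<beta> * s) * ((rate_const (q \<alpha>) \<Lambda> D * \<epsilon> \<alpha>) ^ J \<alpha> * exp (- (real n * \<rho>\<^sup>2 / (64 * \<Lambda>)))))"
proof (rule integral_bounded_by_nn_integral)
  let ?N = "PiM {..<n} (\<lambda>_. P0)"
  let ?post = "\<lambda>X. posterior A w (\<lambda>\<alpha>. log_spline_prior (q \<alpha>) (J \<alpha>) (\<mu> \<alpha>)) n X {p \<in> space density_space. L2_dist p p0 \<ge> \<rho>}"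
  let ?T = "evidence p0 n (q \<beta>) (J \<beta>) (\<mu> \<beta>)"
  let ?F = "\<lambda>\<alpha>. far_evidence p0 n (q \<alpha>) (J \<alpha>) (\<mu> \<alpha>) (\<rho>\<^sup>2)"
  let ?k = "\<lambda>\<alpha>. w \<alpha> / (w \<beta> * s)"
  let ?R = "\<lambda>\<alpha>. (rate_const (q \<alpha>) \<Lambda> D * \<epsilon> \<alpha>) ^ J \<alpha> * exp (- (real n * \<rho>\<^sup>2 / (64 * \<Lambda>)))"
  note pp = posterior_pointwise[where w = w and q = q and J = J and \<mu> = \<mu>, OF A exp w s \<rho>]
  show "0 \<le> ?post X" if "X \<in> space ?N" for X by (rule pp(1)[OF _ _ that])
  have k0: "0 \<le> ?k \<alpha>" if "\<alpha> \<in> A" for \<alpha> using w[OF that] w[OF A(2)] s by simp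
  have L1: "1 \<le> \<Lambda>"
  proof -
    interpret log_spline_experiment "q \<beta>" "J \<beta>" M d D "\<mu> \<beta>" P0 p0 n \<Lambda> by (rule exp[OF A(2)])
    show ?thesis by (rule Lam1)
  qed
  have R0: "0 \<le> ?R \<alpha>" if "\<alpha> \<in> A" for \<alpha>
  proof -
    interpret log_spline_experiment "q \<alpha>" "J \<alpha>" M d D "\<mu> \<alpha>" P0 p0 n \<Lambda> by (rule exp[OF that])
    have "0 < \<epsilon> \<alpha>" using reg[OF that] unfolding regular_def by blast
    moreover have "0 \<le> rate_const (q \<alpha>) \<Lambda> D"
      unfolding rate_const_def by (intro mult_nonneg_nonneg) auto
    ultimately show ?thesis by (intro mult_nonneg_nonneg zero_le_power) auto
  qed
  have term0: "0 \<le> exp (- real (J \<alpha>)) + ?k \<alpha> * ?R \<alpha>" if "\<alpha> \<in> A" for \<alpha>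
    by (rule add_nonneg_nonneg[OF exp_ge_zero mult_nonneg_nonneg[OF k0[OF that] R0[OF that]]])
  have se0: "0 \<le> s * e" using s e0 by simp
  have sum0: "0 \<le> (\<Sum>\<alpha>\<in>A. exp (- real (J \<alpha>)) + ?k \<alpha> * ?R \<alpha>)" by (rule sum_nonneg) (rule term0)
  show "0 \<le> s * e + (\<Sum>\<alpha>\<in>A. exp (- real (J \<alpha>)) + ?k \<alpha> * ?R \<alpha>)"
    by (rule add_nonneg_nonneg[OF se0 sum0])
  have Tm [measurable]: "?T \<in> borel_measurable ?N"
  proof -
    interpret log_spline_experiment "q \<beta>" "J \<beta>" M d D "\<mu> \<beta>" P0 p0 n \<Lambda> by (rule exp[OF A(2)])
    show ?thesis by (rule evidence_measurable)
  qed
  have Fm: "?F \<alpha> \<in> borel_measurable ?N" if "\<alpha> \<in> A" for \<alpha>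
  proof -
    interpret log_spline_experiment "q \<alpha>" "J \<alpha>" M d D "\<mu> \<alpha>" P0 p0 n \<Lambda> by (rule exp[OF that])
    show ?thesis by (rule evidence_measurable)
  qed
  have Fm': "(\<lambda>X. min 1 (ennreal (?k \<alpha>) * ?F \<alpha> X)) \<in> borel_measurable ?N" if "\<alpha> \<in> A" for \<alpha>
    using Fm[OF that] by measurable
  have far: "(\<integral>\<^sup>+X. min 1 (ennreal (?k \<alpha>) * ?F \<alpha> X) \<partial>?N) \<le> ennreal (exp (- real (J \<alpha>)) + ?k \<alpha> * ?R \<alpha>)" if "\<alpha> \<in> A" for \<alpha>
  proof -
    interpret log_spline_experiment "q \<alpha>" "J \<alpha>" M d D "\<mu> \<alpha>" P0 p0 n \<Lambda> by (rule exp[OF that])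
    have "(\<integral>\<^sup>+X. min 1 (ennreal (?k \<alpha>) * ?F \<alpha> X) \<partial>?N) \<le> ennreal (exp (- real (J \<alpha>))) + ennreal (?k \<alpha>) * ennreal (?R \<alpha>)"
      unfolding far_evidence_def by (rule far_rate[OF reg[OF that]])
    also have "\<dots> = ennreal (exp (- real (J \<alpha>)) + ?k \<alpha> * ?R \<alpha>)"
      unfolding ennreal_mult[OF k0[OF that] R0[OF that], symmetric]
      by (rule ennreal_plus[symmetric, OF exp_ge_zero mult_nonneg_nonneg[OF k0[OF that] R0[OF that]]])
    finally show ?thesis .
  qed
  have "(\<integral>\<^sup>+X. ennreal (?post X) \<partial>?N) \<le> (\<integral>\<^sup>+X. ennreal s * inverse (?T X) + (\<Sum>\<alpha>\<in>A. min 1 (ennreal (?k \<alpha>) * ?F \<alpha> X)) \<partial>?N)"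
    by (intro nn_integral_mono pp(2))
  also have "\<dots> = (\<integral>\<^sup>+X. ennreal s * inverse (?T X) \<partial>?N) + (\<integral>\<^sup>+X. (\<Sum>\<alpha>\<in>A. min 1 (ennreal (?k \<alpha>) * ?F \<alpha> X)) \<partial>?N)"
    using Fm' by (intro nn_integral_add) auto
  also have "\<dots> = ennreal s * (\<integral>\<^sup>+X. inverse (?T X) \<partial>?N) + (\<Sum>\<alpha>\<in>A. \<integral>\<^sup>+X. min 1 (ennreal (?k \<alpha>) * ?F \<alpha> X) \<partial>?N)"
    using Fm' by (subst nn_integral_cmult) (auto simp: nn_integral_sum)
  also have "\<dots> \<le> ennreal s * ennreal e + (\<Sum>\<alpha>\<in>A. ennreal (exp (- real (J \<alpha>)) + ?k \<alpha> * ?R \<alpha>))"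
    by (intro add_mono mult_left_mono sum_mono ev far) auto
  also have "\<dots> = ennreal (s * e + (\<Sum>\<alpha>\<in>A. exp (- real (J \<alpha>)) + ?k \<alpha> * ?R \<alpha>))"
  proof -
    have "(\<Sum>\<alpha>\<in>A. ennreal (exp (- real (J \<alpha>)) + ?k \<alpha> * ?R \<alpha>)) = ennreal (\<Sum>\<alpha>\<in>A. exp (- real (J \<alpha>)) + ?k \<alpha> * ?R \<alpha>)"
      by (rule sum_ennreal) (rule term0)
    then show ?thesis
      unfolding ennreal_plus[OF se0 sum0] ennreal_mult[OF less_imp_le[OF s] e0] by (simp only:)
  qed
  finally show "(\<integral>\<^sup>+X. ennreal (?post X) \<partial>?N) \<le> ennreal (s * e + (\<Sum>\<alpha>\<in>A. exp (- real (J \<alpha>)) + ?k \<alpha> * ?R \<alpha>))" .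
qed

section \<open>The evidence under a smooth density\<close>

lemma sup_norm_upper:
  assumes "continuous_on {0..1} f" "x \<in> {0..1}"
  shows "\<bar>f x\<bar> \<le> sup_norm f"
proof -
  have "bdd_above ((\<lambda>x. \<bar>f x\<bar>) ` {0..1})"
    using assms(1) by (intro bounded_imp_bdd_above compact_imp_bounded compact_continuous_image continuous_on_rabs) auto
  then show ?thesis unfolding sup_norm_def using assms(2) by (intro cSUP_upper) auto
qed

lemma sup_norm_least: "(\<And>x. x \<in> {0..1} \<Longrightarrow> \<bar>f x\<bar> \<le> b) \<Longrightarrow> sup_norm f \<le> b"
  unfolding sup_norm_def by (rule cSUP_least) auto

lemma max_norm_ge: "j < J \<Longrightarrow> \<bar>\<theta> j\<bar> \<le> max_norm J \<theta>"
  unfolding max_norm_def by (intro Max_ge) auto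

context log_spline_experiment
begin

text \<open>Since the B-splines sum to one, subtracting the mean of the coefficients shifts the
  spline by a constant, which normalisation undoes. The error e is counted twice, once for the
  spline and once for the normalising constant.\<close>

lemma centred_approximation:
  assumes E: "\<And>x. x \<in> {0..1} \<Longrightarrow> \<bar>spline_comb q J \<theta> x - ln (p0 x)\<bar> \<le> e"
  defines "\<theta>' \<equiv> (\<lambda>j\<in>{..<J}. \<theta> j - (\<Sum>i<J. \<theta> i) / real J)"
  shows "\<theta>' \<in> zero_sum_hyperplane J"
    "\<And>x. x \<in> {0..1} \<Longrightarrow> \<bar>ln (log_spline q J \<theta>' x) - ln (p0 x)\<bar> \<le> 2 * e"
proof -
  let ?m = "(\<Sum>i<J. \<theta> i) / real J"
  have "(\<Sum>j<J. \<theta>' j) = (\<Sum>j<J. \<theta> j - ?m)" unfolding \<theta>'_def by (intro sum.cong) auto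
  also have "\<dots> = 0" using J1 by (simp add: sum_subtractf)
  finally show "\<theta>' \<in> zero_sum_hyperplane J" by (auto simp: zero_sum_hyperplane_def \<theta>'_def)
  fix x :: real assume x: "x \<in> {0..1}"
  have sc: "spline_comb q J \<theta>' y = spline_comb q J \<theta> y - ?m" if "y \<in> {0..1}" for y
  proof -
    have "spline_comb q J \<theta>' y = (\<Sum>j<J. (\<theta> j - ?m) * B_spline q J j y)"
      unfolding spline_comb_def \<theta>'_def by (intro sum.cong) auto
    also have "\<dots> = spline_comb q J \<theta> y - ?m * (\<Sum>j<J. B_spline q J j y)"
      unfolding spline_comb_def by (simp add: left_diff_distrib sum_subtractf sum_distrib_left)
    finally show ?thesis using B_spline_sum[OF that] by simp
  qed
  have E': "\<bar>spline_comb q J \<theta>' y - (ln (p0 y) - ?m)\<bar> \<le> e" if "y \<in> {0..1}" for y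
    using E[OF that] sc[OF that] by simp
  have "(LINT y|unit_lebesgue. exp (ln (p0 y) - ?m)) = (LINT y|unit_lebesgue. p0 y * exp (- ?m))"
    using p0_pos by (intro Bochner_Integration.integral_cong) (auto simp: exp_diff exp_minus divide_inverse)
  also have "\<dots> = exp (- ?m)" using good_p0 by (simp add: good_def)
  finally have "ln (LINT y|unit_lebesgue. exp (ln (p0 y) - ?m)) = - ?m" by simp
  then have "\<bar>log_norm_const q J \<theta>' - (- ?m)\<bar> \<le> e"
    using log_norm_const_perturb[of \<theta>' "\<lambda>y. ln (p0 y) - ?m" e] E' by auto
  then show "\<bar>ln (log_spline q J \<theta>' x) - ln (p0 x)\<bar> \<le> 2 * e"
    unfolding ln_log_spline using E'[OF x] by linarith
qed

end

text \<open>Approximation of ln p0 gives a centre with error of order \<epsilon>; stability of the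
  basis, the role of C4, turns its sup-norm bound into a bound on the coefficients, so that an
  \<epsilon>-ball around it fits into the block.\<close>

lemma evidence_rate:
  assumes \<beta>: "0 < \<beta>" "\<beta> \<le> real q" and M: "0 < M" and d: "0 < d" "d \<le> D" and C4: "0 < C4"
    and stab: "\<And>J \<theta>. q \<le> J \<Longrightarrow> (\<Sum>j<J. \<theta> j) = 0 \<Longrightarrow> C4 * max_norm J \<theta> \<le> sup_norm (\<lambda>x. ln (log_spline q J \<theta> x))"
    and prior: "\<forall>\<^sub>F n in sequentially. coefficient_prior M d D (model_dim n \<beta>) (\<mu> n)"
    and smp: "sampling P0 p0 \<Lambda>" and Lam: "exp (2 * (M + 1)) \<le> \<Lambda>"
    and hol: "p0 \<in> holder_space \<beta>" and sup: "sup_norm (\<lambda>x. ln (p0 x)) < C4 * M"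
  shows "\<exists>c>0. \<forall>\<^sub>F n in sequentially.
    (\<integral>\<^sup>+X. inverse (evidence p0 n q (model_dim n \<beta>) (\<mu> n) X) \<partial>PiM {..<n} (\<lambda>_. P0)) \<le> ennreal (1 / (c * rate n \<beta>) ^ model_dim n \<beta>)"
proof -
  have q1: "1 \<le> q" using \<beta> by (cases q) auto
  define k where "k = nat (\<lceil>\<beta>\<rceil> - 1)"
  define s where "s = \<beta> - real k"
  have c1: "1 \<le> \<lceil>\<beta>\<rceil>" using \<beta>(1) by simp
  then have rk: "real k = of_int \<lceil>\<beta>\<rceil> - 1" unfolding k_def by simp
  have s: "0 < s" "s \<le> 1" unfolding s_def rk by linarith+
  have kq: "k < q"
  proof -
    have "\<lceil>\<beta>\<rceil> \<le> int q" using \<beta>(2) by (simp add: ceiling_le_iff)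
    then show ?thesis unfolding k_def using c1 by linarith
  qed
  have p0_pos: "0 < p0 x" if "x \<in> {0..1}" for x using sampling.p0_pos[OF smp that] .
  have hc: "holder_class k s (\<lambda>x. ln (p0 x))"
    using hol p0_pos unfolding holder_space_iff k_def[symmetric] s_def[symmetric] by (intro holder_class_ln s)
  have cont: "continuous_on {0..1} (\<lambda>x. ln (p0 x))" by (rule holder_class_continuous[OF s hc])
  obtain Df L' where Df0: "Df 0 = (\<lambda>x. ln (p0 x))"
    and Df: "\<And>i x. i < k \<Longrightarrow> x \<in> {0..1} \<Longrightarrow> (Df i has_real_derivative Df (Suc i) x) (at x within {0..1})"
    and DfL: "\<And>x y. x \<in> {0..1} \<Longrightarrow> y \<in> {0..1} \<Longrightarrow> \<bar>Df k x - Df k y\<bar> \<le> L' * \<bar>x - y\<bar> powr s"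
    using hc unfolding holder_class_chain_iff by metis
  define L where "L = max L' 0"
  have L: "\<bar>Df k x - Df k y\<bar> \<le> L * \<bar>x - y\<bar> powr s" if "x \<in> {0..1}" "y \<in> {0..1}" for x y
  proof -
    have "L' * \<bar>x - y\<bar> powr s \<le> L * \<bar>x - y\<bar> powr s" by (intro mult_right_mono) (auto simp: L_def)
    then show ?thesis using DfL[OF that] by linarith
  qed
  define cE where "cE = 2 * (L * 2 ^ (q - 1)) * (2 * real q) powr \<beta>"
  have cE0: "0 \<le> cE" by (simp add: cE_def L_def)
  define S where "S = sup_norm (\<lambda>x. ln (p0 x))"
  \<comment> \<open>Positive by the strict bound on the sup norm of ln p0. It has to accommodate
    both the ball radius \<epsilon> and the error 2 e / C4, hence the condition imposed on the rate
    below.\<close>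
  define gap where "gap = M - S / C4"
  have gap: "0 < gap" using sup C4 unfolding gap_def S_def by (simp add: field_simps)
  have L1: "1 \<le> \<Lambda>" using sampling.Lam1[OF smp] .
  define H where "H = 2 * \<Lambda> ^ 3 * (2 + 2 * cE)\<^sup>2"
  define c where "c = d * exp (- H)"
  have "\<forall>\<^sub>F n in sequentially. rate n \<beta> \<le> gap / (1 + 2 * cE / C4)"
    using gap cE0 C4 by (intro eventually_rate_le \<beta>(1) divide_pos_pos) (auto intro: add_pos_nonneg)
  moreover note eventually_model_dim_ge[OF \<beta>(1), of "2 * q"] eventually_ge_at_top[of "1::nat"] prior
  ultimately have "\<forall>\<^sub>F n in sequentially.
    (\<integral>\<^sup>+X. inverse (evidence p0 n q (model_dim n \<beta>) (\<mu> n) X) \<partial>PiM {..<n} (\<lambda>_. P0)) \<le> ennreal (1 / (c * rate n \<beta>) ^ model_dim n \<beta>)"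
  proof eventually_elim
    case (elim n)
    define J where "J = model_dim n \<beta>"
    define \<epsilon> where "\<epsilon> = rate n \<beta>"
    have q2J: "2 * q \<le> J" using elim unfolding J_def by simp
    interpret sampling P0 p0 n \<Lambda> by (rule smp)
    interpret log_spline_experiment q J M d D "\<mu> n" P0 p0 n \<Lambda>
      using q1 q2J M d elim(4) Lam unfolding J_def[symmetric] by unfold_locales auto
    have eps: "0 < \<epsilon>" "\<epsilon> \<le> 1" unfolding \<epsilon>_def using rate_pos[OF \<beta>(1) elim(3)] rate_le_1[OF \<beta>(1) elim(3)] by auto
    have nJ: "real n * \<epsilon>\<^sup>2 \<le> 2 * real J" unfolding \<epsilon>_def J_def by (rule n_rate_sq_bounds[OF \<beta>(1) elim(3)])
    define e where "e = cE * \<epsilon>"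
    let ?\<theta> = "\<lambda>j. quasi_coeff Df k j (t j)"
    let ?m = "real n powr (1 / (2 * \<beta> + 1))"
    have m0: "0 < ?m" using elim(3) by simp
    \<comment> \<open>The resolution is smaller than the dimension by q - 1; J \<ge> 2 q makes the
      loss at most a factor 2, which explains 2 q in \<open>cE\<close>.\<close>
    have Km: "?m / 2 \<le> real K"
    proof -
      have "?m \<le> real J + 1" unfolding J_def by (rule model_dim_bounds[OF \<beta>(1) elim(3)])
      moreover have "real K = real J + 1 - real q" using q2J by (simp add: K_def of_nat_diff)
      ultimately show ?thesis using q2J by linarith
    qed
    have approx: "\<bar>spline_comb q J ?\<theta> x - ln (p0 x)\<bar> \<le> e" if x: "x \<in> {0..1}" for x
    proof -
      have "\<bar>spline_comb q J ?\<theta> x - Df 0 x\<bar> \<le> 2 * (L * 2 ^ (q - 1)) * (real q / real K) powr (real k + s)"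
        using Df L s kq x by (intro quasi_interpolation) (auto simp: L_def)
      also have "real k + s = \<beta>" by (simp add: s_def)
      also have "2 * (L * 2 ^ (q - 1)) * (real q / real K) powr \<beta> \<le> 2 * (L * 2 ^ (q - 1)) * (2 * real q / ?m) powr \<beta>"
      proof (intro mult_left_mono powr_mono2)
        have "real q / real K \<le> real q / (?m / 2)" using Km m0 Kpos by (intro divide_left_mono mult_pos_pos) auto
        then show "real q / real K \<le> 2 * real q / ?m" by (simp add: mult.commute)
      qed (use \<beta> in \<open>auto simp: L_def\<close>)
      also have "(2 * real q / ?m) powr \<beta> = (2 * real q) powr \<beta> * \<epsilon>"
        unfolding \<epsilon>_def rate_eq_powr[OF \<beta>(1)]
      proof -
        have "(2 * real q / y) powr \<beta> = (2 * real q) powr \<beta> * y powr (- \<beta>)" if "0 < y" for y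
          using that by (simp add: powr_divide powr_minus_divide)
        from this[OF m0] show "(2 * real q / ?m) powr \<beta> = (2 * real q) powr \<beta> * ?m powr (- \<beta>)" .
      qed
      finally show ?thesis unfolding Df0 e_def cE_def by (simp add: mult.assoc)
    qed
    define \<theta>1 where "\<theta>1 = (\<lambda>j\<in>{..<J}. ?\<theta> j - (\<Sum>i<J. ?\<theta> i) / real J)"
    have ca1: "\<theta>1 \<in> zero_sum_hyperplane J"
      unfolding \<theta>1_def by (rule centred_approximation(1)) (rule approx)
    have ca2: "\<bar>ln (log_spline q J \<theta>1 x) - ln (p0 x)\<bar> \<le> 2 * e" if "x \<in> {0..1}" for x
      unfolding \<theta>1_def by (rule centred_approximation(2)[OF _ that]) (rule approx)
    have "C4 * max_norm J \<theta>1 \<le> sup_norm (\<lambda>x. ln (log_spline q J \<theta>1 x))"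
      using ca1 q2J by (intro stab) (auto simp: zero_sum_hyperplane_def)
    also have "\<dots> \<le> S + 2 * e"
    proof (rule sup_norm_least)
      fix x :: real assume x: "x \<in> {0..1}"
      show "\<bar>ln (log_spline q J \<theta>1 x)\<bar> \<le> S + 2 * e"
        using ca2[OF x] sup_norm_upper[OF cont x] unfolding S_def by linarith
    qed
    finally have mn: "max_norm J \<theta>1 \<le> S / C4 + 2 * e / C4" using C4 by (simp add: field_simps)
    have "\<epsilon> * (1 + 2 * cE / C4) \<le> gap"
      using elim(1) C4 cE0 unfolding \<epsilon>_def[symmetric] by (subst (asm) pos_le_divide_eq) (auto intro: add_pos_nonneg)
    then have "S / C4 + 2 * e / C4 \<le> M - \<epsilon>" unfolding gap_def e_def by (simp add: algebra_simps)
    then have cube: "\<theta>1 \<in> cube J (M - \<epsilon>)"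
      unfolding cube_def using mn max_norm_ge[of _ J \<theta>1] by (auto intro: order_trans)
    have "(\<integral>\<^sup>+X. inverse (evidence p0 n q J (\<mu> n) X) \<partial>sample)
      \<le> ennreal (exp (real n * (\<Lambda> ^ 3 * (2 * \<epsilon> + 2 * e)\<^sup>2)) / (d ^ J * \<epsilon> ^ (J - 1)))"
      unfolding evidence_def by (rule evidence_lower_bound[OF eps(1) ca1 cube ca2])
    also have "\<dots> \<le> ennreal (1 / (c * \<epsilon>) ^ J)"
    proof (rule ennreal_leI)
      have "real n * (\<Lambda> ^ 3 * (2 * \<epsilon> + 2 * e)\<^sup>2) = (\<Lambda> ^ 3 * (2 + 2 * cE)\<^sup>2) * (real n * \<epsilon>\<^sup>2)"
        unfolding e_def by (simp add: power2_eq_square algebra_simps)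
      also have "\<dots> \<le> (\<Lambda> ^ 3 * (2 + 2 * cE)\<^sup>2) * (2 * real J)" using nJ L1 by (intro mult_left_mono) auto
      also have "\<dots> = real J * H" by (simp add: H_def)
      finally have "exp (real n * (\<Lambda> ^ 3 * (2 * \<epsilon> + 2 * e)\<^sup>2)) \<le> exp (real J * H)" by simp
      moreover have "d ^ J * \<epsilon> ^ J \<le> d ^ J * \<epsilon> ^ (J - 1)"
        using eps d by (intro mult_left_mono power_decreasing) auto
      ultimately have "exp (real n * (\<Lambda> ^ 3 * (2 * \<epsilon> + 2 * e)\<^sup>2)) / (d ^ J * \<epsilon> ^ (J - 1)) \<le> exp (real J * H) / (d ^ J * \<epsilon> ^ J)"
        using eps d by (intro frac_le) auto
      also have "\<dots> = 1 / (c * \<epsilon>) ^ J"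
        unfolding c_def power_mult_distrib exp_of_nat_mult[symmetric] by (simp add: exp_minus field_simps)
      finally show "exp (real n * (\<Lambda> ^ 3 * (2 * \<epsilon> + 2 * e)\<^sup>2)) / (d ^ J * \<epsilon> ^ (J - 1)) \<le> 1 / (c * \<epsilon>) ^ J" .
    qed
    finally show ?case unfolding J_def \<epsilon>_def .
  qed
  moreover have "0 < c" using d by (simp add: c_def)
  ultimately show ?thesis by blast
qed

section \<open>Comparison of the models\<close>

lemma raw_weight_pos:
  assumes "finite A" "\<And>\<alpha>. \<alpha> \<in> A \<Longrightarrow> 0 < \<alpha>" "0 < C" "1 \<le> n"
  shows "0 < raw_weight A C n \<alpha>"
  unfolding raw_weight_def
proof (rule prod_pos)
  show "0 < (C * rate n \<gamma>) ^ model_dim n \<gamma>" if "\<gamma> \<in> {\<gamma>\<in>A. \<gamma> < \<alpha>}" for \<gamma>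
    using that assms rate_pos[of \<gamma> n] by simp
qed

lemma model_weight_ratio:
  assumes "finite A" "\<And>\<alpha>. \<alpha> \<in> A \<Longrightarrow> 0 < \<alpha>" "0 < C" "1 \<le> n" "\<beta> \<in> A"
  shows "0 < model_weight A C n \<alpha>"
    "model_weight A C n \<alpha> / (model_weight A C n \<beta> * s) = raw_weight A C n \<alpha> / (raw_weight A C n \<beta> * s)"
proof -
  have "0 < (\<Sum>\<gamma>\<in>A. raw_weight A C n \<gamma>)"
    using assms by (intro sum_pos raw_weight_pos) auto
  then show "0 < model_weight A C n \<alpha>"
    "model_weight A C n \<alpha> / (model_weight A C n \<beta> * s) = raw_weight A C n \<alpha> / (raw_weight A C n \<beta> * s)"
    unfolding model_weight_def using raw_weight_pos[OF assms(1-4)] by auto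
qed

lemma raw_weight_split:
  assumes "finite A" "\<beta> \<in> A" "\<beta> < \<alpha>"
  shows "raw_weight A C n \<alpha> = raw_weight A C n \<beta> *
    ((C * rate n \<beta>) ^ model_dim n \<beta> * (\<Prod>\<gamma>\<in>{\<gamma>\<in>A. \<beta> < \<gamma> \<and> \<gamma> < \<alpha>}. (C * rate n \<gamma>) ^ model_dim n \<gamma>))"
proof -
  define f where "f \<gamma> = (C * rate n \<gamma>) ^ model_dim n \<gamma>" for \<gamma>
  have "{\<gamma>\<in>A. \<gamma> < \<alpha>} = {\<gamma>\<in>A. \<gamma> < \<beta>} \<union> insert \<beta> {\<gamma>\<in>A. \<beta> < \<gamma> \<and> \<gamma> < \<alpha>}"
    using assms by auto
  then have "prod f {\<gamma>\<in>A. \<gamma> < \<alpha>} = prod f ({\<gamma>\<in>A. \<gamma> < \<beta>} \<union> insert \<beta> {\<gamma>\<in>A. \<beta> < \<gamma> \<and> \<gamma> < \<alpha>})"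
    by (rule arg_cong)
  also have "\<dots> = prod f {\<gamma>\<in>A. \<gamma> < \<beta>} * prod f (insert \<beta> {\<gamma>\<in>A. \<beta> < \<gamma> \<and> \<gamma> < \<alpha>})"
    using assms(1) by (intro prod.union_disjoint) auto
  also have "prod f (insert \<beta> {\<gamma>\<in>A. \<beta> < \<gamma> \<and> \<gamma> < \<alpha>}) = f \<beta> * prod f {\<gamma>\<in>A. \<beta> < \<gamma> \<and> \<gamma> < \<alpha>}"
    using assms(1) by (intro prod.insert) auto
  finally show ?thesis unfolding raw_weight_def f_def .
qed

lemma power_mult_exp_neg: "(c * r) ^ k * exp (- real k) = (c / exp 1 * r) ^ k" for c r :: real
proof -
  have "exp (- real k) = exp (- 1) ^ k" by (simp flip: exp_of_nat_mult)
  moreover have "c / exp 1 * r = c * r * exp (- 1)" by (simp add: exp_minus divide_inverse)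
  ultimately show ?thesis by (simp only: power_mult_distrib)
qed

text \<open>Budget in units of J_\<alpha>: each of at most card A intermediate weights costs 1 /
  (card A + 1), and so does the evidence threshold, one unit in all. The choice C \<ge> R exp 2
  gains two units, and one remains. From E only E \<le> 1 is used.\<close>

lemma model_term_smaller:
  fixes c R E :: real
  assumes "finite A" "\<And>\<alpha>. \<alpha> \<in> A \<Longrightarrow> 0 < \<alpha>" "\<alpha> \<in> A" "\<beta> \<in> A" "\<alpha> < \<beta>" "0 < C" "0 < c" "0 < R"
    and C: "R * exp 2 \<le> C"
    and n: "1 \<le> n"
    and inter: "\<And>\<gamma>. \<gamma> \<in> A \<Longrightarrow> \<alpha> < \<gamma> \<Longrightarrow> 1 / (C * rate n \<gamma>) ^ model_dim n \<gamma> \<le> exp (1 / (real (card A) + 1) * real (model_dim n \<alpha>))"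
    and den: "1 / (c / exp 1 * rate n \<beta>) ^ model_dim n \<beta> \<le> exp (1 / (real (card A) + 1) * real (model_dim n \<alpha>))"
    and E: "0 \<le> E" "E \<le> 1"
  shows "raw_weight A C n \<alpha> / (raw_weight A C n \<beta> * ((c * rate n \<beta>) ^ model_dim n \<beta> * exp (- real (model_dim n \<beta>))))
     * ((R * rate n \<alpha>) ^ model_dim n \<alpha> * E) \<le> exp (- real (model_dim n \<alpha>))"
proof -
  let ?J = "model_dim n \<alpha>" and ?\<tau> = "1 / (real (card A) + 1)"
  let ?I = "{\<gamma>\<in>A. \<alpha> < \<gamma> \<and> \<gamma> < \<beta>}"
  define Q where "Q = (\<Prod>\<gamma>\<in>?I. (C * rate n \<gamma>) ^ model_dim n \<gamma>)"
  define rw where "rw = raw_weight A C n \<alpha>"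
  define x where "x = (C * rate n \<alpha>) ^ ?J"
  define y where "y = (c / exp 1 * rate n \<beta>) ^ model_dim n \<beta>"
  have ra: "0 < rate n \<alpha>" using assms rate_pos by auto
  have rw: "0 < rw" unfolding rw_def using assms by (intro raw_weight_pos) auto
  have x: "0 < x" unfolding x_def using assms ra by auto
  have y: "0 < y" unfolding y_def using assms rate_pos[of \<beta> n] by auto
  have Qp: "0 < Q" unfolding Q_def using assms rate_pos by (intro prod_pos) auto
  have card: "card ?I \<le> card A" using assms(1) by (intro card_mono) auto
  have "1 / Q = (\<Prod>\<gamma>\<in>?I. 1 / (C * rate n \<gamma>) ^ model_dim n \<gamma>)"
    unfolding Q_def by (simp add: prod_dividef)
  also have "\<dots> \<le> (\<Prod>\<gamma>\<in>?I. exp (?\<tau> * real ?J))"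
    using inter assms rate_pos by (intro prod_mono) (auto intro!: divide_nonneg_nonneg zero_le_power mult_nonneg_nonneg less_imp_le)
  also have "\<dots> = exp (real (card ?I) * (?\<tau> * real ?J))" by (simp only: prod_constant exp_of_nat_mult)
  also have "\<dots> \<le> exp (real (card A) * (?\<tau> * real ?J))"
    using card unfolding exp_le_cancel_iff by (intro mult_right_mono) auto
  finally have Q: "1 / Q \<le> exp (real (card A) * (?\<tau> * real ?J))" .
  have sy: "(c * rate n \<beta>) ^ model_dim n \<beta> * exp (- real (model_dim n \<beta>)) = y"
    unfolding y_def by (rule power_mult_exp_neg)
  have "rw / (raw_weight A C n \<beta> * y) * ((R * rate n \<alpha>) ^ ?J * E) = (1 / Q) * (1 / y) * ((R * rate n \<alpha>) ^ ?J / x) * E"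
    unfolding raw_weight_split[OF assms(1,3,5)] rw_def[symmetric] x_def[symmetric] Q_def[symmetric]
    using rw by simp
  also have "\<dots> \<le> exp (real (card A) * (?\<tau> * real ?J)) * exp (?\<tau> * real ?J) * exp (- (2 * real ?J)) * 1"
  proof (intro mult_mono Q E)
    show "1 / y \<le> exp (?\<tau> * real ?J)" using den unfolding y_def .
    have "(R * rate n \<alpha>) ^ ?J / x = (R / C) ^ ?J"
      unfolding x_def using ra assms(6) by (simp add: power_mult_distrib power_divide)
    also have "\<dots> \<le> (exp (- 2)) ^ ?J"
      using C assms by (intro power_mono) (auto simp: exp_minus field_simps)
    also have "\<dots> = exp (- (2 * real ?J))" by (simp add: mult.commute flip: exp_of_nat_mult)
    finally show "(R * rate n \<alpha>) ^ ?J / x \<le> exp (- (2 * real ?J))" .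
  qed (use Qp y x ra assms in auto)
  also have "\<dots> = exp (real (card A) * (?\<tau> * real ?J) + ?\<tau> * real ?J - 2 * real ?J)"
    by (simp flip: exp_add)
  also have "real (card A) * (?\<tau> * real ?J) + ?\<tau> * real ?J - 2 * real ?J = - real ?J"
  proof -
    have "a * (1 / (a + 1) * x) + 1 / (a + 1) * x - 2 * x = - x" if "0 \<le> a" for a x :: real
    proof -
      have "(a + 1) * (1 / (a + 1)) = 1" using that by simp
      then have "((a + 1) * (1 / (a + 1))) * x - 2 * x = - x" by simp
      then show ?thesis by (simp only: distrib_right mult_1_left mult.assoc)
    qed
    then show ?thesis by simp
  qed
  finally show ?thesis unfolding sy rw_def .
qed

text \<open>For \<alpha> > \<beta> the weight ratio is at most (C \<epsilon>_\<beta>)^J_\<beta> and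
  the volume factor at most one; for \<alpha> = \<beta> the volume factor itself is (R
  \<epsilon>_\<beta>)^J_\<beta>. Dividing by the evidence threshold leaves at most Z^J_\<beta>,
  which E outweighs.\<close>

lemma model_term_larger:
  fixes c R E :: real
  assumes "finite A" "\<And>\<alpha>. \<alpha> \<in> A \<Longrightarrow> 0 < \<alpha>" "\<alpha> \<in> A" "\<beta> \<in> A" "\<beta> \<le> \<alpha>" "0 < C" "0 < c" "0 < R" "1 \<le> n"
    and small: "\<And>\<gamma>. \<gamma> \<in> A \<Longrightarrow> C * rate n \<gamma> \<le> 1" "R * rate n \<alpha> \<le> 1"
    and Z: "C * exp 1 / c \<le> Z" "\<alpha> = \<beta> \<Longrightarrow> R * exp 1 / c \<le> Z"
    and E: "0 \<le> E" "E \<le> exp (- (1 + \<bar>ln Z\<bar>) * real (model_dim n \<beta>))"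
  shows "raw_weight A C n \<alpha> / (raw_weight A C n \<beta> * ((c * rate n \<beta>) ^ model_dim n \<beta> * exp (- real (model_dim n \<beta>))))
     * ((R * rate n \<alpha>) ^ model_dim n \<alpha> * E) \<le> exp (- real (model_dim n \<beta>))"
proof -
  let ?J = "model_dim n \<beta>"
  have Z0: "0 < Z" using Z(1) assms by (auto intro: less_le_trans[of 0 "C * exp 1 / c"])
  have rb: "0 < rate n \<beta>" using assms rate_pos by auto
  have ra: "0 < rate n \<alpha>" using assms rate_pos by auto
  have main: "raw_weight A C n \<alpha> / raw_weight A C n \<beta> * (R * rate n \<alpha>) ^ model_dim n \<alpha> \<le> (Z * (c / exp 1) * rate n \<beta>) ^ ?J"
  proof (cases "\<alpha> = \<beta>")
    case True
    have "R \<le> Z * (c / exp 1)" using Z(2)[OF True] assms by (simp add: field_simps)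
    then have "(R * rate n \<beta>) ^ ?J \<le> (Z * (c / exp 1) * rate n \<beta>) ^ ?J"
      using assms rb by (intro power_mono mult_right_mono) auto
    then show ?thesis using True raw_weight_pos[OF assms(1,2,6,9), of \<beta>] by simp
  next
    case False
    then have lt: "\<beta> < \<alpha>" using assms(5) by simp
    let ?P = "\<Prod>\<gamma>\<in>{\<gamma>\<in>A. \<beta> < \<gamma> \<and> \<gamma> < \<alpha>}. (C * rate n \<gamma>) ^ model_dim n \<gamma>"
    have nn: "0 \<le> C * rate n \<gamma>" if "\<gamma> \<in> A" for \<gamma> using that assms rate_pos[of \<gamma> n] by auto
    have P: "?P \<le> 1" "0 \<le> ?P"
      using small(1) nn by (auto intro!: prod_le_1 prod_nonneg power_le_one)
    have R: "(R * rate n \<alpha>) ^ model_dim n \<alpha> \<le> 1" using small(2) assms ra by (intro power_le_one) auto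
    have "C \<le> Z * (c / exp 1)" using Z(1) assms by (simp add: field_simps)
    then have CZ: "(C * rate n \<beta>) ^ ?J \<le> (Z * (c / exp 1) * rate n \<beta>) ^ ?J"
      using assms rb by (intro power_mono mult_right_mono) auto
    have "raw_weight A C n \<alpha> / raw_weight A C n \<beta> = (C * rate n \<beta>) ^ ?J * ?P"
      unfolding raw_weight_split[OF assms(1,4) lt] using raw_weight_pos[OF assms(1,2,6,9), of \<beta>] by simp
    then have "raw_weight A C n \<alpha> / raw_weight A C n \<beta> * (R * rate n \<alpha>) ^ model_dim n \<alpha> = (C * rate n \<beta>) ^ ?J * ?P * (R * rate n \<alpha>) ^ model_dim n \<alpha>"
      by simp
    also have "\<dots> \<le> (C * rate n \<beta>) ^ ?J * 1 * 1"
      using P R rb ra assms by (intro mult_mono) auto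
    finally show ?thesis using CZ by simp
  qed
  have y: "(c * rate n \<beta>) ^ ?J * exp (- real ?J) = (c / exp 1 * rate n \<beta>) ^ ?J"
    by (rule power_mult_exp_neg)
  have y0: "0 < (c / exp 1 * rate n \<beta>) ^ ?J" using assms rb by simp
  have "raw_weight A C n \<alpha> / (raw_weight A C n \<beta> * ((c * rate n \<beta>) ^ ?J * exp (- real ?J))) * ((R * rate n \<alpha>) ^ model_dim n \<alpha> * E)
    = (raw_weight A C n \<alpha> / raw_weight A C n \<beta> * (R * rate n \<alpha>) ^ model_dim n \<alpha>) / (c / exp 1 * rate n \<beta>) ^ ?J * E"
    unfolding y by simp
  also have "\<dots> \<le> (Z * (c / exp 1) * rate n \<beta>) ^ ?J / (c / exp 1 * rate n \<beta>) ^ ?J * exp (- (1 + \<bar>ln Z\<bar>) * real ?J)"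
    using main y0 E Z0 assms rb by (intro mult_mono divide_right_mono) auto
  also have "(Z * (c / exp 1) * rate n \<beta>) ^ ?J / (c / exp 1 * rate n \<beta>) ^ ?J = Z ^ ?J"
  proof -
    have "(Z * (c / exp 1) * rate n \<beta>) ^ ?J = Z ^ ?J * (c / exp 1 * rate n \<beta>) ^ ?J"
      by (simp only: power_mult_distrib mult.assoc)
    moreover have "Z ^ ?J * y / y = Z ^ ?J" if "0 < y" for y using that by simp
    ultimately show ?thesis using y0 by metis
  qed
  also have "Z ^ ?J = exp (ln Z * real ?J)" using Z0 by (simp add: exp_of_nat2_mult)
  also have "exp (ln Z * real ?J) * exp (- (1 + \<bar>ln Z\<bar>) * real ?J) = exp ((ln Z - \<bar>ln Z\<bar>) * real ?J - real ?J)"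
    by (simp add: algebra_simps flip: exp_add)
  also have "\<dots> \<le> exp (- real ?J)"
    by (simp add: mult_nonpos_nonneg)
  finally show ?thesis .
qed

section \<open>Hypotheses of the experiment and the final assembly\<close>

lemma sampling_from_holder:
  assumes "prob_space P0" "P0 = density unit_lebesgue (\<lambda>x. ennreal (p0 x))"
    and hol: "p0 \<in> holder_space \<beta>" "0 < \<beta>" and pos: "\<And>x. x \<in> {0..1} \<Longrightarrow> 0 < p0 x"
    and sup: "sup_norm (\<lambda>x. ln (p0 x)) \<le> S" and Lam: "exp S \<le> \<Lambda>" "1 \<le> \<Lambda>"
  shows "sampling P0 p0 \<Lambda>"
proof (rule sampling.intro)
  let ?k = "nat (\<lceil>\<beta>\<rceil> - 1)"
  have "1 \<le> \<lceil>\<beta>\<rceil>" using hol(2) by simp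
  then have rk: "real ?k = of_int \<lceil>\<beta>\<rceil> - 1" by simp
  have s: "0 < \<beta> - real ?k" "\<beta> - real ?k \<le> 1" unfolding rk by linarith+
  have cont: "continuous_on {0..1} p0"
    using hol(1) unfolding holder_space_iff by (rule holder_class_continuous[OF s])
  then have "p0 \<in> borel_measurable (restrict_space borel {0..1})"
    by (rule borel_measurable_continuous_on_restrict)
  then show "p0 \<in> borel_measurable unit_lebesgue"
    unfolding unit_lebesgue_def by (simp add: measurable_cong_sets sets_restrict_space)
  have lcont: "continuous_on {0..1} (\<lambda>x. ln (p0 x))"
    using cont pos by (intro continuous_on_ln) (auto simp: less_imp_neq[symmetric])
  fix x :: real assume x: "x \<in> {0..1}"
  have b: "\<bar>ln (p0 x)\<bar> \<le> S" using sup_norm_upper[OF lcont x] sup by linarith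
  have "p0 x = exp (ln (p0 x))" using pos[OF x] by simp
  moreover have "exp (ln (p0 x)) \<le> exp S" "exp (- S) \<le> exp (ln (p0 x))" using b by (auto simp only: exp_le_cancel_iff abs_le_iff)
  moreover have "1 / \<Lambda> \<le> 1 / exp S" using Lam by (intro divide_left_mono) auto
  ultimately show "1 / \<Lambda> \<le> p0 x \<and> p0 x \<le> \<Lambda>" using Lam by (simp add: exp_minus inverse_eq_divide)
qed (fact assms)+

lemma log_spline_experimentI:
  assumes "sampling P0 p0 \<Lambda>" "1 \<le> q" "q \<le> J" "coefficient_prior M d D J \<mu>"
    and "0 < M" "0 < d" "d \<le> D" "exp (2 * (M + 1)) \<le> \<Lambda>"
  shows "log_spline_experiment q J M d D \<mu> P0 p0 \<Lambda>"
proof -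
  interpret sampling P0 p0 n \<Lambda> by (rule assms(1))
  show ?thesis by unfold_locales (fact assms)+
qed

lemma rate_regular:
  assumes "log_spline_experiment q (model_dim n \<alpha>) M d D \<mu> P0 p0 \<Lambda>" "0 < \<alpha>" "1 \<le> n" "q + 1 \<le> model_dim n \<alpha>"
    and "real (model_dim n \<alpha>) * (2 * (M + 1)) ^ (2 * q) / rate n \<alpha> ^ (1 + 2 * q) \<le> exp (real (model_dim n \<alpha>))"
  shows "log_spline_experiment.regular q (model_dim n \<alpha>) M n (rate n \<alpha>)"
proof -
  interpret log_spline_experiment q "model_dim n \<alpha>" M d D \<mu> P0 p0 n \<Lambda> by (rule assms(1))
  have "2 \<le> K" using assms(4) by (simp add: K_def)
  then show ?thesis
    unfolding regular_def
    by (intro conjI assms(3,5) rate_pos[OF assms(2,3)] rate_le_1[OF assms(2,3)] n_rate_sq_bounds[OF assms(2,3)])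
qed

text \<open>\<open>C\<^sub>0\<close> is fixed before \<beta> and p0, because the constants R depend
  only on the spline orders, M, C4 and D. B is chosen last, as it depends on C and on the evidence
  constant of p0.\<close>

theorem theorem5p2:
  fixes A :: "real set" and q :: "real \<Rightarrow> nat" and C4 M d D :: real
    and Pibar :: "nat \<Rightarrow> real \<Rightarrow> (nat \<Rightarrow> real) measure"
  assumes "finite A" and "\<And>\<alpha>. \<alpha> \<in> A \<Longrightarrow> 0 < \<alpha>"
    and "0 < M" and "0 < d" and "d \<le> D"
    and "\<And>\<alpha>. \<alpha> \<in> A \<Longrightarrow> \<alpha> \<le> real (q \<alpha>)"
    and "0 < C4"
    and "\<And>\<alpha> J \<theta>. \<alpha> \<in> A \<Longrightarrow> q \<alpha> \<le> J \<Longrightarrow> (\<Sum>j<J. \<theta> j) = 0 \<Longrightarrow>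
           C4 * max_norm J \<theta> \<le> sup_norm (\<lambda>x. ln (log_spline (q \<alpha>) J \<theta> x))"
    and "\<And>n \<alpha>. (\<forall>\<gamma>\<in>A. q \<gamma> \<le> model_dim n \<gamma>) \<Longrightarrow> \<alpha> \<in> A \<Longrightarrow>
           coefficient_prior M d D (model_dim n \<alpha>) (Pibar n \<alpha>)"
  shows "\<exists>C\<^sub>0>0. \<forall>C\<ge>C\<^sub>0. \<forall>\<beta>\<in>A. \<forall>(P0 :: real measure) (p0 :: real \<Rightarrow> real).
           prob_space P0 \<longrightarrow> P0 = density unit_lebesgue (\<lambda>x. ennreal (p0 x)) \<longrightarrow>
           p0 \<in> holder_space \<beta> \<longrightarrow> (\<forall>x\<in>{0..1}. 0 < p0 x) \<longrightarrow>
           sup_norm (\<lambda>x. ln (p0 x)) < C4 * M \<longrightarrow>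
           (\<exists>B. (\<lambda>n. LINT X|PiM {..<n} (\<lambda>_. P0).
                    posterior A (model_weight A C n)
                      (\<lambda>\<alpha>. log_spline_prior (q \<alpha>) (model_dim n \<alpha>) (Pibar n \<alpha>)) n X
                      {p \<in> space density_space. L2_dist p p0 \<ge> B * rate n \<beta>})
                \<longlonglongrightarrow> 0)"
proof -
  note A = assms(1,2) and M = assms(3) and d = assms(4,5) and q = assms(6) and C4 = assms(7)
    and stab = assms(8) and prior = assms(9)
  \<comment> \<open>One bound for both kinds of densities: 2 (M + 1) covers the log splines of the
    enlarged cube and C4 M covers ln p0.\<close>
  define \<Lambda> where "\<Lambda> = exp (2 * (M + 1) + C4 * M)"
  have L1: "1 \<le> \<Lambda>" using M C4 unfolding \<Lambda>_def by simp
  have LamM: "exp (2 * (M + 1)) \<le> \<Lambda>" and LamC: "exp (C4 * M) \<le> \<Lambda>" using M C4 unfolding \<Lambda>_def by simp_all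
  define R where "R \<alpha> = rate_const (q \<alpha>) \<Lambda> D" for \<alpha>
  have R0: "0 < R \<alpha>" for \<alpha>
    unfolding R_def rate_const_def using base_const_ge_1[OF L1, of "q \<alpha>"] by (intro mult_pos_pos) auto
  \<comment> \<open>A sum instead of a maximum, so that C \<ge> R \<alpha> * exp 2 for every
    \<alpha> at once.\<close>
  define C0 where "C0 = 1 + (\<Sum>\<alpha>\<in>A. R \<alpha> * exp 2)"
  have C0: "0 < C0" unfolding C0_def using R0 by (intro add_pos_nonneg sum_nonneg) (auto intro: less_imp_le)
  have q1: "1 \<le> q \<alpha>" if "\<alpha> \<in> A" for \<alpha> using q[OF that] A(2)[OF that] by (cases "q \<alpha>") auto
  have dims: "\<forall>\<^sub>F n in sequentially. \<forall>\<gamma>\<in>A. q \<gamma> + 1 \<le> model_dim n \<gamma>"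
    using A eventually_model_dim_ge by (intro eventually_ball_finite) auto
  have priors: "\<forall>\<^sub>F n in sequentially. \<forall>\<alpha>\<in>A. coefficient_prior M d D (model_dim n \<alpha>) (Pibar n \<alpha>)"
    using dims by eventually_elim (auto intro!: prior)
  have "\<exists>B. (\<lambda>n. LINT X|PiM {..<n} (\<lambda>_. P0).
                    posterior A (model_weight A C n)
                      (\<lambda>\<alpha>. log_spline_prior (q \<alpha>) (model_dim n \<alpha>) (Pibar n \<alpha>)) n X
                      {p \<in> space density_space. L2_dist p p0 \<ge> B * rate n \<beta>})
                \<longlonglongrightarrow> 0"
    if C: "C0 \<le> C" and \<beta>: "\<beta> \<in> A" and P0: "prob_space P0" "P0 = density unit_lebesgue (\<lambda>x. ennreal (p0 x))"
      and hol: "p0 \<in> holder_space \<beta>" and pos: "\<forall>x\<in>{0..1}. 0 < p0 x" and sup: "sup_norm (\<lambda>x. ln (p0 x)) < C4 * M"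
    for C \<beta> and P0 :: "real measure" and p0 :: "real \<Rightarrow> real"
  proof -
    have C_pos: "0 < C" using C C0 by simp
    have RC: "R \<alpha> * exp 2 \<le> C" if "\<alpha> \<in> A" for \<alpha>
    proof -
      have "R \<alpha> * exp 2 \<le> (\<Sum>\<alpha>\<in>A. R \<alpha> * exp 2)"
        using that A(1) R0 by (intro member_le_sum[of \<alpha> A "\<lambda>\<alpha>. R \<alpha> * exp 2"]) (auto intro: less_imp_le)
      then show ?thesis using C unfolding C0_def by linarith
    qed
    have smp: "sampling P0 p0 \<Lambda>"
      using pos sup LamC L1 by (intro sampling_from_holder[OF P0 hol A(2)[OF \<beta>]]) auto
    have "\<forall>\<^sub>F n in sequentially. coefficient_prior M d D (model_dim n \<beta>) (Pibar n \<beta>)"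
      using priors by eventually_elim (use \<beta> in auto)
    from evidence_rate[OF A(2)[OF \<beta>] q[OF \<beta>] M d C4 stab[OF \<beta>] this smp LamM hol sup]
    obtain c where c: "0 < c" and ev: "\<forall>\<^sub>F n in sequentially.
      (\<integral>\<^sup>+X. inverse (evidence p0 n (q \<beta>) (model_dim n \<beta>) (Pibar n \<beta>) X) \<partial>PiM {..<n} (\<lambda>_. P0)) \<le> ennreal (1 / (c * rate n \<beta>) ^ model_dim n \<beta>)"
      by blast
    define Z where "Z = max (C * exp 1 / c) (R \<beta> * exp 1 / c)"
    \<comment> \<open>Solves B^2 / (64 \<Lambda>) = 1 + \<bar>ln Z\<bar>; as n \<epsilon>_\<beta>^2
      \<ge> J_\<beta>, the exponential factor then beats Z^J_\<beta> and leaves exp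
      (-J_\<beta>).\<close>
    define B where "B = sqrt (64 * \<Lambda> * (1 + \<bar>ln Z\<bar>))"
    have B0: "0 \<le> B" and B2: "B\<^sup>2 = 64 * \<Lambda> * (1 + \<bar>ln Z\<bar>)" using L1 by (auto simp: B_def)
    let ?L = "\<lambda>n. LINT X|PiM {..<n} (\<lambda>_. P0). posterior A (model_weight A C n)
                      (\<lambda>\<alpha>. log_spline_prior (q \<alpha>) (model_dim n \<alpha>) (Pibar n \<alpha>)) n X
                      {p \<in> space density_space. L2_dist p p0 \<ge> B * rate n \<beta>}"
    let ?U = "\<lambda>n. exp (- real (model_dim n \<beta>)) + (\<Sum>\<alpha>\<in>A. 2 * exp (- real (model_dim n \<alpha>)) + exp (- real (model_dim n \<beta>)))"
    have polys: "\<forall>\<^sub>F n in sequentially. \<forall>\<alpha>\<in>A. real (model_dim n \<alpha>) * (2 * (M + 1)) ^ (2 * q \<alpha>) / rate n \<alpha> ^ (1 + 2 * q \<alpha>) \<le> exp (real (model_dim n \<alpha>))"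
      using A M by (intro eventually_ball_finite ballI eventually_polynomial_le_exp) auto
    have smallC: "\<forall>\<^sub>F n in sequentially. \<forall>\<alpha>\<in>A. rate n \<alpha> \<le> 1 / C"
      using A C_pos by (intro eventually_ball_finite ballI eventually_rate_le) auto
    have smallR: "\<forall>\<^sub>F n in sequentially. \<forall>\<alpha>\<in>A. rate n \<alpha> \<le> 1 / R \<alpha>"
      using A R0 by (intro eventually_ball_finite ballI eventually_rate_le) auto
    let ?\<tau> = "1 / (real (card A) + 1)"
    have inter: "\<forall>\<^sub>F n in sequentially. \<forall>\<alpha>\<in>A. \<forall>\<gamma>\<in>A. \<alpha> < \<gamma> \<longrightarrow> 1 / (C * rate n \<gamma>) ^ model_dim n \<gamma> \<le> exp (?\<tau> * real (model_dim n \<alpha>))"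
    proof (intro eventually_ball_finite ballI A(1))
      fix \<alpha> \<gamma> assume "\<alpha> \<in> A" "\<gamma> \<in> A"
      then show "\<forall>\<^sub>F n in sequentially. \<alpha> < \<gamma> \<longrightarrow> 1 / (C * rate n \<gamma>) ^ model_dim n \<gamma> \<le> exp (?\<tau> * real (model_dim n \<alpha>))"
        using A(2) C_pos eventually_inverse_rate_power_le[of \<alpha> \<gamma> C ?\<tau>] by (cases "\<alpha> < \<gamma>") auto
    qed
    have den: "\<forall>\<^sub>F n in sequentially. \<forall>\<alpha>\<in>A. \<alpha> < \<beta> \<longrightarrow> 1 / (c / exp 1 * rate n \<beta>) ^ model_dim n \<beta> \<le> exp (?\<tau> * real (model_dim n \<alpha>))"
    proof (intro eventually_ball_finite ballI A(1))
      fix \<alpha> assume "\<alpha> \<in> A"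
      then show "\<forall>\<^sub>F n in sequentially. \<alpha> < \<beta> \<longrightarrow> 1 / (c / exp 1 * rate n \<beta>) ^ model_dim n \<beta> \<le> exp (?\<tau> * real (model_dim n \<alpha>))"
        using A(2) c eventually_inverse_rate_power_le[of \<alpha> \<beta> "c / exp 1" ?\<tau>] by (cases "\<alpha> < \<beta>") auto
    qed
    have bounds: "\<forall>\<^sub>F n in sequentially. 0 \<le> ?L n \<and> ?L n \<le> ?U n"
      using dims priors ev polys smallC smallR inter den eventually_ge_at_top[of "1::nat"]
    proof eventually_elim
      case (elim n)
      note n1 = elim(9)
      let ?J = "model_dim n" and ?w = "model_weight A C n"
        and ?E = "exp (- (real n * (B * rate n \<beta>)\<^sup>2 / (64 * \<Lambda>)))"
      \<comment> \<open>The threshold for the evidence lies a factor exp (-J_\<beta>) below (c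
        \<epsilon>_\<beta>)^J_\<beta>. The event of smaller evidence then costs only exp
        (-J_\<beta>), while in the other terms the loss merely turns c into c / exp 1.\<close>
      define s where "s = (c * rate n \<beta>) ^ ?J \<beta> * exp (- real (?J \<beta>))"
      have rb: "0 < rate n \<beta>" using rate_pos A(2)[OF \<beta>] n1 by blast
      have s: "0 < s" using c rb by (simp add: s_def)
      have ex: "log_spline_experiment (q \<alpha>) (?J \<alpha>) M d D (Pibar n \<alpha>) P0 p0 \<Lambda>" if "\<alpha> \<in> A" for \<alpha>
        using bspec[OF elim(1) that]
        by (intro log_spline_experimentI[OF smp q1[OF that] _ bspec[OF elim(2) that] M d LamM]) linarith
      have reg: "log_spline_experiment.regular (q \<alpha>) (?J \<alpha>) M n (rate n \<alpha>)" if "\<alpha> \<in> A" for \<alpha>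
        by (rule rate_regular[OF ex[OF that] A(2)[OF that] n1 bspec[OF elim(1) that] bspec[OF elim(4) that]])
      have post: "0 \<le> ?L n \<and> ?L n \<le> s * (1 / (c * rate n \<beta>) ^ ?J \<beta>) +
        (\<Sum>\<alpha>\<in>A. exp (- real (?J \<alpha>)) + ?w \<alpha> / (?w \<beta> * s) * ((R \<alpha> * rate n \<alpha>) ^ ?J \<alpha> * ?E))"
        unfolding R_def
      proof (rule posterior_expectation[where J = ?J and q = q and \<epsilon> = "rate n" and \<mu> = "Pibar n", OF A(1) \<beta> ex _ s _ reg elim(3)])
        show "0 < ?w \<alpha>" if "\<alpha> \<in> A" for \<alpha>
          by (rule model_weight_ratio(1)[OF A C_pos n1 that])
        show "0 \<le> B * rate n \<beta>" using B0 rb by simp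
        show "0 \<le> 1 / (c * rate n \<beta>) ^ ?J \<beta>" using c rb by simp
      qed
      have wr: "?w \<alpha> / (?w \<beta> * s) = raw_weight A C n \<alpha> / (raw_weight A C n \<beta> * s)" for \<alpha>
        by (rule model_weight_ratio(2)[OF A C_pos n1 \<beta>])
      have Eb: "?E \<le> exp (- (1 + \<bar>ln Z\<bar>) * real (?J \<beta>))"
      proof -
        have "real n * (B * rate n \<beta>)\<^sup>2 / (64 * \<Lambda>) = (1 + \<bar>ln Z\<bar>) * (real n * (rate n \<beta>)\<^sup>2)"
          unfolding power_mult_distrib B2 using L1 by (simp add: field_simps)
        moreover have "(1 + \<bar>ln Z\<bar>) * real (?J \<beta>) \<le> (1 + \<bar>ln Z\<bar>) * (real n * (rate n \<beta>)\<^sup>2)"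
          using n_rate_sq_bounds(1)[OF A(2)[OF \<beta>] n1] by (intro mult_left_mono) auto
        ultimately have "- (real n * (B * rate n \<beta>)\<^sup>2 / (64 * \<Lambda>)) \<le> - (1 + \<bar>ln Z\<bar>) * real (?J \<beta>)"
          unfolding mult_minus_left by linarith
        then show ?thesis by (simp only: exp_le_cancel_iff)
      qed
      have "0 \<le> real n * (B * rate n \<beta>)\<^sup>2 / (64 * \<Lambda>)" using L1 by (intro divide_nonneg_nonneg mult_nonneg_nonneg) auto
      then have E1: "?E \<le> 1" unfolding exp_le_one_iff by linarith
      have t: "?w \<alpha> / (?w \<beta> * s) * ((R \<alpha> * rate n \<alpha>) ^ ?J \<alpha> * ?E)
        \<le> exp (- real (?J \<alpha>)) + exp (- real (?J \<beta>))" if \<alpha>: "\<alpha> \<in> A" for \<alpha>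
      proof (cases "\<alpha> < \<beta>")
        case True
        have "?w \<alpha> / (?w \<beta> * s) * ((R \<alpha> * rate n \<alpha>) ^ ?J \<alpha> * ?E) \<le> exp (- real (?J \<alpha>))"
          unfolding wr unfolding s_def
        proof (rule model_term_smaller[OF A \<alpha> \<beta> True C_pos c R0 RC[OF \<alpha>] n1])
          show "1 / (C * rate n \<gamma>) ^ ?J \<gamma> \<le> exp (?\<tau> * real (?J \<alpha>))" if "\<gamma> \<in> A" "\<alpha> < \<gamma>" for \<gamma>
            using elim(7) \<alpha> that by blast
          show "1 / (c / exp 1 * rate n \<beta>) ^ ?J \<beta> \<le> exp (?\<tau> * real (?J \<alpha>))"
            using elim(8) \<alpha> True by blast
        qed (assumption | rule exp_ge_zero E1)+
        then show ?thesis using exp_ge_zero[of "- real (?J \<beta>)"] by linarith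
      next
        case False
        have "?w \<alpha> / (?w \<beta> * s) * ((R \<alpha> * rate n \<alpha>) ^ ?J \<alpha> * ?E) \<le> exp (- real (?J \<beta>))"
          unfolding wr unfolding s_def
        proof (rule model_term_larger[OF A \<alpha> \<beta> _ C_pos c R0 n1])
          show "\<beta> \<le> \<alpha>" using False by simp
          show "C * rate n \<gamma> \<le> 1" if "\<gamma> \<in> A" for \<gamma>
            using bspec[OF elim(5) that] C_pos by (simp only: pos_le_divide_eq mult.commute)
          show "R \<alpha> * rate n \<alpha> \<le> 1" using bspec[OF elim(6) \<alpha>] R0[of \<alpha>] by (simp only: pos_le_divide_eq mult.commute)
          show "C * exp 1 / c \<le> Z" by (simp add: Z_def)
          show "R \<alpha> * exp 1 / c \<le> Z" if "\<alpha> = \<beta>" using that by (simp add: Z_def)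
        qed (assumption | rule exp_ge_zero Eb)+
        then show ?thesis using exp_ge_zero[of "- real (?J \<alpha>)"] by linarith
      qed
      have "s * (1 / (c * rate n \<beta>) ^ ?J \<beta>) = exp (- real (?J \<beta>))" using c rb by (simp add: s_def)
      moreover have "(\<Sum>\<alpha>\<in>A. exp (- real (?J \<alpha>)) + ?w \<alpha> / (?w \<beta> * s) * ((R \<alpha> * rate n \<alpha>) ^ ?J \<alpha> * ?E))
        \<le> (\<Sum>\<alpha>\<in>A. 2 * exp (- real (?J \<alpha>)) + exp (- real (?J \<beta>)))"
      proof (rule sum_mono)
        show "exp (- real (?J \<alpha>)) + ?w \<alpha> / (?w \<beta> * s) * ((R \<alpha> * rate n \<alpha>) ^ ?J \<alpha> * ?E)
          \<le> 2 * exp (- real (?J \<alpha>)) + exp (- real (?J \<beta>))" if "\<alpha> \<in> A" for \<alpha>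
          using t[OF that] by linarith
      qed
      ultimately have "s * (1 / (c * rate n \<beta>) ^ ?J \<beta>) +
        (\<Sum>\<alpha>\<in>A. exp (- real (?J \<alpha>)) + ?w \<alpha> / (?w \<beta> * s) * ((R \<alpha> * rate n \<alpha>) ^ ?J \<alpha> * ?E)) \<le> ?U n"
        by (simp only: add_left_mono)
      with post show ?case by (blast intro: order_trans)
    qed
    have "?U \<longlonglongrightarrow> 0 + (\<Sum>\<alpha>\<in>A. 2 * 0 + 0)"
      using A \<beta> by (intro tendsto_intros exp_neg_model_dim_tendsto) auto
    then have U: "?U \<longlonglongrightarrow> 0" by simp
    have "?L \<longlonglongrightarrow> 0"
      by (rule tendsto_sandwich[OF _ _ tendsto_const U]) (use bounds in \<open>auto elim: eventually_mono\<close>)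
    then show ?thesis ..
  qed
  then show ?thesis using C0 by blast
qed

end
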